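(* Let $n>1$ be an integer and $\alpha>-1$. Put $$C_{\alpha,n}=\frac{\Gamma(2+n+\alpha)}{\Gamma^2\left((2+n+\alpha)/2\right)}$$ and $$\ell(t)=(n+1+\alpha)\int_{\mathbb{B}}\frac{|(1-w_1)\cos t+w_2\sin t|}{|w_1-1|^{n+1+\alpha}}\,dv_\alpha(w).$$ Then $$\ell(\pi/2)=\frac{\pi}{2}\,\ell(0)=\frac{\pi}{2}\,C_{\alpha,n}.$$ For the $\tilde\beta$-(semi)norm of the Bergman projection $P_\alpha$ we have $$\|P_\alpha\|_{\tilde\beta}=\max_{0\le t\le \pi/2}\ell(t)$$ and $$\frac{\pi}{2}\,C_{\alpha,n}\le\|P_\alpha\|_{\tilde\beta}\le\frac{\sqrt{\pi^2+4}}{2}\,C_{\alpha,n}.$$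
   Context: Here $\langle z,w\rangle=z_1\overline{w}_1+\dots+z_n\overline{w}_n$ is the inner product on $\mathbb{C}^n$, $|z|=\langle z,z\rangle^{1/2}$, $\mathbb{B}=\{z\in\mathbb{C}^n:|z|<1\}$, and $w=(w_1,\dots,w_n)$. $dv$ is the volume (Lebesgue) measure normalized so that $v(\mathbb{B})=1$, and for $\alpha>-1$, $dv_\alpha(z)=c_\alpha(1-|z|^2)^\alpha dv(z)$ with $c_\alpha=\binom{n+\alpha}{n}=\frac{\Gamma(n+\alpha+1)}{\Gamma(n+1)\Gamma(\alpha+1)}$, so that $v_\alpha(\mathbb{B})=1$. $\Gamma$ is Euler's Gamma function. $L^\infty(\mathbb{B})$ is the space of essentially bounded complex-valued measurable functions on $\mathbb{B}$, with norm $\|\cdot\|_\infty$. For $a\in\mathbb{B}\setminus\{0\}$ the involutive automorphism $\varphi_a$ of $\mathbb{B}$ is $$\varphi_a(\omega)=\frac{a-\frac{\langle\omega,a\rangle}{|a|^2}a-(1-|a|^2)^{1/2}\left(\omega-\frac{\langle\omega,a\rangle}{|a|^2}a\right)}{1-\langle\omega,a\rangle},$$ and $\varphi_0(\omega)=-\omega$; thus $\varphi_a(0)=a$. For a holomorphic function $f$ on $\mathbb{B}$, $\nabla f=\left(\frac{\partial f}{\partial z_1},\dots,\frac{\partial f}{\partial z_n}\right)$ is the complex gradient, the invariant gradient is $\tilde\nabla f(z)=\nabla(f\circ\varphi_z)(0)$, and $\|f\|_{\tilde\beta}=\sup_{z\in\mathbb{B}}|\tilde\nabla f(z)|$. The Bergman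 projection is $$P_\alpha g(z)=\int_{\mathbb{B}}\frac{g(w)}{(1-\langle z,w\rangle)^{n+1+\alpha}}\,dv_\alpha(w),\quad z\in\mathbb{B},\ g\in L^\infty(\mathbb{B}),$$ and $\|P_\alpha\|_{\tilde\beta}=\sup\{\|P_\alpha g\|_{\tilde\beta}: g\in L^\infty(\mathbb{B}),\ \|g\|_\infty\le1\}$. *)

theory Defs
  imports "HOL-Probability.Essential_Supremum"
begin

text \<open>Throughout, \<open>\<complex>\<^sup>n\<close> is \<open>complex^'n\<close> with \<open>n = CARD('n)\<close>. Its library norm is \<open>|z|\<close>, and
  \<open>ball 0 1\<close> is the unit ball; the library inner product \<open>\<bullet>\<close>, however, is only the real part of
  the Hermitian one.\<close>

definition hinner :: "complex^'n \<Rightarrow> complex^'n \<Rightarrow> complex" where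
  "hinner z w = (\<Sum>k\<in>UNIV. z $ k * cnj (w $ k))"

definition v_measure :: "(complex^'n) measure" where
  "v_measure = uniform_measure (lebesgue_on (ball 0 1)) (ball 0 1)"

definition c_const :: "nat \<Rightarrow> real \<Rightarrow> real" where
  "c_const n \<alpha> = Gamma (real n + \<alpha> + 1) / (Gamma (real n + 1) * Gamma (\<alpha> + 1))"

definition v_alpha :: "real \<Rightarrow> (complex^'n) measure" where
  "v_alpha \<alpha> = density v_measure
     (\<lambda>z. ennreal (c_const CARD('n) \<alpha> * (1 - (norm z)\<^sup>2) powr \<alpha>))"

definition Linf_norm :: "(complex^'n \<Rightarrow> complex) \<Rightarrow> ereal" where
  "Linf_norm g = esssup v_measure (\<lambda>w. ereal (cmod (g w)))"

definition Linf :: "(complex^'n \<Rightarrow> complex) set" where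
  "Linf = {g. g \<in> borel_measurable v_measure \<and> Linf_norm g < \<infinity>}"

definition phi :: "complex^'n \<Rightarrow> complex^'n \<Rightarrow> complex^'n" where
  "phi a \<omega> =
     (if a = 0 then - \<omega>
      else let p = (hinner \<omega> a / of_real ((norm a)\<^sup>2)) *s a
           in (1 / (1 - hinner \<omega> a)) *s
                (a - p - of_real (sqrt (1 - (norm a)\<^sup>2)) *s (\<omega> - p)))"

definition complex_gradient :: "(complex^'n \<Rightarrow> complex) \<Rightarrow> complex^'n \<Rightarrow> complex^'n" where
  "complex_gradient f z = (\<chi> k. deriv (\<lambda>\<zeta>. f (z + axis k \<zeta>)) 0)"

definition invariant_gradient :: "(complex^'n \<Rightarrow> complex) \<Rightarrow> complex^'n \<Rightarrow> complex^'n" where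
  "invariant_gradient f z = complex_gradient (f \<circ> phi z) 0"

definition bloch_seminorm :: "(complex^'n \<Rightarrow> complex) \<Rightarrow> ereal" where
  "bloch_seminorm f = (SUP z\<in>ball 0 1. ereal (norm (invariant_gradient f z)))"

text \<open>The complex power is the principal one; \<open>1 - hinner z w\<close> has positive real part on the ball.\<close>

definition bergman_projection ::
    "real \<Rightarrow> (complex^'n \<Rightarrow> complex) \<Rightarrow> complex^'n \<Rightarrow> complex" where
  "bergman_projection \<alpha> g z =
     (LINT w|v_alpha \<alpha>. g w / (1 - hinner z w) powr of_real (real CARD('n) + 1 + \<alpha>))"

definition bergman_bloch_norm :: "'n::finite itself \<Rightarrow> real \<Rightarrow> ereal" where
  "bergman_bloch_norm _ \<alpha> =
     (SUP g\<in>{g \<in> Linf. Linf_norm g \<le> 1}.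
        bloch_seminorm (bergman_projection \<alpha> (g :: complex^'n \<Rightarrow> complex)))"

definition C_const :: "real \<Rightarrow> nat \<Rightarrow> real" where
  "C_const \<alpha> n = Gamma (2 + real n + \<alpha>) / (Gamma ((2 + real n + \<alpha>) / 2))\<^sup>2"

text \<open>The finite type \<open>'n\<close> has no distinguished elements, so the two coordinates \<open>w\<^sub>1\<close>, \<open>w\<^sub>2\<close> are
  given by indices \<open>i\<close>, \<open>j\<close>.\<close>

definition ell :: "'n::finite \<Rightarrow> 'n \<Rightarrow> real \<Rightarrow> real \<Rightarrow> real" where
  "ell i j \<alpha> t = (real CARD('n) + 1 + \<alpha>) *
     (LINT w|(v_alpha \<alpha> :: (complex^'n) measure).
        cmod ((1 - w $ i) * of_real (cos t) + w $ j * of_real (sin t)) /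
        cmod (w $ i - 1) powr (real CARD('n) + 1 + \<alpha>))"

end

theory Submission
  imports Defs "HOL-Probability.Probability_Measure" "HOL-Complex_Analysis.Conformal_Mappings"
begin

text \<open>
  Put \<open>N = n + 1 + \<alpha>\<close>. Differentiating under the integral sign turns
  \<open>\<langle>\<zeta>, cnj (\<nabla>(P g \<circ> \<phi>\<^sub>z)(0))\<rangle>\<close> into an integral of \<open>g\<close> against an explicit kernel, so by
  duality the norm is the supremum of the \<open>L\<^sup>1\<close> norms \<open>F(z, \<zeta>)\<close> of these kernels over
  \<open>|z| < 1\<close>, \<open>|\<zeta>| = 1\<close>. The kernel sees \<open>w\<close> only through its components along \<open>z\<close> and along
  the part of \<open>\<zeta>\<close> orthogonal to \<open>z\<close>; unitary invariance therefore makes \<open>F\<close> an integral over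
  \<open>\<complex>\<^sup>2\<close> against the joint law of \<open>(w\<^sub>1, w\<^sub>2)\<close>, whose density is a multiple of
  \<open>(1 - |x|\<^sup>2 - |y|\<^sup>2)\<close> to the power \<open>N - 3\<close>. A ball automorphism, applied in two variables,
  brings it to the form \<open>N \<integral> |a (x - r) + b y| / |1 - r x|\<^sup>N\<close> with \<open>r = |z|\<close>. Its integrand is the
  modulus of a function holomorphic in \<open>r\<close>, so the Poisson formula bounds it by its value at
  \<open>r = 1\<close>, which is \<open>\<ell>(t)\<close> for \<open>|a| = cos t\<close>, \<open>|b| = sin t\<close>; Fatou's lemma shows that
  this value is approached as \<open>r\<close> tends to 1. The values at \<open>t = 0\<close> and \<open>t = \<pi>/2\<close> are Beta integrals
  after a Cayley transform to the half plane, and the upper bound is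
  \<open>\<ell>(t) \<le> \<ell>(0) cos t + \<ell>(\<pi>/2) sin t\<close> with Cauchy-Schwarz.
\<close>

section \<open>Change of variables\<close>

text \<open>In the variables where the kernel arises, its two directional factors
  \<open>1 - r\<^sup>2\<close> and \<open>sqrt (1 - r\<^sup>2)\<close> vanish as r tends to 1 while
  the denominator degenerates. The automorphism absorbs both and leaves an integrand that still
  makes sense at r = 1. The Poisson average then runs over the whole unit circle, but a rotation of
  x and y gives every boundary point the same integral, so it is the average of a constant.
  Convergence at the boundary is not known in advance, hence the extended nonnegative integrals, for
  which Tonelli and Fatou hold without integrability. Finiteness comes only from the two explicit
  end point values, whose integrands dominate those of all other t by the triangle inequality. Both
  end points share the factor Beta(1/2, N/2); their ratio pi/2 is due to the Beta factors that
  remain besides it. The lower bound is the value at t = pi/2, and the constant of the upper bound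
  is the length of the vector (1, pi/2).\<close>

lemma absolutely_integrable_iff_nn_integral:
  fixes f :: "'a::euclidean_space \<Rightarrow> real"
  assumes f: "(\<lambda>x. indicator S x * f x) \<in> borel_measurable borel" and nonneg: "\<And>x. x \<in> S \<Longrightarrow> 0 \<le> f x"
  shows "f absolutely_integrable_on S \<longleftrightarrow> (\<integral>\<^sup>+x. ennreal (indicator S x * f x) \<partial>lborel) < \<infinity>"
    and "f absolutely_integrable_on S \<Longrightarrow>
      (\<integral>\<^sup>+x. ennreal (indicator S x * f x) \<partial>lborel) = ennreal (integral S f)"
proof -
  have int: "f absolutely_integrable_on S \<longleftrightarrow> integrable lborel (\<lambda>x. indicator S x * f x)"
    unfolding set_integrable_def using f by (simp add: integrable_completion)
  have nn: "0 \<le> indicator S x * f x" for x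
    using nonneg by (auto simp: indicator_def)
  show "f absolutely_integrable_on S \<longleftrightarrow> (\<integral>\<^sup>+x. ennreal (indicator S x * f x) \<partial>lborel) < \<infinity>"
    unfolding int integrable_iff_bounded using f nn by simp
  assume a: "f absolutely_integrable_on S"
  then have "(\<integral>\<^sup>+x. ennreal (indicator S x * f x) \<partial>lborel) = ennreal (LINT x|lborel. indicator S x * f x)"
    using int nn by (intro nn_integral_eq_integral) auto
  also have "(LINT x|lborel. indicator S x * f x) = (LINT x:S|lebesgue. f x)"
    unfolding set_lebesgue_integral_def using f by (simp add: integral_completion)
  also have "\<dots> = integral S f"
    using set_lebesgue_integral_eq_integral(2)[OF a] .
  finally show "(\<integral>\<^sup>+x. ennreal (indicator S x * f x) \<partial>lborel) = ennreal (integral S f)" .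
qed

text \<open>Substitution theorems for absolutely integrable functions give one equivalence for every
  candidate value b. With b the integral of f this yields equality of finite values; if f is not
  integrable then neither is g, and both sides are infinite.\<close>

lemma nn_integral_eq_if_absolutely_integrable_iff:
  fixes f :: "'a::euclidean_space \<Rightarrow> real" and g :: "'b::euclidean_space \<Rightarrow> real"
  assumes "(\<lambda>x. indicator S x * f x) \<in> borel_measurable borel" "\<And>x. x \<in> S \<Longrightarrow> 0 \<le> f x"
    and "(\<lambda>x. indicator T x * g x) \<in> borel_measurable borel" "\<And>x. x \<in> T \<Longrightarrow> 0 \<le> g x"
    and iff: "\<And>b. f absolutely_integrable_on S \<and> integral S f = b \<longleftrightarrow>
      g absolutely_integrable_on T \<and> integral T g = b"
  shows "(\<integral>\<^sup>+x. ennreal (indicator S x * f x) \<partial>lborel) = (\<integral>\<^sup>+x. ennreal (indicator T x * g x) \<partial>lborel)"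
proof (cases "f absolutely_integrable_on S")
  case True
  then show ?thesis
    using iff[of "integral S f"] absolutely_integrable_iff_nn_integral(2)[OF assms(1,2)]
      absolutely_integrable_iff_nn_integral(2)[OF assms(3,4)] by auto
next
  case False
  then have "\<not> g absolutely_integrable_on T"
    using iff[of "integral T g"] by auto
  then show ?thesis
    using False absolutely_integrable_iff_nn_integral(1)[OF assms(1,2)]
      absolutely_integrable_iff_nn_integral(1)[OF assms(3,4)] by (simp add: not_less top_unique)
qed

lemma nn_integral_change_of_variables_vec:
  fixes f :: "real^'m::{finite,wellorder} \<Rightarrow> real" and g :: "real^'m::_ \<Rightarrow> real^'m::_"
  assumes S: "S \<in> sets borel"
    and der: "\<And>x. x \<in> S \<Longrightarrow> (g has_derivative g' x) (at x within S)"
    and inj: "inj_on g S" and nonneg: "\<And>x. 0 \<le> f x"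
    and meas: "(\<lambda>x. indicator (g ` S) x * f x) \<in> borel_measurable borel"
      "(\<lambda>x. indicator S x * (\<bar>det (matrix (g' x))\<bar> * f (g x))) \<in> borel_measurable borel"
  shows "(\<integral>\<^sup>+x. ennreal (indicator (g ` S) x * f x) \<partial>lborel) =
    (\<integral>\<^sup>+x. ennreal (indicator S x * (\<bar>det (matrix (g' x))\<bar> * f (g x))) \<partial>lborel)"
proof (rule nn_integral_eq_if_absolutely_integrable_iff[OF meas(1) _ meas(2)])
  fix b
  have "S \<in> sets lebesgue" using S by auto
  \<comment> \<open>The substitution theorem speaks of vector-valued functions, so f is embedded
    into \<open>real^1\<close> by \<open>vec\<close>.\<close>
  then have "(\<lambda>x. \<bar>det (matrix (g' x))\<bar> *\<^sub>R (vec (f (g x)) :: real^1)) absolutely_integrable_on S \<and>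
           integral S (\<lambda>x. \<bar>det (matrix (g' x))\<bar> *\<^sub>R (vec (f (g x)) :: real^1)) = vec b
     \<longleftrightarrow> (\<lambda>x. vec (f x) :: real^1) absolutely_integrable_on (g ` S) \<and> integral (g ` S) (\<lambda>x. vec (f x) :: real^1) = vec b"
    by (intro has_absolute_integral_change_of_variables der inj)
  then show "f absolutely_integrable_on g ` S \<and> integral (g ` S) f = b \<longleftrightarrow>
    (\<lambda>x. \<bar>det (matrix (g' x))\<bar> * f (g x)) absolutely_integrable_on S \<and>
    integral S (\<lambda>x. \<bar>det (matrix (g' x))\<bar> * f (g x)) = b"
    by (simp add: absolutely_integrable_on_1_iff integral_on_1_eq)
qed (auto simp: nonneg)

text \<open>The plane is needed in two real models: pairs for iterated integration and, in the next
  lemma, \<open>real^2\<close> for the determinant in the substitution rule. Lebesgue measure is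
  recognised by its values on boxes.\<close>

lemma lborel_complex_distr_pair:
  "(lborel :: complex measure) = distr (lborel :: (real \<times> real) measure) borel (\<lambda>p. Complex (fst p) (snd p))"
proof (rule lborel_eqI)
  have m: "(\<lambda>p. Complex (fst p) (snd p)) \<in> borel_measurable borel"
    by (simp add: borel_measurable_complex_iff borel_prod[symmetric])
  fix l u :: complex assume "\<And>b. b \<in> Basis \<Longrightarrow> l \<bullet> b \<le> u \<bullet> b"
  from this[of 1] this[of \<i>] have lu: "Re l \<le> Re u" "Im l \<le> Im u" by (auto simp: Basis_complex_def)
  have "(\<lambda>p. Complex (fst p) (snd p)) -` box l u = box (Re l, Im l) (Re u, Im u)"
    by (auto simp: box_def Basis_complex_def Basis_prod_def)
  then show "emeasure (distr (lborel :: (real \<times> real) measure) borel (\<lambda>p. Complex (fst p) (snd p))) (box l u)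
    = (\<Prod>b\<in>Basis. (u - l) \<bullet> b)"
    using m lu by (subst emeasure_distr) (auto simp: emeasure_lborel_box_eq Basis_complex_def Basis_prod_def)
qed simp

lemma lborel_complex_distr_vec:
  "(lborel :: complex measure) = distr (lborel :: (real^2) measure) borel (\<lambda>v. Complex (v $ 1) (v $ 2))"
proof (rule lborel_eqI)
  have m: "(\<lambda>v::real^2. Complex (v $ 1) (v $ 2)) \<in> borel_measurable borel"
    by (simp add: borel_measurable_complex_iff)
  fix l u :: complex assume "\<And>b. b \<in> Basis \<Longrightarrow> l \<bullet> b \<le> u \<bullet> b"
  from this[of 1] this[of \<i>] have lu: "Re l \<le> Re u" "Im l \<le> Im u" by (auto simp: Basis_complex_def)
  have B: "(Basis :: (real^2) set) = {axis 1 1, axis 2 1}"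
    by (auto simp: Basis_vec_def exhaust_2) (metis (full_types) exhaust_2)
  have "(\<lambda>v::real^2. Complex (v $ 1) (v $ 2)) -` box l u = box (vector [Re l, Im l]) (vector [Re u, Im u])"
    by (auto simp: box_def Basis_complex_def B inner_axis)
  moreover have "axis 1 (1::real) \<noteq> (axis 2 1 :: real^2)" by (simp add: axis_eq_axis)
  ultimately show "emeasure (distr (lborel :: (real^2) measure) borel (\<lambda>v. Complex (v $ 1) (v $ 2))) (box l u)
    = (\<Prod>b\<in>Basis. (u - l) \<bullet> b)"
    using m lu by (subst emeasure_distr) (auto simp: emeasure_lborel_box_eq Basis_complex_def B inner_axis)
qed simp

lemma nn_integral_complex_Re_Im:
  assumes [measurable]: "f \<in> borel_measurable borel"
  shows "(\<integral>\<^sup>+z. f z \<partial>lborel) = (\<integral>\<^sup>+x. \<integral>\<^sup>+y. f (Complex x y) \<partial>lborel \<partial>lborel)"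
proof -
  have [measurable]: "(\<lambda>p. Complex (fst p) (snd p)) \<in> borel_measurable (borel \<Otimes>\<^sub>M borel)"
    by (simp add: borel_measurable_complex_iff)
  have "(\<integral>\<^sup>+z. f z \<partial>lborel) = (\<integral>\<^sup>+p. f (Complex (fst p) (snd p)) \<partial>(lborel \<Otimes>\<^sub>M lborel))"
    unfolding lborel_prod by (subst lborel_complex_distr_pair, subst nn_integral_distr) (auto simp: borel_prod[symmetric])
  also have "\<dots> = (\<integral>\<^sup>+x. \<integral>\<^sup>+y. f (Complex x y) \<partial>lborel \<partial>lborel)"
    by (subst lborel.nn_integral_fst[symmetric]) auto
  finally show ?thesis .
qed

text \<open>The real Jacobian of a holomorphic map is |g'|^2 by the Cauchy-Riemann equations, and
  the open mapping theorem makes the image of S open, hence measurable. The real rule is applied to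
  g conjugated with the coordinate map from \<open>real^2\<close>.\<close>

lemma nn_integral_holomorphic_change_of_variables:
  fixes f :: "complex \<Rightarrow> real" and g :: "complex \<Rightarrow> complex"
  assumes S: "open S" and der: "\<And>z. z \<in> S \<Longrightarrow> (g has_field_derivative g' z) (at z)"
    and inj: "inj_on g S" and nonneg: "\<And>z. 0 \<le> f z" and f[measurable]: "f \<in> borel_measurable borel"
  shows "(\<integral>\<^sup>+z. ennreal (indicator (g ` S) z * f z) \<partial>lborel) =
    (\<integral>\<^sup>+z. ennreal (indicator S z * ((cmod (g' z))\<^sup>2 * f (g z))) \<partial>lborel)"
proof -
  define T where "T = (\<lambda>v::real^2. Complex (v $ 1) (v $ 2))"
  define R where "R = (\<lambda>z. vector [Re z, Im z] :: real^2)"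
  have TR[simp]: "T (R z) = z" "R (T v) = v" for z v
    by (auto simp: T_def R_def vec_eq_iff exhaust_2 forall_2)
  have T[measurable]: "T \<in> borel_measurable borel" unfolding T_def
    by (simp add: borel_measurable_complex_iff)
  have Tlin: "bounded_linear T"
    unfolding T_def
    by (rule linear_conv_bounded_linear[THEN iffD1]) (auto intro!: linearI simp: complex_eq_iff)
  have Rlin: "bounded_linear R"
    unfolding R_def
    by (rule linear_conv_bounded_linear[THEN iffD1]) (auto intro!: linearI simp: vec_eq_iff forall_2)
  have hol: "g holomorphic_on S"
    using der S by (auto simp: holomorphic_on_open)
  have contg: "continuous_on S g" using hol by (rule holomorphic_on_imp_continuous_on)
  have g'e: "g' z = deriv g z" if "z \<in> S" for z using der[OF that] by (simp add: DERIV_imp_deriv)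
  have contg': "continuous_on S g'"
    using holomorphic_on_imp_continuous_on[OF holomorphic_deriv[OF hol S]] g'e
    by (simp cong: continuous_on_cong)
  have og: "open (g ` S)" using open_mapping_thm3[OF hol S inj] by auto
  let ?g = "\<lambda>v. R (g (T v))"
  let ?g' = "\<lambda>v h. R (g' (T v) * T h)"
  let ?S = "R ` S"
  have Sv: "?S = T -` S" by (auto simp: image_iff) (metis TR)
  have oS: "open ?S" unfolding Sv
    using S by (intro continuous_open_vimage allI) (auto intro: linear_continuous_at[OF Tlin])
  have gS: "?g ` ?S = R ` (g ` S)" by (auto simp: image_image)
  have gSv: "?g ` ?S = T -` (g ` S)" unfolding gS by (auto simp: image_iff) (metis TR)
  have detg: "\<bar>det (matrix (?g' v))\<bar> = (cmod (g' (T v)))\<^sup>2" for v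
    unfolding det_2 matrix_def T_def R_def
    by (simp add: axis_def cmod_power2) (simp add: power2_eq_square)
  have derv: "(?g has_derivative ?g' v) (at v within ?S)" if "v \<in> ?S" for v
  proof -
    have "(g has_derivative (\<lambda>h. g' (T v) * h)) (at (T v))"
      using der[of "T v"] that by (auto simp: has_field_derivative_def)
    then have "((\<lambda>v. g (T v)) has_derivative (\<lambda>h. g' (T v) * T h)) (at v)"
      using bounded_linear_imp_has_derivative[OF Tlin, of "at v"]
      by (rule has_derivative_compose[rotated])
    then have "(?g has_derivative ?g' v) (at v)"
      by (rule bounded_linear.has_derivative[OF Rlin])
    then show ?thesis by (rule has_derivative_at_withinI)
  qed
  have injv: "inj_on ?g ?S"
    using inj by (auto simp: inj_on_def) (metis TR)
  have m1: "(\<lambda>v. indicator (?g ` ?S) v * f (T v)) \<in> borel_measurable borel"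
  proof -
    have [measurable]: "?g ` ?S \<in> sets borel"
      unfolding gSv using measurable_sets[OF T, of "g ` S"] og by auto
    show ?thesis by measurable
  qed
  have m2c: "(\<lambda>z. indicator S z * ((cmod (g' z))\<^sup>2 * f (g z))) \<in> borel_measurable borel"
  proof -
    have [measurable]: "S \<in> sets borel" using S by simp
    \<comment> \<open>Off S nothing is known about \<open>g\<close> and \<open>g'\<close>; they are
      set to 0 there, which the indicator hides.\<close>
    have [measurable]: "(\<lambda>z. if z \<in> S then g z else 0) \<in> borel_measurable borel"
      "(\<lambda>z. if z \<in> S then g' z else 0) \<in> borel_measurable borel"
      using contg contg' S by (auto intro!: borel_measurable_continuous_on_if continuous_intros)
    have "(\<lambda>z. indicator S z * ((cmod (if z \<in> S then g' z else 0))\<^sup>2 * f (if z \<in> S then g z else 0))) \<in> borel_measurable borel"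
      by measurable
    then show ?thesis by (rule measurable_cong[THEN iffD1, rotated]) (auto simp: indicator_def)
  qed
  have "(\<lambda>v. indicator S (T v) * ((cmod (g' (T v)))\<^sup>2 * f (g (T v)))) \<in> borel_measurable borel"
    using measurable_compose[OF T m2c] .
  then have m2: "(\<lambda>v. indicator ?S v * (\<bar>det (matrix (?g' v))\<bar> * f (T (?g v)))) \<in> borel_measurable borel"
    unfolding detg Sv by (simp add: indicator_def)
  have "(\<integral>\<^sup>+v. ennreal (indicator (?g ` ?S) v * f (T v)) \<partial>lborel) =
    (\<integral>\<^sup>+v. ennreal (indicator ?S v * (\<bar>det (matrix (?g' v))\<bar> * f (T (?g v)))) \<partial>lborel)"
    using oS by (intro nn_integral_change_of_variables_vec derv injv m1 m2) (auto simp: nonneg)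
  then have *: "(\<integral>\<^sup>+v. ennreal (indicator (g ` S) (T v) * f (T v)) \<partial>lborel) =
    (\<integral>\<^sup>+v. ennreal (indicator S (T v) * ((cmod (g' (T v)))\<^sup>2 * f (g (T v)))) \<partial>lborel)"
    unfolding detg gSv unfolding Sv by (simp add: indicator_def)
  have [measurable]: "g ` S \<in> sets borel" using og by simp
  note [measurable] = m2c
  show ?thesis
    by (subst (1 2) lborel_complex_distr_vec, subst (1 2) nn_integral_distr)
       (use * T in \<open>simp_all add: T_def\<close>)
qed

text \<open>With \<open>B\<close> the unit ball, Fubini and translation invariance give \<open>|U\<^sup>-\<^sup>1 A| |B| = |A| |U\<^sup>-\<^sup>1 B|\<close>, and an
  isometry preserves \<open>B\<close>; no determinant is needed.\<close>

lemma lborel_distr_isometry: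
  fixes U :: "'a::euclidean_space \<Rightarrow> 'a"
  assumes U: "linear U" and iso: "\<And>x. norm (U x) = norm x"
  shows "distr lborel borel U = lborel"
proof (rule measure_eqI)
  have blU: "bounded_linear U" using U by (simp add: linear_conv_bounded_linear)
  have [measurable]: "U \<in> borel_measurable borel"
    using blU by (intro borel_measurable_continuous_onI linear_continuous_on)
  have "inj U" using linear_injective_0[OF U] iso by (metis norm_eq_zero)
  then have surj: "surj U" by (rule linear_injective_imp_surjective[OF U, simplified])
  show "sets (distr lborel borel U) = sets lborel" by simp
  fix A :: "'a set" assume "A \<in> sets (distr lborel borel U)"
  then have [measurable]: "A \<in> sets borel" by simp
  have [measurable]: "ball (0::'a) 1 \<in> sets borel" by simp
  define b where "b = emeasure lborel (ball (0::'a) 1)"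
  have b: "0 < b" "b < \<infinity>"
    unfolding b_def by (auto simp: emeasure_ball)
  have tr: "(\<integral>\<^sup>+x. f (x + t) \<partial>lborel) = (\<integral>\<^sup>+x. f x \<partial>lborel)"
    if [measurable]: "f \<in> borel_measurable borel" for f :: "'a \<Rightarrow> ennreal" and t
  proof -
    have "(\<integral>\<^sup>+x. f x \<partial>lborel) = (\<integral>\<^sup>+x. f x \<partial>distr lborel borel ((+) t))"
      by (simp add: lborel_distr_plus)
    also have "\<dots> = (\<integral>\<^sup>+x. f (x + t) \<partial>lborel)"
      by (subst nn_integral_distr) (auto simp: add.commute)
    finally show ?thesis by simp
  qed
  \<comment> \<open>Writing t as \<open>U s\<close> turns the condition on x into membership in the
    unit ball around s, whose volume does not depend on s.\<close>
  have ib: "(\<integral>\<^sup>+x. indicator (ball 0 1) (t - U x) \<partial>lborel) = b" for t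
  proof -
    obtain s where s: "t = U s" using surj by (metis surjD)
    have "norm (t - U x) = norm (x - s)" for x
      using iso[of "s - x"] linear_diff[OF U] by (simp add: s norm_minus_commute)
    then have "(\<integral>\<^sup>+x. indicator (ball 0 1) (t - U x) \<partial>lborel) =
      (\<integral>\<^sup>+x. indicator (ball 0 1) (x + (- s)) \<partial>lborel)"
      by (intro nn_integral_cong) (auto simp: indicator_def)
    also have "\<dots> = b" by (subst tr) (auto simp: b_def intro!: borel_measurable_indicator)
    finally show ?thesis .
  qed
  have "emeasure (distr lborel borel U) A * b =
      (\<integral>\<^sup>+y. (\<integral>\<^sup>+x. indicator A (U x) \<partial>lborel) * indicator (ball (0::'a) 1) y \<partial>lborel)"
  proof -
    have "emeasure (distr lborel borel U) A = (\<integral>\<^sup>+x. indicator A (U x) \<partial>lborel)"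
      by (subst nn_integral_indicator[symmetric], simp, subst nn_integral_distr) auto
    then show ?thesis by (simp add: nn_integral_cmult_indicator b_def)
  qed
  also have "\<dots> = (\<integral>\<^sup>+y. \<integral>\<^sup>+x. indicator A (U x + y) * indicator (ball 0 1) y \<partial>lborel \<partial>lborel)"
  proof (rule nn_integral_cong)
    fix y :: 'a
    obtain s where s: "y = U s" using surj by (metis surjD)
    have "(\<integral>\<^sup>+x. indicator A (U x + y) \<partial>lborel) = (\<integral>\<^sup>+x. indicator A (U (x + s)) \<partial>lborel)"
      by (simp add: s linear_add[OF U])
    also have "\<dots> = (\<integral>\<^sup>+x. indicator A (U x) \<partial>lborel)" by (rule tr) measurable
    finally show "(\<integral>\<^sup>+x. indicator A (U x) \<partial>lborel) * indicator (ball 0 1) y =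
      (\<integral>\<^sup>+x. indicator A (U x + y) * indicator (ball 0 1) y \<partial>lborel)"
      by (simp add: nn_integral_multc)
  qed
  also have "\<dots> = (\<integral>\<^sup>+x. \<integral>\<^sup>+y. indicator A (U x + y) * indicator (ball 0 1) y \<partial>lborel \<partial>lborel)"
    by (rule lborel_pair.Fubini') measurable
  also have "\<dots> = (\<integral>\<^sup>+x. \<integral>\<^sup>+y. indicator A y * indicator (ball 0 1) (y - U x) \<partial>lborel \<partial>lborel)"
  proof (rule nn_integral_cong)
    fix x :: 'a
    show "(\<integral>\<^sup>+y. indicator A (U x + y) * indicator (ball 0 1) y \<partial>lborel) =
      (\<integral>\<^sup>+y. indicator A y * indicator (ball 0 1) (y - U x) \<partial>lborel)"
      using tr[of "\<lambda>y. indicator A y * indicator (ball 0 1) (y - U x)" "U x"]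
      by (simp add: add.commute)
  qed
  also have "\<dots> = (\<integral>\<^sup>+y. \<integral>\<^sup>+x. indicator A y * indicator (ball 0 1) (y - U x) \<partial>lborel \<partial>lborel)"
    by (rule lborel_pair.Fubini') measurable
  also have "\<dots> = (\<integral>\<^sup>+y. indicator A y * b \<partial>lborel)"
    by (intro nn_integral_cong) (subst nn_integral_cmult, auto simp: ib)
  also have "\<dots> = emeasure lborel A * b"
    by (simp add: nn_integral_multc)
  finally show "emeasure (distr lborel borel U) A = emeasure lborel A"
    using b by (auto simp: mult.commute[of _ b] ennreal_mult_cancel_left)
qed

lemma nn_integral_complex_scale:
  fixes f :: "complex \<Rightarrow> real"
  assumes "c \<noteq> 0" "\<And>z. 0 \<le> f z" "f \<in> borel_measurable borel"
  shows "(\<integral>\<^sup>+z. ennreal (f z) \<partial>lborel) = (\<integral>\<^sup>+z. ennreal ((cmod c)\<^sup>2 * f (c * z)) \<partial>lborel)"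
proof -
  have "range (\<lambda>z. c * z) = UNIV"
    using assms(1) by (auto simp: image_iff intro!: exI[of _ "_ / c"])
  then show ?thesis
    using nn_integral_holomorphic_change_of_variables[of UNIV "\<lambda>z. c * z" "\<lambda>_. c" f] assms
    by (auto simp: inj_on_def intro!: derivative_eq_intros)
qed

text \<open>A disc has area \<open>pi\<close> times its squared radius, so |z|^2 is distributed as
  \<open>pi\<close> times Lebesgue measure on the positive half line. The sign is reversed because
  the two measures are compared on upper rays, where they must be finite: the upper rays of -|z|^2
  correspond to discs.\<close>

lemma nn_integral_complex_radial:
  fixes f :: "real \<Rightarrow> ennreal"
  assumes [measurable]: "f \<in> borel_measurable borel"
  shows "(\<integral>\<^sup>+z. f ((cmod z)\<^sup>2) \<partial>lborel) = ennreal pi * (\<integral>\<^sup>+t. f t * indicator {0<..} t \<partial>lborel)"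
proof -
  define M where "M = distr (lborel::complex measure) borel (\<lambda>z. - (cmod z)\<^sup>2)"
  define N where "N = distr (density lborel (\<lambda>t::real. ennreal pi * indicator {0<..} t)) borel uminus"
  have M: "emeasure M {x<..} = ennreal (pi * max 0 (- x))" for x
  proof -
    have "- (cmod z)\<^sup>2 > x \<longleftrightarrow> cmod z < sqrt (max 0 (- x))" for z
    proof -
      have "cmod z < sqrt s \<longleftrightarrow> (cmod z)\<^sup>2 < s" for s
        by (metis abs_norm_cancel real_sqrt_abs real_sqrt_less_iff)
      then show ?thesis
        using zero_le_power2[of "cmod z"] by (smt (verit, best))
    qed
    then have "(\<lambda>z::complex. - (cmod z)\<^sup>2) -` {x<..} = ball 0 (sqrt (max 0 (- x)))"
      by auto
    then show ?thesis
      unfolding M_def using unit_ball_vol_even[of 1]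
      by (subst emeasure_distr) (auto simp: emeasure_ball eval_unit_ball_vol)
  qed
  have N: "emeasure N {x<..} = ennreal (pi * max 0 (- x))" for x
  proof -
    have pre: "uminus -` {x<..} = {..< - x}" by auto
    have "emeasure N {x<..} = (\<integral>\<^sup>+t. ennreal pi * indicator {0<..} t * indicator {x<..} (- t) \<partial>lborel)"
      unfolding N_def by (subst emeasure_distr, simp, simp, subst emeasure_density) (auto intro!: nn_integral_cong simp: indicator_def pre)
    also have "\<dots> = (\<integral>\<^sup>+t. ennreal pi * indicator {0<..< max 0 (- x)} t \<partial>lborel)"
      by (intro nn_integral_cong) (auto simp: indicator_def)
    also have "\<dots> = ennreal (pi * max 0 (- x))"
      by (simp add: nn_integral_cmult ennreal_mult)
    finally show ?thesis .
  qed
  have "M = N"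
    by (rule measure_eqI_lessThan) (auto simp: M N M_def[symmetric] N_def[symmetric], simp_all add: M_def N_def)
  then have "(\<integral>\<^sup>+t. f (- t) \<partial>M) = (\<integral>\<^sup>+t. f (- t) \<partial>N)" by simp
  then show ?thesis
    unfolding M_def N_def
    by (subst (asm) (1 2) nn_integral_distr)
      (simp_all add: nn_integral_density nn_integral_cmult mult_ac)
qed

section \<open>Radial and Beta integrals\<close>

text \<open>Cut off at 0, since \<open>powr\<close> of a negative base is a junk value.\<close>

definition pos_powr :: "real \<Rightarrow> real \<Rightarrow> real" where
  "pos_powr t a = (if 0 < t then t powr a else 0)"

lemma pos_powr_nonneg[simp]: "0 \<le> pos_powr t a"
  by (simp add: pos_powr_def)

lemma measurable_pos_powr[measurable]:
  assumes [measurable]: "f \<in> borel_measurable M"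
  shows "(\<lambda>x. pos_powr (f x) a) \<in> borel_measurable M"
  unfolding pos_powr_def by measurable

lemma pos_powr_mult: "0 < c \<Longrightarrow> pos_powr (c * t) a = c powr a * pos_powr t a"
  by (auto simp: pos_powr_def powr_mult zero_less_mult_iff)

text \<open>Scaling by R reduces this to Euler's integral on (0, 1); for R not positive both sides
  vanish. Allowing every real R permits integrating out coordinates one at a time, where the
  remaining squared radius may be negative.\<close>

lemma nn_integral_Beta:
  assumes "0 < p" "0 < q"
  shows "(\<integral>\<^sup>+t. ennreal (pos_powr t (p - 1) * pos_powr (R - t) (q - 1)) \<partial>lborel) =
    ennreal (Beta p q * pos_powr R (p + q - 1))"
proof (cases "0 < R")
  case False
  then show ?thesis
    by (auto simp: pos_powr_def intro!: nn_integral_0_iff_AE[THEN iffD2])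
next
  case True
  have 1: "(\<integral>\<^sup>+t. ennreal (pos_powr t (p - 1) * pos_powr (1 - t) (q - 1)) \<partial>lborel) = ennreal (Beta p q)"
  proof -
    have "((\<lambda>t. t powr (p - 1) * (1 - t) powr (q - 1)) has_integral Beta p q) {0<..<1}"
      using has_integral_Beta_real[OF assms] by (simp add: has_integral_Icc_iff_Ioo)
    then have "((\<lambda>t. if t \<in> {0<..<1} then t powr (p - 1) * (1 - t) powr (q - 1) else 0) has_integral Beta p q) UNIV"
      by (subst has_integral_restrict_UNIV)
    then have "((\<lambda>t. pos_powr t (p - 1) * pos_powr (1 - t) (q - 1)) has_integral Beta p q) UNIV"
      by (rule has_integral_eq[rotated]) (auto simp: pos_powr_def)
    then show ?thesis
      by (intro nn_integral_has_integral_lborel) auto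
  qed
  have "(\<integral>\<^sup>+t. ennreal (pos_powr t (p - 1) * pos_powr (R - t) (q - 1)) \<partial>lborel) =
    ennreal R * (\<integral>\<^sup>+t. ennreal (pos_powr (R * t) (p - 1) * pos_powr (R - R * t) (q - 1)) \<partial>lborel)"
    using True by (subst nn_integral_real_affine[where c = R and t = 0]) auto
  also have "(\<lambda>t. pos_powr (R * t) (p - 1) * pos_powr (R - R * t) (q - 1)) =
    (\<lambda>t. R powr (p + q - 2) * (pos_powr t (p - 1) * pos_powr (1 - t) (q - 1)))"
  proof
    fix t
    have "R - R * t = R * (1 - t)" by (simp add: algebra_simps)
    moreover have "R powr (p + q - 2) = R powr (p - 1) * R powr (q - 1)"
      by (simp add: powr_add[symmetric])
    ultimately show "pos_powr (R * t) (p - 1) * pos_powr (R - R * t) (q - 1) =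
      R powr (p + q - 2) * (pos_powr t (p - 1) * pos_powr (1 - t) (q - 1))"
      using True by (simp add: pos_powr_mult)
  qed
  also have "ennreal R * (\<integral>\<^sup>+t. ennreal (R powr (p + q - 2) * (pos_powr t (p - 1) * pos_powr (1 - t) (q - 1))) \<partial>lborel)
    = ennreal (R * R powr (p + q - 2)) * ennreal (Beta p q)"
  proof -
    have "(\<integral>\<^sup>+t. ennreal (R powr (p + q - 2) * (pos_powr t (p - 1) * pos_powr (1 - t) (q - 1))) \<partial>lborel) =
      (\<integral>\<^sup>+t. ennreal (R powr (p + q - 2)) * ennreal (pos_powr t (p - 1) * pos_powr (1 - t) (q - 1)) \<partial>lborel)"
      by (intro nn_integral_cong ennreal_mult) auto
    also have "\<dots> = ennreal (R powr (p + q - 2)) * ennreal (Beta p q)"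
      by (subst nn_integral_cmult) (simp_all only: 1, measurable)
    finally show ?thesis using True by (simp add: ennreal_mult mult.assoc)
  qed
  also have "R * R powr (p + q - 2) = pos_powr R (p + q - 1)"
    using True by (simp add: pos_powr_def powr_mult_base)
  also have "ennreal (pos_powr R (p + q - 1)) * ennreal (Beta p q) = ennreal (Beta p q * pos_powr R (p + q - 1))"
    by (simp add: ennreal_mult'' mult.commute)
  finally show ?thesis .
qed

text \<open>The substitution \<open>x = u / (1 - u)\<close> maps (0, 1) onto the half line, with
  \<open>1 + x = 1 / (1 - u)\<close> and derivative \<open>1 / (1 - u)\<^sup>2\<close>; the powers
  of \<open>1 - u\<close> then add up to q - 1.\<close>

lemma nn_integral_Beta_halfline:
  assumes "0 < p" "0 < q"
  shows "(\<integral>\<^sup>+x. ennreal (pos_powr x (p - 1) * (1 + x) powr - (p + q)) \<partial>lborel) = ennreal (Beta p q)"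
proof -
  let ?g = "\<lambda>u::real. u / (1 - u)" and ?f = "\<lambda>x. x powr (p - 1) * (1 + x) powr - (p + q)"
  let ?h = "\<lambda>u. \<bar>1 / (1 - u)\<^sup>2\<bar> * ?f (?g u)"
  have im: "?g ` {0<..<1} = {0<..}"
  proof -
    have "x \<in> ?g ` {0<..<1}" if "x > 0" for x
      using that by (intro image_eqI[of _ _ "x / (1 + x)"]) (auto simp: field_simps)
    then show ?thesis by auto
  qed
  have "(\<integral>\<^sup>+x. ennreal (indicator (?g ` {0<..<1}) x * ?f x) \<partial>lborel) =
    (\<integral>\<^sup>+u. ennreal (indicator {0<..<1} u * ?h u) \<partial>lborel)"
  proof (rule nn_integral_eq_if_absolutely_integrable_iff)
    show "(?f absolutely_integrable_on ?g ` {0<..<1} \<and> integral (?g ` {0<..<1}) ?f = b) \<longleftrightarrow>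
      (?h absolutely_integrable_on {0<..<1} \<and> integral {0<..<1} ?h = b)" for b
      by (rule has_absolute_integral_change_of_variables_1'[symmetric])
        (auto intro!: derivative_eq_intros simp: inj_on_def field_simps power2_eq_square)
  qed (auto simp: im)
  also have "(\<lambda>u. indicator {0<..<1} u * ?h u) = (\<lambda>t. pos_powr t (p - 1) * pos_powr (1 - t) (q - 1))"
  proof
    fix u :: real
    show "indicator {0<..<1} u * ?h u = pos_powr u (p - 1) * pos_powr (1 - u) (q - 1)"
    proof (cases "0 < u \<and> u < 1")
      case True
      then have "1 + u / (1 - u) = 1 / (1 - u)" by (simp add: field_simps)
      moreover have "(1 / (1 - u)) powr - (p + q) = (1 - u) powr (p + q)"
        using True powr_minus_divide[of "1 / (1 - u)" "p + q"] by (simp add: powr_divide)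
      moreover have "?g u powr (p - 1) = u powr (p - 1) * (1 - u) powr (1 - p)"
        using True powr_minus_divide[of "1 - u" "p - 1"] by (simp add: powr_divide)
      moreover have "\<bar>1 / (1 - u)\<^sup>2\<bar> = (1 - u) powr (-2)"
        using True by (simp add: powr_minus_divide)
      ultimately have "?h u = (1 - u) powr (-2) * (u powr (p - 1) * (1 - u) powr (1 - p)) * (1 - u) powr (p + q)"
        by simp
      also have "\<dots> = u powr (p - 1) * ((1 - u) powr (-2) * (1 - u) powr (1 - p) * (1 - u) powr (p + q))"
        by simp
      also have "(1 - u) powr (-2) * (1 - u) powr (1 - p) * (1 - u) powr (p + q) = (1 - u) powr (q - 1)"
        by (simp flip: powr_add)
      finally show ?thesis using True by (simp add: pos_powr_def)
    qed (auto simp: pos_powr_def)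
  qed
  also have "(\<integral>\<^sup>+t. ennreal (pos_powr t (p - 1) * pos_powr (1 - t) (q - 1)) \<partial>lborel) = ennreal (Beta p q)"
    using nn_integral_Beta[OF assms, of 1] by (simp add: pos_powr_def)
  finally show ?thesis
    unfolding im by (auto simp: pos_powr_def indicator_def if_distrib if_distribR cong: if_cong elim!: trans[rotated] intro!: nn_integral_cong)
qed

section \<open>The law of two coordinates\<close>

lemma borel_measurable_vec_nth_comp[measurable]:
  fixes f :: "'b \<Rightarrow> 'a::euclidean_space ^ 'n"
  assumes "f \<in> borel_measurable M"
  shows "(\<lambda>x. f x $ k) \<in> borel_measurable M"
  using assms by (rule borel_measurable_continuous_on[rotated]) (intro continuous_intros)

text \<open>A box is a product of boxes in the components, so both measures agree on boxes. The
  product form gives access to one coordinate at a time.\<close>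

lemma lborel_vec_distr_PiM:
  "(lborel :: ('a::euclidean_space ^ 'n) measure) =
     distr (PiM UNIV (\<lambda>_. lborel)) borel (\<lambda>x. \<chi> k. x k)"
proof (rule lborel_eqI)
  interpret product_sigma_finite "\<lambda>_::'n. lborel :: 'a measure" by standard
  have m: "(\<lambda>x. (\<chi> k. x k) :: 'a ^ 'n) \<in> borel_measurable (PiM UNIV (\<lambda>_. lborel))"
    by (rule borel_measurable_euclidean_space[THEN iffD2]) (auto simp: Basis_vec_def inner_axis)
  fix l u :: "'a ^ 'n" assume lu: "\<And>b. b \<in> Basis \<Longrightarrow> l \<bullet> b \<le> u \<bullet> b"
  have lu': "l $ k \<bullet> b \<le> u $ k \<bullet> b" if "b \<in> Basis" for k b
    using lu[of "axis k b"] that by (auto simp: Basis_vec_def inner_axis)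
  have "(\<lambda>x. (\<chi> k. x k) :: 'a ^ 'n) -` box l u \<inter> space (PiM UNIV (\<lambda>_. lborel)) =
      (\<Pi>\<^sub>E k\<in>UNIV. box (l $ k) (u $ k))"
    by (auto simp: mem_box Basis_vec_def inner_axis space_PiM PiE_def Pi_iff)
  then have "emeasure (distr (PiM UNIV (\<lambda>_. lborel)) borel (\<lambda>x. (\<chi> k. x k) :: 'a ^ 'n)) (box l u) =
      emeasure (PiM UNIV (\<lambda>_::'n. lborel :: 'a measure)) (\<Pi>\<^sub>E k\<in>UNIV. box (l $ k) (u $ k))"
    using m by (subst emeasure_distr) auto
  also have "\<dots> = (\<Prod>k\<in>UNIV. emeasure lborel (box (l $ k) (u $ k)))"
    by (subst emeasure_PiM) auto
  also have "\<dots> = ennreal (\<Prod>k\<in>UNIV. \<Prod>b\<in>Basis. (u $ k - l $ k) \<bullet> b)"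
    using lu' by (simp add: emeasure_lborel_box_eq inner_diff_left prod_nonneg flip: prod_ennreal)
  also have "(\<Prod>k\<in>UNIV. \<Prod>b\<in>Basis. (u $ k - l $ k) \<bullet> b) = (\<Prod>b\<in>Basis. (u - l) \<bullet> b)"
  proof -
    have B: "(Basis :: ('a ^ 'n) set) = (\<lambda>(k, b). axis k b) ` (UNIV \<times> Basis)"
      by (auto simp: Basis_vec_def image_iff)
    have "inj_on (\<lambda>(k, b). axis k b :: 'a ^ 'n) (UNIV \<times> Basis)"
      by (auto simp: inj_on_def axis_eq_axis)
    then show ?thesis
      unfolding B by (subst prod.reindex) (auto simp: prod.cartesian_product inner_axis case_prod_unfold)
  qed
  finally show "emeasure (distr (PiM UNIV (\<lambda>_. lborel)) borel (\<lambda>x. (\<chi> k. x k) :: 'a ^ 'n)) (box l u) =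
    (\<Prod>b\<in>Basis. (u - l) \<bullet> b)" .
qed simp

lemma nn_integral_pos_powr_disc:
  assumes "a > -1"
  shows "(\<integral>\<^sup>+y. ennreal (pos_powr (R - (cmod y)\<^sup>2) a) \<partial>lborel) = ennreal (pi / (a + 1) * pos_powr R (a + 1))"
proof -
  have "(\<integral>\<^sup>+y. ennreal (pos_powr (R - (cmod y)\<^sup>2) a) \<partial>lborel) =
    ennreal pi * (\<integral>\<^sup>+t. ennreal (pos_powr (R - t) a) * indicator {0<..} t \<partial>lborel)"
    by (rule nn_integral_complex_radial[of "\<lambda>t. ennreal (pos_powr (R - t) a)"]) measurable
  \<comment> \<open>A zeroth power cut off at 0 is the indicator of the positive half line, so this
    is a Beta integral with first parameter 1.\<close>
  also have "(\<integral>\<^sup>+t. ennreal (pos_powr (R - t) a) * indicator {0<..} t \<partial>lborel) =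
    (\<integral>\<^sup>+t. ennreal (pos_powr t (1 - 1) * pos_powr (R - t) ((a + 1) - 1)) \<partial>lborel)"
    by (intro nn_integral_cong) (auto simp: pos_powr_def indicator_def)
  also have "\<dots> = ennreal (Beta 1 (a + 1) * pos_powr R (a + 1))"
    using assms by (subst nn_integral_Beta) (auto simp: add.commute)
  also have "Beta 1 (a + 1) = 1 / (a + 1)"
  proof -
    have "Gamma (a + 1) > 0" using assms by (intro Gamma_real_pos) auto
    moreover have "Gamma (1 + (a + 1)) = (a + 1) * Gamma (a + 1)"
      using assms Gamma_plus1[of "a + 1"] by (simp add: nonpos_Ints_def add.commute)
    ultimately show ?thesis
      unfolding Beta_def by simp
  qed
  finally show ?thesis
    using assms by (simp add: ennreal_mult' ennreal_mult''[symmetric] flip: ennreal_mult)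
qed

text \<open>Each coordinate integrated out raises the exponent by one and contributes
  \<open>pi\<close> divided by the new exponent; these divisors accumulate in the Gamma quotient.
  The induction needs every R, because fixing one coordinate y replaces R by R - |y|^2.\<close>

lemma nn_integral_PiM_pos_powr:
  assumes "finite I" "a > -1"
  shows "(\<integral>\<^sup>+x. ennreal (pos_powr (R - (\<Sum>k\<in>I. (cmod (x k))\<^sup>2)) a) \<partial>PiM I (\<lambda>_. lborel)) =
    ennreal (pi ^ card I * Gamma (a + 1) / Gamma (a + 1 + card I) * pos_powr R (a + card I))"
  using assms(1)
proof (induction I arbitrary: R rule: finite_induct)
  case empty
  have "Gamma (a + 1) > 0" using assms by (intro Gamma_real_pos) auto
  then show ?case by (simp add: PiM_empty nn_integral_count_space_finite)
next
  case (insert i I)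
  interpret product_sigma_finite "\<lambda>_. lborel :: complex measure" by standard
  let ?c = "pi ^ card I * Gamma (a + 1) / Gamma (a + 1 + card I)"
  have c: "0 \<le> ?c" using assms(2) by (auto intro!: divide_nonneg_nonneg mult_nonneg_nonneg Gamma_real_nonneg)
  have "(\<integral>\<^sup>+x. ennreal (pos_powr (R - (\<Sum>k\<in>insert i I. (cmod (x k))\<^sup>2)) a) \<partial>PiM (insert i I) (\<lambda>_. lborel)) =
    (\<integral>\<^sup>+y. \<integral>\<^sup>+x. ennreal (pos_powr (R - (\<Sum>k\<in>insert i I. (cmod ((x(i := y)) k))\<^sup>2)) a) \<partial>PiM I (\<lambda>_. lborel) \<partial>lborel)"
    using insert by (subst product_nn_integral_insert_rev) auto
  also have "\<dots> = (\<integral>\<^sup>+y. \<integral>\<^sup>+x. ennreal (pos_powr ((R - (cmod y)\<^sup>2) - (\<Sum>k\<in>I. (cmod (x k))\<^sup>2)) a) \<partial>PiM I (\<lambda>_. lborel) \<partial>lborel)"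
  proof (intro nn_integral_cong)
    fix x y
    have "(\<Sum>k\<in>I. (cmod ((x(i := y)) k))\<^sup>2) = (\<Sum>k\<in>I. (cmod (x k))\<^sup>2)"
      using insert by (intro sum.cong) auto
    then show "ennreal (pos_powr (R - (\<Sum>k\<in>insert i I. (cmod ((x(i := y)) k))\<^sup>2)) a) =
      ennreal (pos_powr ((R - (cmod y)\<^sup>2) - (\<Sum>k\<in>I. (cmod (x k))\<^sup>2)) a)"
      using insert by (simp add: algebra_simps)
  qed
  also have "\<dots> = (\<integral>\<^sup>+y. ennreal ?c * ennreal (pos_powr (R - (cmod y)\<^sup>2) (a + card I)) \<partial>lborel)"
    by (intro nn_integral_cong, subst insert.IH) (rule ennreal_mult[OF c], simp)
  also have "\<dots> = ennreal ?c * ennreal (pi / (a + card I + 1) * pos_powr R (a + card I + 1))"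
    using assms(2) by (subst nn_integral_cmult) (auto simp: nn_integral_pos_powr_disc)
  also have "\<dots> = ennreal (?c * (pi / (a + card I + 1)) * pos_powr R (a + card I + 1))"
    unfolding mult.assoc[of ?c] by (rule ennreal_mult'[OF c, symmetric])
  also have "?c * (pi / (a + card I + 1)) = pi ^ Suc (card I) * Gamma (a + 1) / Gamma (a + 1 + Suc (card I))"
    using assms(2) Gamma_plus1[of "a + 1 + card I"] by (simp add: nonpos_Ints_def add_ac mult_ac)
  finally show ?case using insert by (simp add: add_ac)
qed

text \<open>The other n - 2 coordinates enter only through the weight; integrating them out raises
  its exponent by n - 2 and leaves H as a factor.\<close>

lemma nn_integral_vec_marginal:
  fixes i j :: "'n::finite" and H :: "complex \<Rightarrow> complex \<Rightarrow> ennreal"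
  assumes ij: "i \<noteq> j" and a: "a > -1"
    and H: "case_prod H \<in> borel_measurable (borel \<Otimes>\<^sub>M borel)"
  shows "(\<integral>\<^sup>+w. H (w $ i) (w $ j) * ennreal (pos_powr (1 - (norm w)\<^sup>2) a) \<partial>(lborel :: (complex^'n) measure)) =
    ennreal (pi ^ (CARD('n) - 2) * Gamma (a + 1) / Gamma (a + CARD('n) - 1)) *
    (\<integral>\<^sup>+x. \<integral>\<^sup>+y. H x y * ennreal (pos_powr (1 - (cmod x)\<^sup>2 - (cmod y)\<^sup>2) (a + CARD('n) - 2)) \<partial>lborel \<partial>lborel)"
proof -
  interpret product_sigma_finite "\<lambda>_::'n. lborel :: complex measure" by standard
  define I where "I = UNIV - {i, j}"
  have U: "UNIV = insert i (insert j I)" and I: "finite I" "j \<notin> I" "i \<notin> insert j I"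
    using ij by (auto simp: I_def)
  have "CARD('n) \<ge> 2" using ij card_mono[of UNIV "{i, j}"] by simp
  then have cI: "card I = CARD('n) - 2" "real (CARD('n) - 2) = real CARD('n) - 2"
    using ij by (simp_all add: I_def card_Diff_subset)
  have [measurable]: "(\<lambda>x. H (f x) (g x)) \<in> borel_measurable M"
    if "f \<in> borel_measurable M" "g \<in> borel_measurable M" for f g and M :: "'b measure"
    using measurable_compose[OF measurable_Pair[OF that] H] by simp
  have m: "(\<lambda>x. (\<chi> k. x k) :: complex ^ 'n) \<in> borel_measurable (PiM UNIV (\<lambda>_. lborel))"
    by (rule borel_measurable_euclidean_space[THEN iffD2]) (auto simp: Basis_vec_def inner_axis)
  have n2: "(norm w)\<^sup>2 = (\<Sum>k\<in>UNIV. (cmod (w $ k))\<^sup>2)" for w :: "complex^'n"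
    by (simp add: norm_vec_def L2_set_def sum_nonneg)
  let ?S = "\<lambda>x J. \<Sum>k\<in>J. (cmod (x k))\<^sup>2"
  let ?c = "pi ^ (CARD('n) - 2) * Gamma (a + 1) / Gamma (a + CARD('n) - 1)"
  have c: "0 \<le> ?c" using a \<open>CARD('n) \<ge> 2\<close>
    by (auto intro!: divide_nonneg_nonneg mult_nonneg_nonneg Gamma_real_nonneg)
  have "(\<integral>\<^sup>+w. H (w $ i) (w $ j) * ennreal (pos_powr (1 - (norm w)\<^sup>2) a) \<partial>(lborel :: (complex^'n) measure)) =
    (\<integral>\<^sup>+x. H (x i) (x j) * ennreal (pos_powr (1 - ?S x UNIV) a) \<partial>PiM UNIV (\<lambda>_. lborel))"
    unfolding n2 by (subst lborel_vec_distr_PiM, subst nn_integral_distr) (use m in auto)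
  also have "\<dots> = (\<integral>\<^sup>+x. H (x i) (x j) * ennreal (pos_powr (1 - ?S x (insert i (insert j I))) a)
      \<partial>PiM (insert i (insert j I)) (\<lambda>_. lborel))"
    by (simp only: U[symmetric])
  also have "\<dots> = (\<integral>\<^sup>+x. \<integral>\<^sup>+y. \<integral>\<^sup>+z. H x y *
      ennreal (pos_powr (1 - ?S (z(j := y, i := x)) (insert i (insert j I))) a) \<partial>PiM I (\<lambda>_. lborel) \<partial>lborel \<partial>lborel)"
    using I ij
    by (subst product_nn_integral_insert_rev, simp, simp, measurable)
      (intro nn_integral_cong, subst product_nn_integral_insert_rev, auto)
  also have "\<dots> = (\<integral>\<^sup>+x. \<integral>\<^sup>+y. \<integral>\<^sup>+z. H x y *
      ennreal (pos_powr ((1 - (cmod x)\<^sup>2 - (cmod y)\<^sup>2) - ?S z I) a) \<partial>PiM I (\<lambda>_. lborel) \<partial>lborel \<partial>lborel)"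
  proof (intro nn_integral_cong)
    fix x y :: complex and z :: "'n \<Rightarrow> complex"
    have "?S (z(j := y, i := x)) I = ?S z I"
      using I by (intro sum.cong) auto
    then show "H x y * ennreal (pos_powr (1 - ?S (z(j := y, i := x)) (insert i (insert j I))) a) =
      H x y * ennreal (pos_powr ((1 - (cmod x)\<^sup>2 - (cmod y)\<^sup>2) - ?S z I) a)"
      using I ij by (simp add: algebra_simps)
  qed
  also have "\<dots> = (\<integral>\<^sup>+x. \<integral>\<^sup>+y. ennreal ?c * (H x y *
      ennreal (pos_powr (1 - (cmod x)\<^sup>2 - (cmod y)\<^sup>2) (a + CARD('n) - 2))) \<partial>lborel \<partial>lborel)"
  proof (intro nn_integral_cong)
    fix x y :: complex
    have *: "(\<integral>\<^sup>+z. ennreal (pos_powr ((1 - (cmod x)\<^sup>2 - (cmod y)\<^sup>2) - ?S z I) a) \<partial>PiM I (\<lambda>_. lborel)) =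
      ennreal (?c * pos_powr (1 - (cmod x)\<^sup>2 - (cmod y)\<^sup>2) (a + CARD('n) - 2))"
      using I a nn_integral_PiM_pos_powr[of I a "1 - (cmod x)\<^sup>2 - (cmod y)\<^sup>2"]
      by (simp add: cI add_diff_eq diff_diff_eq add.commute[of _ 1])
    show "(\<integral>\<^sup>+z. H x y * ennreal (pos_powr ((1 - (cmod x)\<^sup>2 - (cmod y)\<^sup>2) - ?S z I) a) \<partial>PiM I (\<lambda>_. lborel)) =
      ennreal ?c * (H x y * ennreal (pos_powr (1 - (cmod x)\<^sup>2 - (cmod y)\<^sup>2) (a + CARD('n) - 2)))"
      by (subst nn_integral_cmult, measurable) (simp only: *, subst ennreal_mult[OF c pos_powr_nonneg], simp only: mult_ac)
  qed
  also have "\<dots> = ennreal ?c * (\<integral>\<^sup>+x. \<integral>\<^sup>+y. H x y *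
      ennreal (pos_powr (1 - (cmod x)\<^sup>2 - (cmod y)\<^sup>2) (a + CARD('n) - 2)) \<partial>lborel \<partial>lborel)"
    by (subst nn_integral_cmult[symmetric], measurable) (intro nn_integral_cong, subst nn_integral_cmult, auto)
  finally show ?thesis .
qed

section \<open>Integration against the weighted ball measure\<close>

lemma space_v_alpha: "space (v_alpha \<alpha> :: (complex^'n) measure) = ball 0 1"
  by (simp add: v_alpha_def v_measure_def)

lemma sets_v_alpha: "sets (v_alpha \<alpha> :: (complex^'n) measure) = sets (lebesgue_on (ball 0 1))"
  by (simp add: v_alpha_def v_measure_def)

lemma measurable_v_alpha_borel:
  "f \<in> borel_measurable borel \<Longrightarrow> f \<in> borel_measurable (v_alpha \<alpha> :: (complex^'n) measure)"
  unfolding measurable_cong_sets[OF sets_v_alpha refl]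
  by (intro measurable_restrict_space1 measurable_completion) simp

text \<open>The factor n!/pi^n is the reciprocal volume of the unit ball in real dimension 2n. The
  cut-off in \<open>pos_powr\<close> takes over the restriction to the ball, so the integral can run
  over the whole space.\<close>

lemma nn_integral_v_alpha:
  fixes f :: "complex^'n \<Rightarrow> ennreal"
  assumes f: "f \<in> borel_measurable borel" and \<alpha>: "\<alpha> > -1"
  shows "(\<integral>\<^sup>+w. f w \<partial>v_alpha \<alpha>) = (\<integral>\<^sup>+w. f w *
    ennreal (c_const CARD('n) \<alpha> * fact CARD('n) / pi ^ CARD('n) * pos_powr (1 - (norm w)\<^sup>2) \<alpha>) \<partial>lborel)"
proof -
  let ?B = "ball (0::complex^'n) 1"
  let ?D = "\<lambda>z::complex^'n. ennreal (c_const CARD('n) \<alpha> * (1 - (norm z)\<^sup>2) powr \<alpha>)"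
  have c: "0 \<le> c_const CARD('n) \<alpha>"
    using \<alpha> by (auto simp: c_const_def intro!: divide_nonneg_nonneg mult_nonneg_nonneg Gamma_real_nonneg)
  have m: "g \<in> borel_measurable (lebesgue_on ?B)" if "g \<in> borel_measurable borel" for g :: "_ \<Rightarrow> ennreal"
    using that by (intro measurable_restrict_space1 measurable_completion) simp
  have vol: "emeasure (lebesgue_on ?B) ?B = ennreal (pi ^ CARD('n) / fact CARD('n))"
    using unit_ball_vol_even[of "CARD('n)"]
    by (subst emeasure_restrict_space) (auto simp: emeasure_ball mult.commute)
  have D: "?D \<in> borel_measurable borel" by measurable
  have "(\<integral>\<^sup>+w. f w \<partial>v_alpha \<alpha>) = (\<integral>\<^sup>+w. ?D w * f w \<partial>v_measure)"
    unfolding v_alpha_def using m[OF f] m[OF D]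
    by (intro nn_integral_density) (simp_all add: v_measure_def)
  also have "\<dots> = (\<integral>\<^sup>+w. ?D w * f w * indicator ?B w \<partial>lebesgue_on ?B) / emeasure (lebesgue_on ?B) ?B"
    unfolding v_measure_def using m[OF f] m[OF D] by (intro nn_integral_uniform_measure) simp_all
  also have "(\<integral>\<^sup>+w. ?D w * f w * indicator ?B w \<partial>lebesgue_on ?B) = (\<integral>\<^sup>+w. ?D w * f w * indicator ?B w \<partial>lborel)"
    by (subst nn_integral_restrict_space)
      (auto simp: nn_integral_completion indicator_def intro!: nn_integral_cong split: if_splits)
  also have "\<dots> / emeasure (lebesgue_on ?B) ?B =
      (\<integral>\<^sup>+w. ?D w * f w * indicator ?B w * ennreal (fact CARD('n) / pi ^ CARD('n)) \<partial>lborel)"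
    unfolding vol using f D
    by (subst nn_integral_multc)
      (auto simp: divide_ennreal_def inverse_ennreal intro!: borel_measurable_times_ennreal borel_measurable_indicator)
  also have "\<dots> = (\<integral>\<^sup>+w. f w *
    ennreal (c_const CARD('n) \<alpha> * fact CARD('n) / pi ^ CARD('n) * pos_powr (1 - (norm w)\<^sup>2) \<alpha>) \<partial>lborel)"
  proof (rule nn_integral_cong)
    fix w :: "complex^'n"
    have iff: "w \<in> ?B \<longleftrightarrow> 0 < 1 - (norm w)\<^sup>2"
      by (simp add: power_less_one_iff abs_square_less_1)
    show "?D w * f w * indicator ?B w * ennreal (fact CARD('n) / pi ^ CARD('n)) =
      f w * ennreal (c_const CARD('n) \<alpha> * fact CARD('n) / pi ^ CARD('n) * pos_powr (1 - (norm w)\<^sup>2) \<alpha>)"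
    proof (cases "w \<in> ?B")
      case True
      then have "pos_powr (1 - (norm w)\<^sup>2) \<alpha> = (1 - (norm w)\<^sup>2) powr \<alpha>"
        using iff by (simp add: pos_powr_def)
      moreover have "c_const CARD('n) \<alpha> * fact CARD('n) / pi ^ CARD('n) * (1 - (norm w)\<^sup>2) powr \<alpha> =
        (c_const CARD('n) \<alpha> * (1 - (norm w)\<^sup>2) powr \<alpha>) * (fact CARD('n) / pi ^ CARD('n))" by simp
      ultimately have "ennreal (c_const CARD('n) \<alpha> * fact CARD('n) / pi ^ CARD('n) * pos_powr (1 - (norm w)\<^sup>2) \<alpha>) =
        ?D w * ennreal (fact CARD('n) / pi ^ CARD('n))"
        by (simp only: ennreal_mult''[of "fact CARD('n) / pi ^ CARD('n)"] divide_nonneg_nonneg fact_ge_zero pi_ge_zero zero_le_power)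
      then show ?thesis
        using True by (simp only: indicator_simps mult_1_right mult_1_left mult_ac)
    next
      case False
      then have "pos_powr (1 - (norm w)\<^sup>2) \<alpha> = 0"
        using iff by (simp add: pos_powr_def)
      then show ?thesis using False by simp
    qed
  qed
  finally show ?thesis .
qed

text \<open>The joint density of two coordinates under \<open>v\<^sub>\<alpha>\<close>, where \<open>N = n + 1 + \<alpha>\<close>.\<close>

definition weight2 :: "real \<Rightarrow> complex \<Rightarrow> complex \<Rightarrow> real" where
  "weight2 N x y = (N - 1) * (N - 2) / pi\<^sup>2 * pos_powr (1 - (cmod x)\<^sup>2 - (cmod y)\<^sup>2) (N - 3)"

text \<open>Extended values leave finiteness open, and the iterated form allows y to be treated for
  fixed x. By \<open>int2_one\<close> the weight has total mass 1.\<close>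

definition int2 :: "real \<Rightarrow> (complex \<Rightarrow> complex \<Rightarrow> real) \<Rightarrow> ennreal" where
  "int2 N H = (\<integral>\<^sup>+x. \<integral>\<^sup>+y. ennreal (H x y * weight2 N x y) \<partial>lborel \<partial>lborel)"

lemma weight2_nonneg: "2 < N \<Longrightarrow> 0 \<le> weight2 N x y"
  by (simp add: weight2_def)

lemma weight2_eq_0:
  assumes "1 \<le> cmod x"
  shows "weight2 N x y = 0"
proof -
  have "1 \<le> (cmod x)\<^sup>2" using assms by (simp add: one_le_power)
  then have "1 - (cmod x)\<^sup>2 - (cmod y)\<^sup>2 \<le> 0" using zero_le_power2[of "cmod y"] by linarith
  then show ?thesis by (simp add: weight2_def pos_powr_def)
qed

lemma measurable_weight2[measurable]:
  assumes [measurable]: "f \<in> borel_measurable M" "g \<in> borel_measurable M"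
  shows "(\<lambda>x. weight2 N (f x) (g x)) \<in> borel_measurable M"
  unfolding weight2_def by measurable

lemma measurable_comp2:
  assumes "case_prod H \<in> borel_measurable (borel \<Otimes>\<^sub>M borel)"
    and "f \<in> borel_measurable M" "g \<in> borel_measurable M"
  shows "(\<lambda>x. H (f x) (g x)) \<in> borel_measurable M"
  using measurable_compose[OF measurable_Pair[OF assms(2,3)] assms(1)] by simp

text \<open>The constants of \<open>v_alpha\<close> and of the marginal combine so that the
  dimension survives only in N; the identity behind this is Gamma(N) = (N - 1)(N - 2) Gamma(N -
  2).\<close>

lemma nn_integral_v_alpha_coordinates:
  fixes i j :: "'n::finite" and H :: "complex \<Rightarrow> complex \<Rightarrow> real"
  assumes ij: "i \<noteq> j" and \<alpha>: "\<alpha> > -1"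
    and H: "case_prod H \<in> borel_measurable (borel \<Otimes>\<^sub>M borel)"
    and N: "N = real CARD('n) + 1 + \<alpha>"
  shows "(\<integral>\<^sup>+w. ennreal (H (w $ i) (w $ j)) \<partial>(v_alpha \<alpha> :: (complex^'n) measure)) = int2 N H"
proof -
  note [measurable] = measurable_comp2[OF H]
  have "CARD('n) \<ge> 2" using ij card_mono[of UNIV "{i, j}"] by simp
  then have N2: "N > 2" using N \<alpha> by simp
  let ?k = "c_const CARD('n) \<alpha> * fact CARD('n) / pi ^ CARD('n)"
  let ?c = "pi ^ (CARD('n) - 2) * Gamma (\<alpha> + 1) / Gamma (\<alpha> + CARD('n) - 1)"
  have kpos: "0 \<le> ?k"
    using \<alpha> by (auto simp: c_const_def intro!: divide_nonneg_nonneg mult_nonneg_nonneg Gamma_real_nonneg)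
  have c: "0 \<le> ?c" using \<alpha> \<open>CARD('n) \<ge> 2\<close>
    by (auto intro!: divide_nonneg_nonneg mult_nonneg_nonneg Gamma_real_nonneg)
  have kc: "?k * ?c = (N - 1) * (N - 2) / pi\<^sup>2"
  proof -
    have "Gamma (\<alpha> + 1) > 0" "Gamma (\<alpha> + CARD('n) - 1) > 0"
      using \<alpha> \<open>CARD('n) \<ge> 2\<close> by (auto intro!: Gamma_real_pos)
    moreover have "Gamma (real CARD('n) + \<alpha> + 1) = (N - 1) * (N - 2) * Gamma (\<alpha> + CARD('n) - 1)"
    proof -
      have 1: "Gamma ((N - 1) + 1) = (N - 1) * Gamma (N - 1)" and 2: "Gamma ((N - 2) + 1) = (N - 2) * Gamma (N - 2)"
        by (rule Gamma_plus1, use N2 in \<open>simp add: nonpos_Ints_def\<close>)+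
      have "Gamma (real CARD('n) + \<alpha> + 1) = Gamma ((N - 1) + 1)" by (simp add: N)
      also have "\<dots> = (N - 1) * Gamma ((N - 2) + 1)" unfolding 1 by simp
      also have "\<dots> = (N - 1) * (N - 2) * Gamma (N - 2)" unfolding 2 by simp
      also have "N - 2 = \<alpha> + CARD('n) - 1" by (simp add: N)
      finally show ?thesis by (simp add: N)
    qed
    moreover have "pi ^ CARD('n) = pi ^ (CARD('n) - 2) * pi\<^sup>2"
      using \<open>CARD('n) \<ge> 2\<close> by (metis le_add_diff_inverse2 power_add)
    moreover have "Gamma (real CARD('n) + 1) = fact CARD('n)"
      using Gamma_fact[of "CARD('n)", where 'a=real] by (simp add: add.commute)
    ultimately show ?thesis by (simp add: c_const_def)
  qed
  have "(\<integral>\<^sup>+w. ennreal (H (w $ i) (w $ j)) \<partial>(v_alpha \<alpha> :: (complex^'n) measure)) =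
    (\<integral>\<^sup>+w. ennreal ?k * (ennreal (H (w $ i) (w $ j)) * ennreal (pos_powr (1 - (norm w)\<^sup>2) \<alpha>))
      \<partial>(lborel :: (complex^'n) measure))"
    using \<alpha> by (subst nn_integral_v_alpha, measurable)
      (intro nn_integral_cong, subst ennreal_mult[OF kpos pos_powr_nonneg], simp only: mult_ac)
  also have "\<dots> = ennreal ?k * (ennreal ?c * (\<integral>\<^sup>+x. \<integral>\<^sup>+y. ennreal (H x y) *
      ennreal (pos_powr (1 - (cmod x)\<^sup>2 - (cmod y)\<^sup>2) (\<alpha> + CARD('n) - 2)) \<partial>lborel \<partial>lborel))"
    using nn_integral_vec_marginal[OF ij \<alpha>, of "\<lambda>x y. ennreal (H x y)"]
    by (subst nn_integral_cmult, measurable)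
  also have "\<dots> = ennreal (?k * ?c) * (\<integral>\<^sup>+x. \<integral>\<^sup>+y. ennreal (H x y) *
      ennreal (pos_powr (1 - (cmod x)\<^sup>2 - (cmod y)\<^sup>2) (\<alpha> + CARD('n) - 2)) \<partial>lborel \<partial>lborel)"
    by (subst ennreal_mult[OF kpos c]) (simp only: mult_ac)
  also have "\<dots> = (\<integral>\<^sup>+x. \<integral>\<^sup>+y. ennreal (?k * ?c) * (ennreal (H x y) *
      ennreal (pos_powr (1 - (cmod x)\<^sup>2 - (cmod y)\<^sup>2) (\<alpha> + CARD('n) - 2))) \<partial>lborel \<partial>lborel)"
    by (subst nn_integral_cmult[symmetric], measurable) (intro nn_integral_cong, subst nn_integral_cmult, auto)
  also have "\<dots> = int2 N H"
    unfolding int2_def weight2_def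
  proof (intro nn_integral_cong)
    fix x y
    have e: "\<alpha> + real CARD('n) - 2 = N - 3" by (simp add: N)
    let ?K = "(N - 1) * (N - 2) / pi\<^sup>2" and ?P = "pos_powr (1 - (cmod x)\<^sup>2 - (cmod y)\<^sup>2) (N - 3)"
    have K: "0 \<le> ?K" using N2 by simp
    have "ennreal (H x y * (?K * ?P)) = ennreal (H x y) * ennreal (?K * ?P)"
      using K by (intro ennreal_mult'' mult_nonneg_nonneg) simp_all
    also have "ennreal (?K * ?P) = ennreal ?K * ennreal ?P"
      using K by (intro ennreal_mult) simp_all
    finally show "ennreal (?k * ?c) * (ennreal (H x y) * ennreal (pos_powr (1 - (cmod x)\<^sup>2 - (cmod y)\<^sup>2) (\<alpha> + CARD('n) - 2)))
      = ennreal (H x y * (?K * ?P))"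
      unfolding kc e by (simp only: mult_ac)
  qed
  finally show ?thesis .
qed

section \<open>Invariance under isometries and rotations, and the total mass\<close>

lemma nn_integral_v_alpha_isometry:
  fixes f :: "complex^'n \<Rightarrow> ennreal" and U :: "complex^'n \<Rightarrow> complex^'n"
  assumes U: "linear U" and iso: "\<And>x. norm (U x) = norm x"
    and [measurable]: "f \<in> borel_measurable borel" and \<alpha>: "\<alpha> > -1"
  shows "(\<integral>\<^sup>+w. f (U w) \<partial>v_alpha \<alpha>) = (\<integral>\<^sup>+w. f w \<partial>v_alpha \<alpha>)"
proof -
  have [measurable]: "U \<in> borel_measurable borel"
    using U by (intro borel_measurable_continuous_onI linear_continuous_on) (simp add: linear_conv_bounded_linear)
  let ?w = "\<lambda>w::complex^'n. ennreal (c_const CARD('n) \<alpha> * fact CARD('n) / pi ^ CARD('n) * pos_powr (1 - (norm w)\<^sup>2) \<alpha>)"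
  have "(\<integral>\<^sup>+w. f w \<partial>v_alpha \<alpha>) = (\<integral>\<^sup>+w. f w * ?w w \<partial>distr lborel borel U)"
    unfolding lborel_distr_isometry[OF U iso] using \<alpha> by (subst nn_integral_v_alpha) auto
  also have "\<dots> = (\<integral>\<^sup>+w. f (U w) * ?w w \<partial>lborel)"
    by (subst nn_integral_distr) (auto simp: iso)
  also have "\<dots> = (\<integral>\<^sup>+w. f (U w) \<partial>v_alpha \<alpha>)"
    using \<alpha> by (subst nn_integral_v_alpha) auto
  finally show ?thesis by simp
qed

lemma nn_integral_complex_rotate:
  assumes c: "cmod c = 1" and [measurable]: "f \<in> borel_measurable borel"
  shows "(\<integral>\<^sup>+z. f (c * z) \<partial>lborel) = (\<integral>\<^sup>+z. f z \<partial>lborel)"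
proof -
  have "distr lborel borel ((*) c) = lborel"
    using c by (intro lborel_distr_isometry) (auto simp: norm_mult intro!: linearI simp: algebra_simps)
  then have "(\<integral>\<^sup>+z. f z \<partial>lborel) = (\<integral>\<^sup>+z. f z \<partial>distr lborel borel ((*) c))" by simp
  also have "\<dots> = (\<integral>\<^sup>+z. f (c * z) \<partial>lborel)" by (subst nn_integral_distr) auto
  finally show ?thesis by simp
qed

lemma int2_rotate:
  assumes "cmod c = 1" "cmod d = 1" and H: "case_prod H \<in> borel_measurable (borel \<Otimes>\<^sub>M borel)"
  shows "int2 N (\<lambda>x y. H (c * x) (d * y)) = int2 N H"
proof -
  note [measurable] = measurable_comp2[OF H]
  have "int2 N H = (\<integral>\<^sup>+x. \<integral>\<^sup>+y. ennreal (H x (d * y) * weight2 N x (d * y)) \<partial>lborel \<partial>lborel)"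
    unfolding int2_def
    by (intro nn_integral_cong nn_integral_complex_rotate[OF assms(2), symmetric]) measurable
  also have "\<dots> = (\<integral>\<^sup>+x. \<integral>\<^sup>+y. ennreal (H (c * x) (d * y) * weight2 N (c * x) (d * y)) \<partial>lborel \<partial>lborel)"
    by (intro nn_integral_complex_rotate[OF assms(1), symmetric]) measurable
  also have "\<dots> = int2 N (\<lambda>x y. H (c * x) (d * y))"
    by (simp add: int2_def weight2_def norm_mult assms)
  finally show ?thesis by simp
qed

text \<open>Integrating out y raises the exponent by one and leaves the density of a single
  coordinate.\<close>

lemma nn_integral_weight2:
  assumes N: "2 < N"
  shows "(\<integral>\<^sup>+y. ennreal (weight2 N x y) \<partial>lborel) = ennreal ((N - 1) / pi * pos_powr (1 - (cmod x)\<^sup>2) (N - 2))"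
proof -
  let ?k = "(N - 1) * (N - 2) / pi\<^sup>2"
  have k: "0 \<le> ?k" using N by simp
  have "(\<integral>\<^sup>+y. ennreal (weight2 N x y) \<partial>lborel) =
    (\<integral>\<^sup>+y. ennreal ?k * ennreal (pos_powr (1 - (cmod x)\<^sup>2 - (cmod y)\<^sup>2) (N - 3)) \<partial>lborel)"
    unfolding weight2_def using k by (intro nn_integral_cong ennreal_mult) simp_all
  also have "\<dots> = ennreal ?k * ennreal (pi / (N - 2) * pos_powr (1 - (cmod x)\<^sup>2) (N - 2))"
    using N nn_integral_pos_powr_disc[of "N - 3"] by (subst nn_integral_cmult) auto
  also have "\<dots> = ennreal (?k * (pi / (N - 2) * pos_powr (1 - (cmod x)\<^sup>2) (N - 2)))"
    by (rule ennreal_mult'[OF k, symmetric])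
  also have "?k * (pi / (N - 2) * pos_powr (1 - (cmod x)\<^sup>2) (N - 2)) = (N - 1) / pi * pos_powr (1 - (cmod x)\<^sup>2) (N - 2)"
    using N by (simp add: power2_eq_square)
  finally show ?thesis .
qed

lemma int2_one:
  assumes "2 < N"
  shows "int2 N (\<lambda>x y. 1) = 1"
proof -
  have "int2 N (\<lambda>x y. 1) = (\<integral>\<^sup>+x. ennreal ((N - 1) / pi) * ennreal (pos_powr (1 - (cmod x)\<^sup>2) (N - 2)) \<partial>lborel)"
    unfolding int2_def mult_1 nn_integral_weight2[OF assms]
    using assms by (intro nn_integral_cong ennreal_mult) simp_all
  also have "\<dots> = ennreal ((N - 1) / pi) * ennreal (pi / (N - 1) * pos_powr 1 (N - 1))"
    using assms nn_integral_pos_powr_disc[of "N - 2" 1] by (subst nn_integral_cmult) auto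
  also have "\<dots> = 1"
    using assms by (simp add: ennreal_mult[symmetric] pos_powr_def)
  finally show ?thesis .
qed

lemma ex_two_distinct:
  assumes "CARD('n::finite) > 1"
  obtains i j :: "'n::finite" where "i \<noteq> j"
  using assms by (metis (full_types) is_singletonI' is_singleton_altdef less_numeral_extra(4) UNIV_not_empty)

text \<open>The total mass is the two-coordinate integral of the constant 1, which two applications
  of the disc formula evaluate.\<close>

lemma prob_space_v_alpha:
  assumes "CARD('n) > 1" "\<alpha> > -1"
  shows "prob_space (v_alpha \<alpha> :: (complex^'n::finite) measure)"
proof -
  obtain i j :: 'n where "i \<noteq> j"
    using ex_two_distinct[OF assms(1)] .
  then have "(\<integral>\<^sup>+w. ennreal 1 \<partial>(v_alpha \<alpha> :: (complex^'n) measure)) = int2 (real CARD('n) + 1 + \<alpha>) (\<lambda>x y. 1)"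
    using nn_integral_v_alpha_coordinates[of i j \<alpha> "\<lambda>x y. 1"] assms by simp
  also have "\<dots> = 1" using assms by (intro int2_one) simp
  finally show ?thesis by (intro prob_spaceI) simp
qed

section \<open>Reduction to two coordinates\<close>

lemma hinner_add_left: "hinner (x + y) w = hinner x w + hinner y w"
  by (simp add: hinner_def algebra_simps sum.distrib)

lemma hinner_diff_left: "hinner (x - y) w = hinner x w - hinner y w"
  by (simp add: hinner_def algebra_simps sum_subtractf)

lemma hinner_minus_left: "hinner (- x) w = - hinner x w"
  by (simp add: hinner_def sum_negf)

lemma hinner_scale_left: "hinner (c *s x) w = c * hinner x w"
  by (simp add: hinner_def sum_distrib_left mult.assoc)

lemma cnj_hinner: "cnj (hinner x w) = hinner w x"
  by (simp add: hinner_def mult.commute)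

lemma hinner_diff_right: "hinner x (w - v) = hinner x w - hinner x v"
  by (simp add: hinner_def algebra_simps sum_subtractf)

lemma hinner_scale_right: "hinner x (c *s w) = cnj c * hinner x w"
  by (simp add: hinner_def sum_distrib_left mult_ac)

lemma hinner_self: "hinner x x = of_real ((norm x)\<^sup>2)"
  by (simp add: hinner_def norm_vec_def L2_set_def sum_nonneg complex_mult_cnj cmod_power2)

lemma hinner_axis_right: "hinner x (axis k c) = x $ k * cnj c"
proof -
  have "hinner x (axis k c) = (\<Sum>l\<in>UNIV. if l = k then x $ k * cnj c else 0)"
    unfolding hinner_def by (rule sum.cong) (auto simp: axis_def)
  then show ?thesis by simp
qed

lemma hinner_axis_left: "hinner (axis k c) x = c * cnj (x $ k)"
  using cnj_hinner[of x "axis k c"] by (simp add: hinner_axis_right mult.commute)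

lemma norm_hinner_le: "cmod (hinner x w) \<le> norm x * norm w"
proof -
  have "cmod (hinner x w) \<le> (\<Sum>k\<in>UNIV. \<bar>cmod (x $ k)\<bar> * \<bar>cmod (w $ k)\<bar>)"
    unfolding hinner_def by (rule order_trans[OF norm_sum]) (simp add: norm_mult)
  also have "\<dots> \<le> norm x * norm w"
    unfolding norm_vec_def by (rule L2_set_mult_ineq)
  finally show ?thesis .
qed

lemma norm_vec_scale: "norm (c *s (x :: complex^'n)) = cmod c * norm x"
proof -
  have "(of_real ((norm (c *s x))\<^sup>2) :: complex) = of_real ((cmod c)\<^sup>2 * (norm x)\<^sup>2)"
    unfolding hinner_self[symmetric] of_real_mult complex_norm_square[of c] hinner_scale_left hinner_scale_right
    by (simp add: mult_ac)
  then have "(norm (c *s x))\<^sup>2 = (cmod c * norm x)\<^sup>2"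
    by (simp only: of_real_eq_iff power_mult_distrib)
  then show ?thesis by simp
qed

lemma norm_axis_complex: "norm (axis k c :: complex^'n) = cmod c"
proof -
  have "(of_real ((norm (axis k c :: complex^'n))\<^sup>2) :: complex) = of_real ((cmod c)\<^sup>2)"
    unfolding hinner_self[symmetric] complex_norm_square by (simp add: hinner_axis_right)
  then have "(norm (axis k c :: complex^'n))\<^sup>2 = (cmod c)\<^sup>2"
    by (simp only: of_real_eq_iff)
  then show ?thesis by simp
qed

lemma scaleR_vec_conv_of_real: "r *\<^sub>R (x :: complex^'n) = of_real r *s x"
  by (simp add: vec_eq_iff complex_eq_iff)

text \<open>The complex reflection that negates x and fixes the vectors Hermitian-orthogonal to it.
  For x = 0 division by zero makes it the identity, which is right when the two vectors to be
  exchanged already coincide.\<close>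

definition householder :: "complex^'n \<Rightarrow> complex^'n \<Rightarrow> complex^'n" where
  "householder x w = w - (2 * hinner w x / hinner x x) *s x"

lemma hinner_householder: "hinner (householder x w) (householder x v) = hinner w v"
proof (cases "x = 0")
  case True
  then show ?thesis by (simp add: householder_def)
next
  case False
  then have x: "hinner x x \<noteq> 0" "cnj (hinner x x) = hinner x x"
    by (auto simp: hinner_self)
  show ?thesis
    unfolding householder_def hinner_diff_left hinner_diff_right hinner_scale_left hinner_scale_right
    using x by (simp add: cnj_hinner field_simps)
qed

lemma norm_householder: "norm (householder x w) = norm w"
  using hinner_householder[of x w w] by (simp only: hinner_self of_real_eq_iff) simp

lemma linear_householder: "linear (householder x)"
  by (rule linearI)
    (simp_all add: householder_def scaleR_vec_conv_of_real hinner_add_left hinner_scale_left vec_eq_iff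
      algebra_simps add_divide_distrib)

lemma householder_fix: "hinner w x = 0 \<Longrightarrow> householder x w = w"
  by (simp add: householder_def)

text \<open>The reflection subtracts from p the multiple
  \<open>2 * hinner p (p - e) / hinner (p - e) (p - e)\<close> of p - e. Since
  \<open>hinner p e\<close> is real, numerator and denominator agree. This is why axis vectors carry
  a phase later on.\<close>

lemma householder_swap:
  assumes "norm p = 1" "norm e = 1" "cnj (hinner p e) = hinner p e"
  shows "householder (p - e) p = e"
proof (cases "p = e")
  case False
  have ep: "hinner e p = hinner p e" using assms(3) cnj_hinner[of p e] by simp
  have "hinner (p - e) (p - e) \<noteq> 0" using False by (simp add: hinner_self)
  moreover have "hinner (p - e) (p - e) = 2 * hinner p (p - e)"
  proof -
    have "hinner p p = 1" "hinner e e = 1" using assms(1,2) by (simp_all add: hinner_self)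
    then show ?thesis using ep by (simp add: hinner_diff_left hinner_diff_right)
  qed
  ultimately have "2 * hinner p (p - e) / hinner (p - e) (p - e) = 1" by simp
  then show ?thesis by (simp add: householder_def)
qed (simp add: householder_def)

text \<open>The phase of c, or 1 when c = 0; it turns a coordinate axis so that the reality
  condition of \<open>householder_swap\<close> holds.\<close>

lemma ex_phase_cnj_mult_real:
  obtains t where "cmod t = 1" "cnj (c * cnj t) = c * cnj t"
proof (cases "c = 0")
  case True
  then show ?thesis using that[of 1] by simp
next
  case False
  have "c * cnj (c / of_real (cmod c)) = of_real (cmod c)"
    using False complex_norm_square[of c] by (simp add: power2_eq_square field_simps)
  then show ?thesis using that[of "c / of_real (cmod c)"] False by (simp add: norm_divide)
qed

text \<open>Two complex Householder reflections: the second is in a vector orthogonal to the image of \<open>p\<close>,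
  hence fixes it.\<close>

lemma ex_isometry_to_coordinates:
  fixes p q :: "complex^'n"
  assumes "norm p = 1" "norm q = 1" "hinner p q = 0" "i \<noteq> j"
  obtains U :: "complex^'n \<Rightarrow> complex^'n" and a b :: complex where "linear U" "\<And>w. norm (U w) = norm w" "cmod a = 1" "cmod b = 1"
    "\<And>w. hinner w p = a * U w $ i" "\<And>w. hinner w q = b * U w $ j"
proof -
  obtain s where s: "cmod s = 1" "cnj (p $ i * cnj s) = p $ i * cnj s" by (rule ex_phase_cnj_mult_real)
  define e where "e = (axis i s :: complex^'n)"
  have e: "norm e = 1" using s by (simp add: e_def norm_axis_complex)
  have pe: "householder (p - e) p = e"
    using s e assms by (intro householder_swap) (auto simp: e_def hinner_axis_right)
  define q' where "q' = householder (p - e) q"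
  have q': "norm q' = 1" by (simp add: q'_def norm_householder assms)
  have "hinner e q' = 0" using hinner_householder[of "p - e" p q] pe assms by (simp add: q'_def)
  obtain t where t: "cmod t = 1" "cnj (q' $ j * cnj t) = q' $ j * cnj t" by (rule ex_phase_cnj_mult_real)
  define f where "f = (axis j t :: complex^'n)"
  have f: "norm f = 1" using t by (simp add: f_def norm_axis_complex)
  have qf: "householder (q' - f) q' = f"
    using t f q' by (intro householder_swap) (auto simp: f_def hinner_axis_right)
  have ef: "householder (q' - f) e = e"
    using \<open>hinner e q' = 0\<close> assms(4)
    by (intro householder_fix) (simp add: hinner_diff_right f_def hinner_axis_right e_def, simp add: axis_def)
  define U where "U = householder (q' - f) \<circ> householder (p - e)"
  have U: "hinner (U w) (U v) = hinner w v" for w v by (simp add: U_def hinner_householder)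
  show ?thesis
  proof (rule that)
    show "linear U" unfolding U_def by (intro linear_compose linear_householder)
    show "norm (U w) = norm w" for w by (simp add: U_def norm_householder)
    \<comment> \<open>\<open>hinner\<close> is conjugate-linear in its second argument, so the
      phases of the two axis vectors come out conjugated.\<close>
    show "cmod (cnj s) = 1" "cmod (cnj t) = 1" using s t by auto
    have "U p = e" "U q = f" using pe qf ef by (simp_all add: U_def q'_def)
    then show "hinner w p = cnj s * U w $ i" "hinner w q = cnj t * U w $ j" for w
      using U[of w p] U[of w q] by (simp_all add: e_def f_def hinner_axis_right mult.commute)
  qed
qed

text \<open>Gram-Schmidt, with a free choice of p when z = 0 and of q when \<zeta> is a multiple of
  p; the latter choice needs dimension at least two.\<close>

lemma ex_orthonormal_decomposition:
  fixes z \<zeta> :: "complex^'n"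
  assumes "CARD('n) > 1"
  obtains p q a b where "norm p = 1" "norm q = 1" "hinner p q = 0"
    "z = of_real (norm z) *s p" "\<zeta> = a *s p + b *s q"
proof -
  obtain i j :: 'n where ij: "i \<noteq> j"
    using ex_two_distinct[OF assms] .
  have unit: "norm ((1 / of_real (norm x)) *s x) = 1" if "x \<noteq> 0" for x :: "complex^'n"
    using that by (simp add: norm_vec_scale norm_divide)
  obtain p where p: "norm p = 1" "z = of_real (norm z) *s p"
  proof (cases "z = 0")
    case True
    then show ?thesis using that[of "axis i 1"] by (simp add: norm_axis_complex)
  next
    case False
    then show ?thesis using that[of "(1 / of_real (norm z)) *s z"] unit[of z] by (simp add: vector_smult_assoc)
  qed
  have pp: "hinner p p = 1" using p by (simp add: hinner_self)
  obtain q b where q: "norm q = 1" "hinner p q = 0" "\<zeta> - hinner \<zeta> p *s p = b *s q"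
  proof (cases "\<zeta> - hinner \<zeta> p *s p = 0")
    case True
    \<comment> \<open>Two coordinates suffice for a nonzero vector orthogonal to p: swap, conjugate
      and change one sign, or take an axis on which p vanishes.\<close>
    define v where "v = (if p $ i = 0 \<and> p $ j = 0 then axis i 1 else axis i (cnj (p $ j)) - axis j (cnj (p $ i)) :: complex^'n)"
    have "v $ i \<noteq> 0 \<or> v $ j \<noteq> 0" using ij by (auto simp: v_def axis_def)
    then have "v \<noteq> 0" by auto
    moreover have "hinner p v = 0"
      by (auto simp: v_def hinner_diff_right hinner_axis_right)
    ultimately show ?thesis
      using that[of "(1 / of_real (norm v)) *s v" 0] unit[of v] True by (simp add: hinner_scale_right)
  next
    case False
    define v where "v = \<zeta> - hinner \<zeta> p *s p"
    have "hinner v p = 0" by (simp add: v_def hinner_diff_left hinner_scale_left pp)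
    then have "hinner p v = 0" using cnj_hinner[of v p] by simp
    then show ?thesis
      using that[of "(1 / of_real (norm v)) *s v" "of_real (norm v)"] unit[of v] False
      by (simp add: hinner_scale_right vector_smult_assoc flip: v_def)
  qed
  show ?thesis
    using that[OF p(1) q(1,2) p(2), of "hinner \<zeta> p" b] q(3) by (simp add: algebra_simps)
qed

text \<open>An isometry carries the frame p, q to two coordinate directions up to unit phases, which
  \<open>int2_rotate\<close> removes.\<close>

lemma nn_integral_v_alpha_orthonormal:
  fixes p q :: "complex^'n" and G :: "complex \<Rightarrow> complex \<Rightarrow> real"
  assumes p: "norm p = 1" and q: "norm q = 1" and pq: "hinner p q = 0" and n: "CARD('n) > 1"
    and \<alpha>: "\<alpha> > -1" and G: "case_prod G \<in> borel_measurable (borel \<Otimes>\<^sub>M borel)"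
  shows "(\<integral>\<^sup>+w. ennreal (G (hinner w p) (hinner w q)) \<partial>v_alpha \<alpha>) = int2 (real CARD('n) + 1 + \<alpha>) G"
proof -
  obtain i j :: 'n where ij: "i \<noteq> j"
    using ex_two_distinct[OF n] .
  obtain U :: "complex^'n \<Rightarrow> complex^'n" and a b where U: "linear U" "\<And>w. norm (U w) = norm w" "cmod a = 1" "cmod b = 1"
    "\<And>w. hinner w p = a * U w $ i" "\<And>w. hinner w q = b * U w $ j"
    using ex_isometry_to_coordinates[OF p q pq ij] by metis
  note [measurable] = measurable_comp2[OF G]
  have "(\<integral>\<^sup>+w. ennreal (G (hinner w p) (hinner w q)) \<partial>v_alpha \<alpha>) =
    (\<integral>\<^sup>+w. ennreal (G (a * U w $ i) (b * U w $ j)) \<partial>v_alpha \<alpha>)"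
    by (simp add: U)
  also have "\<dots> = (\<integral>\<^sup>+w. ennreal (G (a * w $ i) (b * w $ j)) \<partial>(v_alpha \<alpha> :: (complex^'n) measure))"
    using U \<alpha> by (intro nn_integral_v_alpha_isometry[of U "\<lambda>w. ennreal (G (a * w $ i) (b * w $ j))"]) measurable
  also have "\<dots> = int2 (real CARD('n) + 1 + \<alpha>) (\<lambda>x y. G (a * x) (b * y))"
    using ij \<alpha> by (intro nn_integral_v_alpha_coordinates[of i j \<alpha> "\<lambda>x y. G (a * x) (b * y)"])
      (simp_all add: case_prod_unfold)
  also have "\<dots> = int2 (real CARD('n) + 1 + \<alpha>) G"
    using U G by (intro int2_rotate)
  finally show ?thesis .
qed

section \<open>From the ball to its boundary\<close>

lemma one_minus_of_real_mult_nonzero: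
  assumes "0 \<le> r" "r < 1" "cmod u \<le> 1"
  shows "1 - of_real r * u \<noteq> 0"
proof -
  have "cmod (of_real r * u) < 1"
    using assms mult_mono[of r r "cmod u" 1] by (simp add: norm_mult)
  then show ?thesis by auto
qed

text \<open>The substitution is the automorphism \<open>x = (r - t) / (1 - r t)\<close>, \<open>y = - sqrt (1 - r\<^sup>2) s / (1 - r t)\<close>,
  performed first in \<open>y\<close> for fixed \<open>x\<close> and then in \<open>x\<close>.\<close>

lemma int2_mobius:
  assumes r: "0 \<le> r" "r < 1" and N: "2 < N"
  shows "int2 N (\<lambda>x y. cmod (of_real (1 - r\<^sup>2) * a * x + of_real (sqrt (1 - r\<^sup>2)) * b * y) /
      cmod (1 - of_real r * x) powr (N + 1)) =
    int2 N (\<lambda>x y. cmod (a * (x - of_real r) + b * y) / cmod (1 - of_real r * x) powr N)"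
proof -
  define S where "S = 1 - r\<^sup>2"
  have S: "0 < S" using r by (simp add: S_def abs_square_less_1)
  have rS: "of_real r * of_real r = (1 - of_real S :: complex)"
    by (simp add: S_def power2_eq_square flip: of_real_mult)
  have Sc: "- of_real S = (of_real r * of_real r - 1 :: complex)" by (simp add: rS)
  let ?D = "ball (0::complex) 1"
  define \<Phi> where "\<Phi> t = (of_real r - t) / (1 - of_real r * t)" for t :: complex
  \<comment> \<open>The scaling factor of the second coordinate, expressed through the old variable
    x, since y is substituted while x is still fixed; at \<open>\<Phi> t\<close> it becomes
    \<open>- sqrt S / (1 - r * t)\<close>.\<close>
  define c where "c x = - (1 - of_real r * x) / of_real (sqrt S)" for x :: complex
  define H where "H x y = cmod (of_real S * a * x + of_real (sqrt S) * b * y) / cmod (1 - of_real r * x) powr (N + 1)" for x y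
  define K where "K x y = cmod (a * (x - of_real r) + b * y) / cmod (1 - of_real r * x) powr N" for x y
  have [measurable]: "(\<lambda>x. H (f x) (g x)) \<in> borel_measurable M" "(\<lambda>x. K (f x) (g x)) \<in> borel_measurable M"
    "(\<lambda>x. c (f x)) \<in> borel_measurable M"
    if [measurable]: "f \<in> borel_measurable M" "g \<in> borel_measurable M" for f g and M :: "'b measure"
    unfolding H_def K_def c_def by measurable
  have [measurable]: "?D \<in> sets borel" by simp
  have ne: "1 - of_real r * t \<noteq> 0" if "t \<in> ?D" for t
    using that by (intro one_minus_of_real_mult_nonzero r) simp
  have cne: "c x \<noteq> 0" if "x \<in> ?D" for x using ne[OF that] S by (simp add: c_def)
  have \<Phi>1: "1 - of_real r * \<Phi> t = of_real S / (1 - of_real r * t)" if "t \<in> ?D" for t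
    using ne[OF that] rS by (simp add: \<Phi>_def field_simps)
  have \<Phi>n: "1 - (cmod (\<Phi> t))\<^sup>2 = S * (1 - (cmod t)\<^sup>2) / (cmod (1 - of_real r * t))\<^sup>2" if "t \<in> ?D" for t
  proof -
    have "(cmod (1 - of_real r * t))\<^sup>2 - (cmod (of_real r - t))\<^sup>2 = S * (1 - (cmod t)\<^sup>2)"
      by (simp add: cmod_power2 S_def) (simp add: power2_eq_square algebra_simps)
    then show ?thesis using ne[OF that] by (simp add: \<Phi>_def norm_divide power_divide field_simps)
  qed
  have \<Phi>D: "\<Phi> t \<in> ?D" if "t \<in> ?D" for t
  proof -
    have "0 < S * (1 - (cmod t)\<^sup>2) / (cmod (1 - of_real r * t))\<^sup>2"
      using S ne[OF that] that by (auto intro!: divide_pos_pos mult_pos_pos simp: abs_square_less_1)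
    then have "(cmod (\<Phi> t))\<^sup>2 < 1" using \<Phi>n[OF that] by linarith
    then show ?thesis by (simp add: abs_square_less_1)
  qed
  have \<Phi>\<Phi>: "\<Phi> (\<Phi> t) = t" if "t \<in> ?D" for t
  proof -
    have "\<Phi> (\<Phi> t) = (of_real r - \<Phi> t) / (of_real S / (1 - of_real r * t))"
      unfolding \<Phi>1[OF that, symmetric] by (simp add: \<Phi>_def[of "\<Phi> t"])
    also have "of_real r - \<Phi> t = t * (1 - of_real r * of_real r) / (1 - of_real r * t)"
      using ne[OF that] by (simp add: \<Phi>_def field_simps)
    also have "\<dots> = t * of_real S / (1 - of_real r * t)"
      by (simp add: rS)
    finally show ?thesis using ne[OF that] S by simp
  qed
  have im: "\<Phi> ` ?D = ?D"
    using \<Phi>D \<Phi>\<Phi> by (auto simp: image_iff) (metis dist_0_norm mem_ball)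
  have inj: "inj_on \<Phi> ?D" using \<Phi>\<Phi> by (metis inj_onI)
  define \<Phi>' where "\<Phi>' t = - of_real S / (1 - of_real r * t)\<^sup>2" for t :: complex
  have der: "(\<Phi> has_field_derivative \<Phi>' t) (at t)" if "t \<in> ?D" for t
    unfolding \<Phi>_def \<Phi>'_def Sc using ne[OF that]
    by (auto intro!: derivative_eq_intros simp: power2_eq_square field_simps)
  \<comment> \<open>The integrand after the substitution in y alone, with its Jacobian |c
    x|^2.\<close>
  define G where "G x y = (cmod (c x))\<^sup>2 * (H x (c x * y) * weight2 N x (c x * y))" for x y
  have Gnn: "0 \<le> G x y" for x y
  proof -
    have "0 \<le> H x (c x * y)" by (simp add: H_def)
    then show ?thesis using weight2_nonneg[OF N] by (simp add: G_def)
  qed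
  have [measurable]: "(\<lambda>x. G (f x) (g x)) \<in> borel_measurable M"
    if [measurable]: "f \<in> borel_measurable M" "g \<in> borel_measurable M" for f g and M :: "'b measure"
    unfolding G_def by measurable
  have pt: "(cmod (\<Phi>' t))\<^sup>2 * G (\<Phi> t) y = K t y * weight2 N t y" if "t \<in> ?D" for t y
  proof -
    define d where "d = cmod (1 - of_real r * t)"
    have d: "0 < d" using ne[OF that] by (simp add: d_def)
    have ct: "c (\<Phi> t) = - of_real (sqrt S) / (1 - of_real r * t)"
    proof -
      have "of_real S = (of_real (sqrt S) * of_real (sqrt S) :: complex)"
        using S by (simp flip: of_real_mult)
      then show ?thesis unfolding c_def \<Phi>1[OF that] using S by simp
    qed
    have nc: "(cmod (c (\<Phi> t)))\<^sup>2 = S / d\<^sup>2"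
      unfolding ct using S by (simp add: norm_divide power_divide d_def)
    have n': "(cmod (\<Phi>' t))\<^sup>2 = (S / d\<^sup>2)\<^sup>2"
      using S by (simp add: \<Phi>'_def norm_divide norm_power d_def power_divide)
    have W: "weight2 N (\<Phi> t) (c (\<Phi> t) * y) = (S / d\<^sup>2) powr (N - 3) * weight2 N t y"
    proof -
      have "1 - (cmod (\<Phi> t))\<^sup>2 - (cmod (c (\<Phi> t) * y))\<^sup>2 = S / d\<^sup>2 * (1 - (cmod t)\<^sup>2 - (cmod y)\<^sup>2)"
        unfolding norm_mult power_mult_distrib nc \<Phi>n[OF that] by (simp add: d_def algebra_simps diff_divide_distrib add_divide_distrib)
      moreover have "0 < S / d\<^sup>2" using S d by simp
      ultimately show ?thesis unfolding weight2_def by (simp only: pos_powr_mult mult.left_commute)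
    qed
    have Hn: "H (\<Phi> t) (c (\<Phi> t) * y) = S * cmod (a * (t - of_real r) + b * y) / d / (S / d) powr (N + 1)"
    proof -
      have "of_real (sqrt S) * b * (c (\<Phi> t) * y) = - (of_real S * (b * y) / (1 - of_real r * t))"
        unfolding ct using S by (simp flip: of_real_mult mult.assoc)
      then have "of_real S * a * \<Phi> t + of_real (sqrt S) * b * (c (\<Phi> t) * y) =
        of_real S * a * ((of_real r - t) / (1 - of_real r * t)) - of_real S * (b * y) / (1 - of_real r * t)"
        by (simp add: \<Phi>_def)
      also have "\<dots> = - (of_real S * (a * (t - of_real r) + b * y) / (1 - of_real r * t))"
      proof -
        have "s * a * (u / q) - s * (b * y) / q = - (s * (a * (- u) + b * y) / q)" for s u q :: complex
          by (cases "q = 0") (simp_all add: field_simps)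
        from this[of "of_real S" "of_real r - t"] show ?thesis by simp
      qed
      finally have "of_real S * a * \<Phi> t + of_real (sqrt S) * b * (c (\<Phi> t) * y) =
        - (of_real S * (a * (t - of_real r) + b * y) / (1 - of_real r * t))" .
      moreover have "cmod (1 - of_real r * \<Phi> t) = S / d"
        unfolding \<Phi>1[OF that] using S by (simp add: norm_divide d_def)
      ultimately show ?thesis
        unfolding H_def using S by (simp add: norm_divide norm_mult d_def)
    qed
    \<comment> \<open>The Jacobian in x supplies two factors \<open>S / d\<^sup>2\<close>, the one
      in y supplies one, and the weight N - 3 of them. Their N-th power cancels every S and leaves
      \<open>1 / d powr N\<close>.\<close>
    have "(S / d\<^sup>2)\<^sup>2 * (S / d\<^sup>2) * (S / d\<^sup>2) powr (N - 3) = (S / d\<^sup>2) powr N"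
      using S d powr_add[of "S / d\<^sup>2" 3 "N - 3"] by (simp add: power3_eq_cube power2_eq_square)
    moreover have "S / d / (S / d) powr (N + 1) * (S / d\<^sup>2) powr N = 1 / d powr N"
    proof -
      have "S / d\<^sup>2 = S / d / d" by (simp add: power2_eq_square)
      then have "(S / d\<^sup>2) powr N = (S / d) powr N / d powr N" using S d by (simp add: powr_divide powr_mult)
      moreover have "(S / d) powr (N + 1) = (S / d) * (S / d) powr N" using S d by (simp add: powr_add)
      ultimately show ?thesis using S d by simp
    qed
    ultimately have e: "S / d / (S / d) powr (N + 1) * ((S / d\<^sup>2)\<^sup>2 * (S / d\<^sup>2) * (S / d\<^sup>2) powr (N - 3)) = 1 / d powr N"
      by simp
    have "(cmod (\<Phi>' t))\<^sup>2 * G (\<Phi> t) y =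
      cmod (a * (t - of_real r) + b * y) * (S / d / (S / d) powr (N + 1) * ((S / d\<^sup>2)\<^sup>2 * (S / d\<^sup>2) * (S / d\<^sup>2) powr (N - 3)))
        * weight2 N t y"
      unfolding G_def n' nc W Hn by (simp add: mult_ac)
    also have "\<dots> = cmod (a * (t - of_real r) + b * y) * (1 / d powr N) * weight2 N t y"
      unfolding e ..
    finally show ?thesis by (simp add: K_def d_def)
  qed
  have "int2 N H = (\<integral>\<^sup>+x. \<integral>\<^sup>+y. ennreal (indicator ?D x * G x y) \<partial>lborel \<partial>lborel)"
    unfolding int2_def
  proof (rule nn_integral_cong)
    fix x
    show "(\<integral>\<^sup>+y. ennreal (H x y * weight2 N x y) \<partial>lborel) = (\<integral>\<^sup>+y. ennreal (indicator ?D x * G x y) \<partial>lborel)"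
    proof (cases "x \<in> ?D")
      case True
      then show ?thesis
        using nn_integral_complex_scale[OF cne[OF True], of "\<lambda>y. H x y * weight2 N x y"] N
        by (simp add: G_def H_def weight2_nonneg)
    qed (simp add: weight2_eq_0)
  qed
  \<comment> \<open>The order is exchanged so that x can be substituted for fixed y.\<close>
  also have "\<dots> = (\<integral>\<^sup>+y. \<integral>\<^sup>+x. ennreal (indicator ?D x * G x y) \<partial>lborel \<partial>lborel)"
    by (rule lborel_pair.Fubini') measurable
  also have "\<dots> = (\<integral>\<^sup>+y. \<integral>\<^sup>+t. ennreal (K t y * weight2 N t y) \<partial>lborel \<partial>lborel)"
  proof (rule nn_integral_cong)
    fix y
    have "(\<integral>\<^sup>+x. ennreal (indicator ?D x * G x y) \<partial>lborel) =
      (\<integral>\<^sup>+t. ennreal (indicator ?D t * ((cmod (\<Phi>' t))\<^sup>2 * G (\<Phi> t) y)) \<partial>lborel)"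
      using nn_integral_holomorphic_change_of_variables[OF open_ball der inj, of "\<lambda>x. G x y"] Gnn
      unfolding im by simp
    also have "\<dots> = (\<integral>\<^sup>+t. ennreal (K t y * weight2 N t y) \<partial>lborel)"
    proof (intro nn_integral_cong)
      fix t
      show "ennreal (indicator ?D t * ((cmod (\<Phi>' t))\<^sup>2 * G (\<Phi> t) y)) = ennreal (K t y * weight2 N t y)"
        using pt[of t y] weight2_eq_0[of t N y] by (cases "t \<in> ?D") simp_all
    qed
    finally show "(\<integral>\<^sup>+x. ennreal (indicator ?D x * G x y) \<partial>lborel) = \<dots>" .
  qed
  also have "\<dots> = int2 N K"
    unfolding int2_def by (rule lborel_pair.Fubini'[symmetric]) measurable
  finally show ?thesis
    unfolding H_def K_def S_def .
qed

section \<open>The Poisson integral on the unit disc\<close>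

definition poisson_kernel :: "real \<Rightarrow> real \<Rightarrow> real" where
  "poisson_kernel r t = (1 - r\<^sup>2) / (cmod (1 - of_real r * exp (2 * of_real pi * \<i> * of_real t)))\<^sup>2"

text \<open>Cauchy's formula applied to k(u) = h(u)(1 - r^2)/(1 - r u), which is holomorphic on the
  closed disc and agrees with h at u = r. On the circle u/((u - r)(1 - r u)) equals 1/|1 - r u|^2,
  which produces the Poisson kernel.\<close>

lemma poisson_formula_disc:
  assumes h: "h holomorphic_on cball 0 1" and r: "0 \<le> r" "r < 1"
  shows "((\<lambda>t. of_real ((1 - r\<^sup>2) / (cmod (1 - of_real r * exp (2 * of_real pi * \<i> * of_real t)))\<^sup>2) *
      h (exp (2 * of_real pi * \<i> * of_real t))) has_integral h (of_real r)) {0..1}"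
proof -
  let ?e = "\<lambda>t::real. exp (2 * of_real pi * \<i> * of_real t)"
  define k where "k u = h u * of_real (1 - r\<^sup>2) / (1 - of_real r * u)" for u
  note ne = one_minus_of_real_mult_nonzero[OF r]
  have "k holomorphic_on cball 0 1"
    unfolding k_def using h ne by (intro holomorphic_intros) auto
  then have "((\<lambda>u. k u / (u - of_real r)) has_contour_integral 2 * of_real pi * \<i> * k (of_real r)) (circlepath 0 1)"
    using r by (intro Cauchy_integral_circlepath_simple) auto
  then have "((\<lambda>t. k (circlepath 0 1 t) / (circlepath 0 1 t - of_real r) * vector_derivative (circlepath 0 1) (at t within {0..1}))
     has_integral 2 * of_real pi * \<i> * k (of_real r)) {0..1}"
    by (simp add: has_contour_integral_def)
  then have "((\<lambda>t. 2 * of_real pi * \<i> * (?e t * k (?e t) / (?e t - of_real r))) has_integral 2 * of_real pi * \<i> * k (of_real r)) {0..1}"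
  proof (rule has_integral_eq[rotated])
    fix t :: real assume "t \<in> {0..1}"
    then have "vector_derivative (circlepath 0 1) (at t within {0..1}) = 2 * of_real pi * \<i> * ?e t"
      using vector_derivative_circlepath01[of t 0 1] by simp
    moreover have "circlepath 0 1 t = ?e t" by (simp add: circlepath)
    ultimately show "k (circlepath 0 1 t) / (circlepath 0 1 t - of_real r) * vector_derivative (circlepath 0 1) (at t within {0..1})
      = 2 * of_real pi * \<i> * (?e t * k (?e t) / (?e t - of_real r))" by (simp only: times_divide_eq_right times_divide_eq_left mult_ac)
  qed
  then have *: "((\<lambda>t. ?e t * k (?e t) / (?e t - of_real r)) has_integral k (of_real r)) {0..1}"
    by (subst (asm) has_integral_mult_right_iff) simp_all
  have "1 - (of_real r)\<^sup>2 \<noteq> (0::complex)"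
    using ne[of "of_real r"] r by (simp add: power2_eq_square)
  then have kr: "k (of_real r) = h (of_real r)"
    by (simp add: k_def power2_eq_square)
  show ?thesis
  proof (rule has_integral_eq[OF _ *[unfolded kr]])
    fix t :: real assume "t \<in> {0..1}"
    define e where "e = ?e t"
    have e1: "cmod e = 1" by (simp add: e_def)
    then have ee: "e * cnj e = 1" by (simp add: complex_norm_square[symmetric])
    have "e \<noteq> 0" using e1 by auto
    have "(of_real ((cmod (1 - of_real r * e))\<^sup>2) :: complex) = (1 - of_real r * e) * (1 - of_real r * cnj e)"
      by (simp only: complex_norm_square) simp
    also have "\<dots> = (1 - of_real r * e) * (e - of_real r) / e"
    proof -
      have "cnj e = 1 / e" using ee \<open>e \<noteq> 0\<close> by (simp add: field_simps)
      show ?thesis unfolding \<open>cnj e = 1 / e\<close> using \<open>e \<noteq> 0\<close> by (simp add: field_simps)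
    qed
    finally show "?e t * k (?e t) / (?e t - of_real r) =
      of_real ((1 - r\<^sup>2) / (cmod (1 - of_real r * ?e t))\<^sup>2) * h (?e t)"
      unfolding e_def[symmetric] of_real_divide by (simp add: k_def)
  qed
qed

lemma poisson_kernel_nonneg: "0 \<le> r \<Longrightarrow> r < 1 \<Longrightarrow> 0 \<le> poisson_kernel r t"
  by (simp add: poisson_kernel_def power_le_one)

lemma continuous_on_poisson_kernel:
  assumes "0 \<le> r" "r < 1"
  shows "continuous_on A (poisson_kernel r)"
  unfolding poisson_kernel_def using one_minus_of_real_mult_nonzero[OF assms]
  by (intro continuous_intros) auto

lemma nn_integral_poisson_kernel:
  assumes "0 \<le> r" "r < 1"
  shows "(\<integral>\<^sup>+t. ennreal (indicator {0..1} t * poisson_kernel r t) \<partial>lborel) = 1"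
proof -
  have "((\<lambda>t. complex_of_real (poisson_kernel r t)) has_integral of_real 1) {0..1}"
    using poisson_formula_disc[of "\<lambda>_. 1" r] assms by (simp add: poisson_kernel_def)
  from has_integral_linear[OF this bounded_linear_Re]
  have 1: "integral {0..1} (poisson_kernel r) = 1"
    by (intro integral_unique) (simp add: o_def)
  have "poisson_kernel r absolutely_integrable_on {0..1}"
    by (intro absolutely_integrable_continuous_real continuous_on_poisson_kernel assms)
  moreover have [measurable]: "poisson_kernel r \<in> borel_measurable borel"
    by (intro borel_measurable_continuous_onI continuous_on_poisson_kernel assms)
  moreover have "(\<lambda>t. indicator {0..1} t * poisson_kernel r t) \<in> borel_measurable borel" by measurable
  ultimately show ?thesis
    using absolutely_integrable_iff_nn_integral(2)[of "{0..1}" "poisson_kernel r"] assms 1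
    by (simp add: poisson_kernel_nonneg)
qed

text \<open>The triangle inequality under the Poisson formula, in other words subharmonicity of
  |h|.\<close>

lemma norm_le_poisson:
  assumes h: "h holomorphic_on cball 0 1" and r: "0 \<le> r" "r < 1"
  shows "ennreal (cmod (h (of_real r))) \<le>
    (\<integral>\<^sup>+t. ennreal (indicator {0..1} t * (poisson_kernel r t * cmod (h (exp (2 * of_real pi * \<i> * of_real t))))) \<partial>lborel)"
proof -
  let ?e = "\<lambda>t::real. exp (2 * of_real pi * \<i> * of_real t)"
  let ?f = "\<lambda>t. poisson_kernel r t * cmod (h (?e t))"
  have conth: "continuous_on A (\<lambda>t. h (?e t))" for A
    by (rule continuous_on_compose2[OF holomorphic_on_imp_continuous_on[OF h]]) (auto intro!: continuous_intros)
  have cont: "continuous_on A ?f" for A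
    by (intro continuous_intros continuous_on_poisson_kernel conth r)
  have i: "((\<lambda>t. of_real (poisson_kernel r t) * h (?e t)) has_integral h (of_real r)) {0..1}"
    unfolding poisson_kernel_def by (rule poisson_formula_disc[OF h r])
  have "cmod (integral {0..1} (\<lambda>t. of_real (poisson_kernel r t) * h (?e t))) \<le> integral {0..1} ?f"
    using r i cont by (intro integral_norm_bound_integral)
      (auto simp: norm_mult poisson_kernel_nonneg intro: integrable_continuous_real)
  then have "cmod (h (of_real r)) \<le> integral {0..1} ?f"
    using integral_unique[OF i] by simp
  also have "ennreal (integral {0..1} ?f) = (\<integral>\<^sup>+t. ennreal (indicator {0..1} t * ?f t) \<partial>lborel)"
  proof (rule absolutely_integrable_iff_nn_integral(2)[symmetric])
    have [measurable]: "?f \<in> borel_measurable borel" using cont by (rule borel_measurable_continuous_onI)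
    show "(\<lambda>t. indicator {0..1} t * ?f t) \<in> borel_measurable borel" by measurable
  qed (use r cont in \<open>auto simp: poisson_kernel_nonneg intro: absolutely_integrable_continuous_real\<close>)
  finally show ?thesis by (simp add: ennreal_leI)
qed

lemma borel_measurable_cnj[measurable]:
  "f \<in> borel_measurable M \<Longrightarrow> (\<lambda>x. cnj (f x)) \<in> borel_measurable M"
  by (rule borel_measurable_continuous_on[where f = cnj]) (auto intro: continuous_intros)

text \<open>The integral in \<open>ell\<close> without its factor N, with free coefficients: the
  value at r = 1 of the integrals over the ball.\<close>

definition boundary_int :: "real \<Rightarrow> real \<Rightarrow> real \<Rightarrow> ennreal" where
  "boundary_int N A B = int2 N (\<lambda>x y. cmod ((1 - x) * of_real A + y * of_real B) / cmod (x - 1) powr N)"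

text \<open>Replacing x by e x moves the boundary point e to 1, and a rotation of y aligns the
  phases of the two terms. A common unimodular factor then drops out, so the value depends neither
  on e nor on the phases of a and b.\<close>

lemma int2_boundary_rotate:
  assumes e: "cmod e = 1"
  shows "int2 N (\<lambda>x y. cmod (a * (x - e) + b * y) / cmod (1 - e * cnj x) powr N) = boundary_int N (cmod a) (cmod b)"
proof -
  \<comment> \<open>u is the common phase: after the rotations the numerator is u times
    \<open>(1 - x) * cmod a + y * cmod b\<close>. When a or b is zero the matching phase is
    arbitrary.\<close>
  obtain u where u: "cmod u = 1" "a * e = - of_real (cmod a) * u"
  proof (cases "a = 0")
    case True
    then show ?thesis using that[of 1] by simp
  next
    case False
    then show ?thesis using that[of "- (a * e / of_real (cmod a))"] e by (simp add: norm_divide norm_mult)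
  qed
  obtain d where d: "cmod d = 1" "b * d = of_real (cmod b) * u"
  proof (cases "b = 0")
    case True
    then show ?thesis using that[of 1] by simp
  next
    case False
    then show ?thesis using that[of "of_real (cmod b) * u / b"] u by (simp add: norm_divide norm_mult)
  qed
  have ee: "e * cnj e = 1" using e by (simp add: complex_norm_square[symmetric])
  have "int2 N (\<lambda>x y. cmod (a * (x - e) + b * y) / cmod (1 - e * cnj x) powr N) =
    int2 N (\<lambda>x y. cmod (a * (e * x - e) + b * (d * y)) / cmod (1 - e * cnj (e * x)) powr N)"
    by (intro int2_rotate[symmetric] e d) measurable
  also have "(\<lambda>x y. cmod (a * (e * x - e) + b * (d * y)) / cmod (1 - e * cnj (e * x)) powr N) =
    (\<lambda>x y. cmod ((1 - x) * of_real (cmod a) + y * of_real (cmod b)) / cmod (x - 1) powr N)"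
  proof (intro ext)
    fix x y
    have "a * (e * x - e) + b * (d * y) = (a * e) * (x - 1) + (b * d) * y" by (simp add: algebra_simps)
    also have "\<dots> = u * ((1 - x) * of_real (cmod a) + y * of_real (cmod b))"
      unfolding u d by (simp add: algebra_simps)
    finally have 1: "cmod (a * (e * x - e) + b * (d * y)) = cmod ((1 - x) * of_real (cmod a) + y * of_real (cmod b))"
      using u by (simp add: norm_mult)
    have "1 - e * cnj (e * x) = 1 - (e * cnj e) * cnj x" by simp
    also have "\<dots> = cnj (1 - x)" unfolding ee by simp
    finally have 2: "cmod (1 - e * cnj (e * x)) = cmod (x - 1)"
      by (simp only: complex_mod_cnj norm_minus_commute)
    show "cmod (a * (e * x - e) + b * (d * y)) / cmod (1 - e * cnj (e * x)) powr N =
      cmod ((1 - x) * of_real (cmod a) + y * of_real (cmod b)) / cmod (x - 1) powr N"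
      unfolding 1 2 ..
  qed
  finally show ?thesis unfolding boundary_int_def .
qed

text \<open>The integrand becomes the modulus of a function holomorphic in \<open>r\<close> once \<open>1 - r x\<close> is replaced by
  \<open>1 - r cnj x\<close>, which has the same modulus for real \<open>r\<close>.\<close>

lemma int2_le_boundary_int:
  assumes r: "0 \<le> r" "r < 1" and N: "2 < N"
  shows "int2 N (\<lambda>x y. cmod (a * (x - of_real r) + b * y) / cmod (1 - of_real r * x) powr N) \<le>
    boundary_int N (cmod a) (cmod b)"
proof -
  let ?e = "\<lambda>t::real. exp (2 * of_real pi * \<i> * of_real t) :: complex"
  define K where "K l x y = cmod (a * (x - l) + b * y) / cmod (1 - l * cnj x) powr N" for l x y
  define P where "P t = indicator {0..1} t * poisson_kernel r t" for t
  have P0: "0 \<le> P t" for t using r by (simp add: P_def poisson_kernel_nonneg)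
  have [measurable]: "P \<in> borel_measurable borel"
  proof -
    have [measurable]: "poisson_kernel r \<in> borel_measurable borel"
      by (intro borel_measurable_continuous_onI continuous_on_poisson_kernel r)
    show ?thesis unfolding P_def by measurable
  qed
  have [measurable]: "?e \<in> borel_measurable borel"
    by (intro borel_measurable_continuous_onI continuous_intros)
  have [measurable]: "(\<lambda>x. K (l x) (f x) (g x)) \<in> borel_measurable M"
    if [measurable]: "l \<in> borel_measurable M" "f \<in> borel_measurable M" "g \<in> borel_measurable M"
    for l f g and M :: "'b measure"
    unfolding K_def by measurable
  have pw: "ennreal (K (of_real r) x y * weight2 N x y) \<le>
      (\<integral>\<^sup>+t. ennreal (P t) * ennreal (K (?e t) x y * weight2 N x y) \<partial>lborel)" for x y
  proof (cases "cmod x < 1")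
    case False
    then show ?thesis by (simp add: weight2_eq_0)
  next
    case True
    \<comment> \<open>For |l| at most 1 and |x| < 1 the base \<open>1 - l * cnj x\<close> has
      positive real part, so the principal power is holomorphic in l up to the unit circle. Its
      exponent is real, so the modulus of the power is the power of the modulus.\<close>
    define h where "h l = (a * (x - l) + b * y) / (1 - l * cnj x) powr of_real N" for l
    have Re: "0 < Re (1 - l * cnj x)" if "cmod l \<le> 1" for l
    proof -
      have "cmod (l * cnj x) < 1"
        using that True mult_mono[of "cmod l" 1 "cmod x" "cmod x"] by (simp add: norm_mult)
      then show ?thesis using complex_Re_le_cmod[of "l * cnj x"] by simp
    qed
    have "h holomorphic_on cball 0 1"
      unfolding h_def
    proof (intro holomorphic_intros)
      fix l :: complex assume "l \<in> cball 0 1"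
      then have "0 < Re (1 - l * cnj x)" using Re by simp
      then have "1 - l * cnj x \<noteq> 0" "\<not> Re (1 - l * cnj x) \<le> 0"
        by (metis less_irrefl zero_complex.sel(1), linarith)
      then show "1 - l * cnj x \<notin> \<real>\<^sub>\<le>\<^sub>0" "(1 - l * cnj x) powr of_real N \<noteq> 0"
        by (simp_all only: complex_nonpos_Reals_iff powr_eq_0_iff simp_thms)
    qed
    then have "ennreal (cmod (h (of_real r))) \<le>
      (\<integral>\<^sup>+t. ennreal (indicator {0..1} t * (poisson_kernel r t * cmod (h (?e t)))) \<partial>lborel)"
      using r by (rule norm_le_poisson)
    moreover have hK: "cmod (h l) = K l x y" for l
      by (simp add: h_def K_def norm_divide norm_powr_real_powr')
    ultimately have "ennreal (K (of_real r) x y) \<le> (\<integral>\<^sup>+t. ennreal (P t * K (?e t) x y) \<partial>lborel)"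
      by (simp add: P_def mult.assoc)
    then have "ennreal (K (of_real r) x y) * ennreal (weight2 N x y) \<le>
      (\<integral>\<^sup>+t. ennreal (P t * K (?e t) x y) \<partial>lborel) * ennreal (weight2 N x y)"
      by (rule mult_right_mono) simp
    also have "\<dots> = (\<integral>\<^sup>+t. ennreal (P t * K (?e t) x y) * ennreal (weight2 N x y) \<partial>lborel)"
      by (rule nn_integral_multc[symmetric]) measurable
    also have "\<dots> = (\<integral>\<^sup>+t. ennreal (P t) * ennreal (K (?e t) x y * weight2 N x y) \<partial>lborel)"
    proof (intro nn_integral_cong)
      fix t
      have "0 \<le> K (?e t) x y" by (simp add: K_def)
      then show "ennreal (P t * K (?e t) x y) * ennreal (weight2 N x y) = ennreal (P t) * ennreal (K (?e t) x y * weight2 N x y)"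
        using P0[of t] weight2_nonneg[OF N, of x y] by (simp add: ennreal_mult mult.assoc)
    qed
    finally show ?thesis
      using weight2_nonneg[OF N, of x y] by (simp add: ennreal_mult'')
  qed
  have "int2 N (\<lambda>x y. cmod (a * (x - of_real r) + b * y) / cmod (1 - of_real r * x) powr N) = int2 N (K (of_real r))"
  proof -
    have "cmod (1 - of_real r * x) = cmod (1 - of_real r * cnj x)" for x
      using complex_mod_cnj[of "1 - of_real r * x"] by simp
    then show ?thesis unfolding K_def by simp
  qed
  \<comment> \<open>Tonelli moves the circle variable t outermost; there the inner integral is the
    same for all t, and the Poisson kernel has mass 1.\<close>
  also have "\<dots> \<le> (\<integral>\<^sup>+x. \<integral>\<^sup>+y. \<integral>\<^sup>+t. ennreal (P t) * ennreal (K (?e t) x y * weight2 N x y) \<partial>lborel \<partial>lborel \<partial>lborel)"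
    unfolding int2_def by (intro nn_integral_mono pw)
  also have "\<dots> = (\<integral>\<^sup>+x. \<integral>\<^sup>+t. \<integral>\<^sup>+y. ennreal (P t) * ennreal (K (?e t) x y * weight2 N x y) \<partial>lborel \<partial>lborel \<partial>lborel)"
    by (intro nn_integral_cong lborel_pair.Fubini') measurable
  also have "\<dots> = (\<integral>\<^sup>+t. \<integral>\<^sup>+x. \<integral>\<^sup>+y. ennreal (P t) * ennreal (K (?e t) x y * weight2 N x y) \<partial>lborel \<partial>lborel \<partial>lborel)"
    by (intro lborel_pair.Fubini') measurable
  also have "\<dots> = (\<integral>\<^sup>+t. ennreal (P t) * int2 N (K (?e t)) \<partial>lborel)"
    unfolding int2_def by (simp add: nn_integral_cmult)
  also have "\<dots> = (\<integral>\<^sup>+t. ennreal (P t) * boundary_int N (cmod a) (cmod b) \<partial>lborel)"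
    unfolding K_def by (simp add: int2_boundary_rotate)
  also have "\<dots> = boundary_int N (cmod a) (cmod b)"
  proof -
    have "(\<integral>\<^sup>+t. ennreal (P t) \<partial>lborel) = 1"
      unfolding P_def by (rule nn_integral_poisson_kernel[OF r])
    then show ?thesis by (subst nn_integral_multc) simp_all
  qed
  finally show ?thesis .
qed

text \<open>Fatou's lemma along radii increasing to 1: inside the disc the denominator converges to
  a nonzero limit, and outside it the weight vanishes. The sign of B is reversed because x - r tends
  to -(1 - x).\<close>

lemma boundary_int_le:
  assumes N: "2 < N"
    and le: "\<And>r. 0 \<le> r \<Longrightarrow> r < 1 \<Longrightarrow>
      int2 N (\<lambda>x y. cmod (of_real A * (x - of_real r) + of_real (- B) * y) / cmod (1 - of_real r * x) powr N) \<le> C"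
  shows "boundary_int N A B \<le> C"
proof -
  define r where "r n = 1 - inverse (real (Suc n))" for n
  have r: "0 \<le> r n" "r n < 1" for n by (auto simp: r_def field_simps)
  have rlim: "r \<longlonglongrightarrow> 1"
    using tendsto_diff[OF tendsto_const[of 1] LIMSEQ_inverse_real_of_nat] by (simp add: r_def[abs_def])
  define u where "u n = (\<lambda>(x, y). ennreal (cmod (of_real A * (x - of_real (r n)) + of_real (- B) * y) /
    cmod (1 - of_real (r n) * x) powr N * weight2 N x y))" for n
  have [measurable]: "u n \<in> borel_measurable (borel \<Otimes>\<^sub>M borel)" for n
    unfolding u_def by measurable
  have lim: "(\<lambda>n. u n (x, y)) \<longlonglongrightarrow>
    ennreal (cmod ((1 - x) * of_real A + y * of_real B) / cmod (x - 1) powr N * weight2 N x y)" for x y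
  proof (cases "cmod x < 1")
    case False
    then show ?thesis by (simp add: u_def weight2_eq_0)
  next
    case True
    then have ne: "x \<noteq> 1" by auto
    have "cmod ((1 - x) * of_real A + y * of_real B) = cmod (of_real A * (x - of_real 1) + of_real (- B) * y)"
      using norm_minus_cancel[of "(1 - x) * of_real A + y * of_real B"] by (simp add: algebra_simps)
    moreover have "cmod (x - 1) = cmod (1 - of_real 1 * x)" by (simp add: norm_minus_commute)
    moreover have "(\<lambda>n. u n (x, y)) \<longlonglongrightarrow> ennreal (cmod (of_real A * (x - of_real 1) + of_real (- B) * y) /
      cmod (1 - of_real 1 * x) powr N * weight2 N x y)"
      unfolding u_def prod.case using ne by (intro tendsto_intros rlim) auto
    ultimately show ?thesis by simp
  qed
  \<comment> \<open>Both coordinates are merged into one product integral, so that a single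
    application of Fatou suffices.\<close>
  have int: "int2 N (\<lambda>x y. cmod (of_real A * (x - of_real (r n)) + of_real (- B) * y) / cmod (1 - of_real (r n) * x) powr N) =
    (\<integral>\<^sup>+p. u n p \<partial>(lborel \<Otimes>\<^sub>M lborel))" for n
    unfolding int2_def by (subst lborel.nn_integral_fst[symmetric]) (simp_all add: u_def)
  have "boundary_int N A B = (\<integral>\<^sup>+x. \<integral>\<^sup>+y. liminf (\<lambda>n. u n (x, y)) \<partial>lborel \<partial>lborel)"
    unfolding boundary_int_def int2_def by (simp only: lim_imp_Liminf[OF sequentially_bot lim])
  also have "\<dots> = (\<integral>\<^sup>+p. liminf (\<lambda>n. u n p) \<partial>(lborel \<Otimes>\<^sub>M lborel))"
    by (rule lborel.nn_integral_fst[of "\<lambda>p. liminf (\<lambda>n. u n p)"]) measurable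
  also have "\<dots> \<le> liminf (\<lambda>n. \<integral>\<^sup>+p. u n p \<partial>(lborel \<Otimes>\<^sub>M lborel))"
    by (rule nn_integral_liminf) measurable
  also have "\<dots> \<le> C"
    unfolding int[symmetric] by (intro Liminf_le always_eventually allI le r) simp
  finally show ?thesis .
qed

section \<open>The values at the end points\<close>

text \<open>With u = v^2 the derivative 2v meets \<open>u powr (-1/2)\<close> and leaves the
  constant 2, which accounts for the two half lines of an even integrand.\<close>

lemma nn_integral_cauchy_weight:
  assumes "1 < m"
  shows "(\<integral>\<^sup>+v. ennreal ((1 + v\<^sup>2) powr - (m / 2)) \<partial>lborel) = ennreal (Beta (1/2) ((m - 1) / 2))"
proof -
  let ?f = "\<lambda>u::real. u powr (1/2 - 1) * (1 + u) powr - (1/2 + (m - 1) / 2)"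
  let ?h = "\<lambda>v::real. \<bar>2 * v\<bar> * ?f (v\<^sup>2)"
  let ?g = "\<lambda>v::real. (1 + v\<^sup>2) powr - (m / 2)"
  have im: "(\<lambda>v. v\<^sup>2) ` {0<..} = {0::real<..}"
  proof -
    have "x \<in> (\<lambda>v. v\<^sup>2) ` {0<..}" if "x > 0" for x :: real
      using that by (intro image_eqI[of _ _ "sqrt x"]) auto
    then show ?thesis by auto
  qed
  have "ennreal (Beta (1/2) ((m - 1) / 2)) = (\<integral>\<^sup>+u. ennreal (pos_powr u (1/2 - 1) * (1 + u) powr - (1/2 + (m - 1) / 2)) \<partial>lborel)"
    using assms by (intro nn_integral_Beta_halfline[symmetric]) auto
  also have "\<dots> = (\<integral>\<^sup>+u. ennreal (indicator ((\<lambda>v. v\<^sup>2) ` {0<..}) u * ?f u) \<partial>lborel)"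
    unfolding im by (intro nn_integral_cong) (simp add: pos_powr_def indicator_def)
  also have "\<dots> = (\<integral>\<^sup>+v. ennreal (indicator {0<..} v * ?h v) \<partial>lborel)"
  proof (rule nn_integral_eq_if_absolutely_integrable_iff)
    show "(?f absolutely_integrable_on (\<lambda>v. v\<^sup>2) ` {0<..} \<and> integral ((\<lambda>v. v\<^sup>2) ` {0<..}) ?f = b) \<longleftrightarrow>
      (?h absolutely_integrable_on {0<..} \<and> integral {0<..} ?h = b)" for b
      by (rule has_absolute_integral_change_of_variables_1'[symmetric])
        (auto intro!: derivative_eq_intros simp: inj_on_def)
  qed (auto simp: im)
  also have "\<dots> = (\<integral>\<^sup>+v. ennreal (2 * (indicator {0<..} v * ?g v)) \<partial>lborel)"
  proof (intro nn_integral_cong)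
    fix v :: real
    have "\<bar>2 * v\<bar> * ?f (v\<^sup>2) = 2 * ?g v" if "v > 0"
    proof -
      have "(v\<^sup>2) powr (1/2 - 1) = 1 / v"
        using that by (simp add: powr_minus_divide powr_half_sqrt)
      moreover have "- (1/2 + (m - 1) / 2) = - (m / 2)" by (simp add: field_simps)
      ultimately show ?thesis using that by simp
    qed
    then show "ennreal (indicator {0<..} v * ?h v) = ennreal (2 * (indicator {0<..} v * ?g v))"
      by (auto simp: indicator_def)
  qed
  also have "\<dots> = (\<integral>\<^sup>+v. ennreal (indicator {0<..} v * ?g v) \<partial>lborel) + (\<integral>\<^sup>+v. ennreal (indicator {0<..} v * ?g v) \<partial>lborel)"
  proof -
    have "(\<integral>\<^sup>+v. ennreal (2 * (indicator {0<..} v * ?g v)) \<partial>lborel) = (\<integral>\<^sup>+v. 2 * ennreal (indicator {0<..} v * ?g v) \<partial>lborel)"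
      by (intro nn_integral_cong) (subst ennreal_mult', simp_all)
    also have "\<dots> = 2 * (\<integral>\<^sup>+v. ennreal (indicator {0<..} v * ?g v) \<partial>lborel)"
      by (rule nn_integral_cmult) measurable
    finally show ?thesis by (simp only: mult_2)
  qed
  also have "(\<integral>\<^sup>+v. ennreal (indicator {0<..} v * ?g v) \<partial>lborel) + (\<integral>\<^sup>+v. ennreal (indicator {0<..} v * ?g v) \<partial>lborel) =
    (\<integral>\<^sup>+v. ennreal (indicator {0<..} v * ?g v) \<partial>lborel) + (\<integral>\<^sup>+v. ennreal (indicator {0<..} (-v) * ?g v) \<partial>lborel)"
    using nn_integral_real_affine[of "\<lambda>v. ennreal (indicator {0<..} v * ?g v)" "-1" 0] by simp
  also have "\<dots> = (\<integral>\<^sup>+v. ennreal (indicator {0<..} v * ?g v) + ennreal (indicator {0<..} (-v) * ?g v) \<partial>lborel)"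
    by (subst nn_integral_add) auto
  also have "\<dots> = (\<integral>\<^sup>+v. ennreal (?g v) \<partial>lborel)"
  proof (intro nn_integral_cong_AE)
    have "AE v in lborel. v \<noteq> (0::real)" by (rule AE_lborel_singleton)
    then show "AE v in lborel. ennreal (indicator {0<..} v * ?g v) + ennreal (indicator {0<..} (-v) * ?g v) = ennreal (?g v)"
      by eventually_elim (auto simp: indicator_def)
  qed
  finally show ?thesis by simp
qed

text \<open>The Cayley transform to the half plane \<open>Re z > 0\<close>; with the exponent \<open>2 p + 3 - N\<close> the integrand there
  becomes \<open>(Re z)\<^sup>p |z + 1|\<close> to the power \<open>- (N + 1)\<close>, whatever \<open>p\<close> is.\<close>

lemma nn_integral_disc_cayley:
  assumes p: "-1 < p" and N: "p < N - 1" "1 < N"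
  shows "(\<integral>\<^sup>+x. ennreal (pos_powr (1 - (cmod x)\<^sup>2) p / cmod (1 - x) powr (2 * p + 3 - N)) \<partial>lborel) =
    ennreal (2 powr (N - 1) * Beta (1/2) (N / 2) * Beta (p + 1) (N - 1 - p))"
proof -
  let ?S = "{z::complex. 0 < Re z}"
  let ?g = "\<lambda>z::complex. (z - 1) / (z + 1)"
  let ?g' = "\<lambda>z::complex. 2 / (z + 1)\<^sup>2"
  let ?F = "\<lambda>x. pos_powr (1 - (cmod x)\<^sup>2) p / cmod (1 - x) powr (2 * p + 3 - N)"
  have ne: "z + 1 \<noteq> 0" if "z \<in> ?S" for z
    using that by (auto simp: complex_eq_iff)
  have w1: "1 - ?g z = 2 / (z + 1)" if "z \<in> ?S" for z
    using ne[OF that] by (simp add: field_simps)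
  have w2: "1 - (cmod (?g z))\<^sup>2 = 4 * Re z / (cmod (z + 1))\<^sup>2" if "z \<in> ?S" for z
  proof -
    have "(cmod (z + 1))\<^sup>2 - (cmod (z - 1))\<^sup>2 = 4 * Re z"
      by (simp add: cmod_power2) (simp add: power2_eq_square algebra_simps)
    moreover have "1 - (cmod (?g z))\<^sup>2 = ((cmod (z + 1))\<^sup>2 - (cmod (z - 1))\<^sup>2) / (cmod (z + 1))\<^sup>2"
      unfolding norm_divide power_divide using ne[OF that] by (simp add: diff_divide_distrib)
    ultimately show ?thesis by simp
  qed
  have im: "?g ` ?S = ball 0 1"
  proof (intro equalityI subsetI)
    fix w assume "w \<in> ?g ` ?S"
    then obtain z where z: "z \<in> ?S" "w = ?g z" by auto
    have "0 < 4 * Re z / (cmod (z + 1))\<^sup>2" using z ne[of z] by simp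
    then have "(cmod w)\<^sup>2 < 1" using w2[OF z(1)] unfolding z(2) by linarith
    then show "w \<in> ball 0 1" by (simp add: abs_square_less_1)
  next
    fix w :: complex assume w: "w \<in> ball 0 1"
    then have ne: "1 - w \<noteq> 0" by auto
    define z where "z = (1 + w) / (1 - w)"
    have "z + 1 = 2 / (1 - w)" "z - 1 = 2 * w / (1 - w)" using ne by (simp_all add: z_def field_simps)
    then have "w = ?g z" using ne by simp
    have "Re z = (1 - (cmod w)\<^sup>2) / (cmod (1 - w))\<^sup>2"
      unfolding z_def Re_divide cmod_power2 by (simp add: power2_eq_square algebra_simps)
    moreover have "(cmod w)\<^sup>2 < 1" using w by (simp add: abs_square_less_1)
    ultimately have "z \<in> ?S" using ne by simp
    with \<open>w = ?g z\<close> show "w \<in> ?g ` ?S" by blast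
  qed
  have inj: "inj_on ?g ?S"
  proof (rule inj_onI)
    fix x y assume "x \<in> ?S" "y \<in> ?S" "?g x = ?g y"
    then have "2 / (x + 1) = 2 / (y + 1)" using w1 by metis
    then show "x = y" using ne \<open>x \<in> ?S\<close> \<open>y \<in> ?S\<close> by (simp add: frac_eq_eq)
  qed
  have der: "(?g has_field_derivative ?g' z) (at z)" if "z \<in> ?S" for z
    using ne[OF that] by (auto intro!: derivative_eq_intros simp: power2_eq_square)
  have oS: "open ?S" by (rule open_halfspace_Re_gt)
  define A where "A = Beta (1/2) (N / 2)"
  have A0: "0 \<le> A"
    using N by (auto simp: A_def Beta_def intro!: divide_nonneg_nonneg mult_nonneg_nonneg Gamma_real_nonneg)
  have "(\<integral>\<^sup>+x. ennreal (?F x) \<partial>lborel) = (\<integral>\<^sup>+x. ennreal (indicator (?g ` ?S) x * ?F x) \<partial>lborel)"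
  proof (intro nn_integral_cong)
    fix x :: complex
    show "ennreal (?F x) = ennreal (indicator (?g ` ?S) x * ?F x)"
      unfolding im by (auto simp: indicator_def pos_powr_def abs_square_less_1)
  qed
  also have "\<dots> = (\<integral>\<^sup>+z. ennreal (indicator ?S z * ((cmod (?g' z))\<^sup>2 * ?F (?g z))) \<partial>lborel)"
    by (rule nn_integral_holomorphic_change_of_variables[OF oS der inj]) (auto intro!: divide_nonneg_nonneg)
  also have "\<dots> = (\<integral>\<^sup>+z. ennreal (2 powr (N - 1) * (pos_powr (Re z) p * cmod (z + 1) powr - (N + 1))) \<partial>lborel)"
  proof (intro nn_integral_cong)
    fix z :: complex
    show "ennreal (indicator ?S z * ((cmod (?g' z))\<^sup>2 * ?F (?g z))) =
      ennreal (2 powr (N - 1) * (pos_powr (Re z) p * cmod (z + 1) powr - (N + 1)))"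
    proof (cases "z \<in> ?S")
      case False
      then show ?thesis by (simp add: pos_powr_def)
    next
      case True
      define d where "d = cmod (z + 1)"
      have d: "d > 0" using ne[OF True] by (simp add: d_def)
      have e1: "(cmod (?g' z))\<^sup>2 = 4 * d powr (-4)"
        using d by (simp add: norm_divide norm_power d_def[symmetric] power_divide powr_minus_divide)
      have "?F (?g z) = (4 * Re z * d powr (-2)) powr p / (2 * d powr (-1)) powr (2 * p + 3 - N)"
        unfolding w1[OF True] w2[OF True] using True d
        by (simp add: pos_powr_def norm_divide d_def[symmetric] powr_minus_divide)
      also have "\<dots> = 4 powr p * Re z powr p * d powr (-2 * p) * (2 powr - (2 * p + 3 - N) * d powr (2 * p + 3 - N))"
      proof -
        have m3: "(u * v * w) powr p = u powr p * v powr p * w powr p" if "0 \<le> u" "0 \<le> v" "0 \<le> w" for u v w :: real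
          using that by (simp add: powr_mult)
        have "(4 * Re z * d powr (-2)) powr p = 4 powr p * Re z powr p * d powr (-2 * p)"
          using True by (subst m3) (simp_all only: powr_powr, simp_all)
        moreover have "(2 * d powr (-1)) powr q = 2 powr q * d powr (- q)" for q
          by (subst powr_mult) (simp_all only: powr_powr, simp_all)
        moreover have "1 / (2 powr q * d powr (- q)) = 2 powr - q * d powr q" for q
          by (simp add: powr_minus_divide)
        ultimately show ?thesis
          by (metis (no_types) divide_inverse inverse_eq_divide)
      qed
      finally have e2: "?F (?g z) = 4 powr p * Re z powr p * d powr (-2 * p) * (2 powr - (2 * p + 3 - N) * d powr (2 * p + 3 - N))" .
      have e3: "(4::real) powr p = 2 powr (2 * p)"
        using powr_powr[of 2 2 p] by simp
      \<comment> \<open>The powers of 2 come from |g'|^2, from the factor 4 in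
        \<open>1 - |g z|\<^sup>2\<close> raised to p, and from \<open>|1 - g z|\<close>; p cancels
        among them.\<close>
      have e4: "4 * 2 powr (2 * p) * 2 powr - (2 * p + 3 - N) = (2::real) powr (N - 1)"
        using powr_add[of 2 2 "2 * p + (- (2 * p + 3 - N))"] powr_add[of 2 "2 * p" "- (2 * p + 3 - N)"]
        by (simp add: algebra_simps)
      have e5: "d powr (-4) * d powr (-2 * p) * d powr (2 * p + 3 - N) = d powr - (N + 1)"
        by (simp only: powr_add[symmetric]) (rule arg_cong2[where f = "(powr)"], simp_all)
      have "(cmod (?g' z))\<^sup>2 * ?F (?g z) = (4 * 2 powr (2 * p) * 2 powr - (2 * p + 3 - N)) *
          (Re z powr p * (d powr (-4) * d powr (-2 * p) * d powr (2 * p + 3 - N)))"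
        unfolding e1 e2 e3 by (simp only: mult_ac)
      also have "\<dots> = 2 powr (N - 1) * (Re z powr p * d powr - (N + 1))"
        unfolding e4 e5 ..
      finally have "(cmod (?g' z))\<^sup>2 * ?F (?g z) = 2 powr (N - 1) * (Re z powr p * d powr - (N + 1))" .
      then show ?thesis using True by (simp add: pos_powr_def d_def)
    qed
  qed
  also have "\<dots> = (\<integral>\<^sup>+x. \<integral>\<^sup>+y. ennreal (2 powr (N - 1) * (pos_powr x p * cmod (Complex x y + 1) powr - (N + 1))) \<partial>lborel \<partial>lborel)"
    by (subst nn_integral_complex_Re_Im) (auto simp: nn_integral_complex_Re_Im)
  also have "\<dots> = (\<integral>\<^sup>+x. ennreal (2 powr (N - 1) * A) * ennreal (pos_powr x ((p + 1) - 1) * (1 + x) powr - ((p + 1) + (N - 1 - p))) \<partial>lborel)"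
  proof (intro nn_integral_cong)
    fix x :: real
    show "(\<integral>\<^sup>+y. ennreal (2 powr (N - 1) * (pos_powr x p * cmod (Complex x y + 1) powr - (N + 1))) \<partial>lborel) =
      ennreal (2 powr (N - 1) * A) * ennreal (pos_powr x ((p + 1) - 1) * (1 + x) powr - ((p + 1) + (N - 1 - p)))"
    proof (cases "x > 0")
      case False
      then show ?thesis by (simp add: pos_powr_def)
    next
      case True
      let ?c = "2 powr (N - 1) * pos_powr x p"
      have "(\<integral>\<^sup>+y. ennreal (2 powr (N - 1) * (pos_powr x p * cmod (Complex x y + 1) powr - (N + 1))) \<partial>lborel) =
        (\<integral>\<^sup>+y. ennreal (?c * ((1 + x)\<^sup>2 + y\<^sup>2) powr - ((N + 1) / 2)) \<partial>lborel)"
      proof (intro nn_integral_cong)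
        fix y
        have h: "cmod (Complex x y + 1) = ((1 + x)\<^sup>2 + y\<^sup>2) powr (1/2)"
          by (simp add: cmod_def powr_half_sqrt add.commute)
        have "cmod (Complex x y + 1) powr - (N + 1) = ((1 + x)\<^sup>2 + y\<^sup>2) powr (1/2 * - (N + 1))"
          by (simp only: h powr_powr)
        also have "1/2 * - (N + 1) = - ((N + 1) / 2)" by linarith
        finally show "ennreal (2 powr (N - 1) * (pos_powr x p * cmod (Complex x y + 1) powr - (N + 1))) =
          ennreal (?c * ((1 + x)\<^sup>2 + y\<^sup>2) powr - ((N + 1) / 2))"
          by (simp only: mult.assoc)
      qed
      \<comment> \<open>Scaling y by 1 + x separates the variables: the integral over v is the
        Cauchy weight with m = N + 1, and the Jacobian lowers the decay in 1 + x from N + 1 to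
        N.\<close>
      also have "\<dots> = ennreal (1 + x) * (\<integral>\<^sup>+v. ennreal (?c * ((1 + x)\<^sup>2 + ((1 + x) * v)\<^sup>2) powr - ((N + 1) / 2)) \<partial>lborel)"
        using True by (subst nn_integral_real_affine[where c = "1 + x" and t = 0]) auto
      also have "\<dots> = ennreal (1 + x) * (\<integral>\<^sup>+v. ennreal (?c * (1 + x) powr - (N + 1)) * ennreal ((1 + v\<^sup>2) powr - ((N + 1) / 2)) \<partial>lborel)"
      proof (intro arg_cong2[where f = "(*)"] refl nn_integral_cong)
        fix v :: real
        have "(1 + x)\<^sup>2 + ((1 + x) * v)\<^sup>2 = (1 + x)\<^sup>2 * (1 + v\<^sup>2)" by (simp add: power2_eq_square algebra_simps)
        moreover have "((1 + x)\<^sup>2) powr - ((N + 1) / 2) = (1 + x) powr - (N + 1)"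
        proof -
          have "(1 + x)\<^sup>2 = (1 + x) powr 2" using True by simp
          then have "((1 + x)\<^sup>2) powr - ((N + 1) / 2) = (1 + x) powr (2 * - ((N + 1) / 2))"
            by (simp only: powr_powr)
          moreover have "2 * - (u / 2) = - u" for u :: real by simp
          ultimately show ?thesis by (simp only:)
        qed
        ultimately have "((1 + x)\<^sup>2 + ((1 + x) * v)\<^sup>2) powr - ((N + 1) / 2) = (1 + x) powr - (N + 1) * (1 + v\<^sup>2) powr - ((N + 1) / 2)"
          by (simp add: powr_mult)
        then show "ennreal (?c * ((1 + x)\<^sup>2 + ((1 + x) * v)\<^sup>2) powr - ((N + 1) / 2)) =
          ennreal (?c * (1 + x) powr - (N + 1)) * ennreal ((1 + v\<^sup>2) powr - ((N + 1) / 2))"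
          by (simp add: ennreal_mult[symmetric] mult.assoc)
      qed
      also have "\<dots> = ennreal (1 + x) * (ennreal (?c * (1 + x) powr - (N + 1)) * ennreal A)"
        using N nn_integral_cauchy_weight[of "N + 1"] by (subst nn_integral_cmult) (auto simp: A_def)
      also have "\<dots> = ennreal ((1 + x) * (?c * (1 + x) powr - (N + 1) * A))"
        using True A0 by (simp add: ennreal_mult)
      also have "(1 + x) * (?c * (1 + x) powr - (N + 1) * A) = 2 powr (N - 1) * A * (pos_powr x p * ((1 + x) * (1 + x) powr - (N + 1)))"
        by simp
      also have "(1 + x) * (1 + x) powr - (N + 1) = (1 + x) powr - N"
        using True powr_mult_base[of "1 + x" "- (N + 1)"] by simp
      also have "ennreal (2 powr (N - 1) * A * (pos_powr x p * (1 + x) powr - N)) =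
        ennreal (2 powr (N - 1) * A) * ennreal (pos_powr x ((p + 1) - 1) * (1 + x) powr - ((p + 1) + (N - 1 - p)))"
        using A0 by (subst ennreal_mult[symmetric]) simp_all
      finally show ?thesis .
    qed
  qed
  also have "\<dots> = ennreal (2 powr (N - 1) * A) * ennreal (Beta (p + 1) (N - 1 - p))"
    using p N by (subst nn_integral_cmult, measurable, subst nn_integral_Beta_halfline) auto
  also have "\<dots> = ennreal (2 powr (N - 1) * A * Beta (p + 1) (N - 1 - p))"
    using A0 by (intro ennreal_mult'[symmetric]) simp
  finally show ?thesis unfolding A_def .
qed

text \<open>Legendre's complex duplication formula restricted to positive reals, written with halves
  because Beta(1/2, N/2) produces Gamma at N/2 and (N + 1)/2.\<close>

lemma Gamma_real_duplication:
  assumes "0 < (x::real)"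
  shows "Gamma (x / 2) * Gamma ((x + 1) / 2) = 2 powr (1 - x) * sqrt pi * Gamma x"
proof -
  have "complex_of_real (Gamma (x / 2) * Gamma (x / 2 + 1 / 2)) =
    Gamma (complex_of_real (x / 2)) * Gamma (complex_of_real (x / 2) + 1 / 2)"
    using Gamma_complex_of_real[of "x / 2"] Gamma_complex_of_real[of "x / 2 + 1 / 2"] by simp
  also have "\<dots> = exp ((1 - 2 * complex_of_real (x / 2)) * of_real (ln 2)) * of_real (sqrt pi) * Gamma (2 * complex_of_real (x / 2))"
  proof (rule Gamma_legendre_duplication)
    have "complex_of_real t \<notin> \<int>\<^sub>\<le>\<^sub>0" if "t > 0" for t
      using that by (auto elim!: nonpos_Ints_cases' simp: complex_eq_iff)
    from this[of "x / 2"] this[of "x / 2 + 1 / 2"] assms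
    show "complex_of_real (x / 2) \<notin> \<int>\<^sub>\<le>\<^sub>0" "complex_of_real (x / 2) + 1 / 2 \<notin> \<int>\<^sub>\<le>\<^sub>0" by auto
  qed
  also have "\<dots> = complex_of_real (exp ((1 - x) * ln 2) * sqrt pi * Gamma x)"
    by (simp add: Gamma_complex_of_real exp_of_real[symmetric])
  finally have "Gamma (x / 2) * Gamma (x / 2 + 1 / 2) = exp ((1 - x) * ln 2) * sqrt pi * Gamma x"
    by (simp only: of_real_eq_iff)
  then show ?thesis by (simp add: powr_def add_divide_distrib)
qed

text \<open>The integrand does not involve y, so only the one-coordinate density with exponent N - 2
  matters. The Cayley formula with p = N - 2 has the required denominator exponent N - 1, and its
  factor Beta(N - 1, 1) cancels N - 1.\<close>

lemma boundary_int_1_0: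
  assumes N: "2 < N"
  shows "boundary_int N 1 0 = ennreal (2 powr (N - 1) * Beta (1/2) (N / 2) / pi)"
proof -
  have "boundary_int N 1 0 = (\<integral>\<^sup>+x. \<integral>\<^sup>+y. ennreal (1 / cmod (1 - x) powr (N - 1)) * ennreal (weight2 N x y) \<partial>lborel \<partial>lborel)"
    unfolding boundary_int_def int2_def
  proof (intro nn_integral_cong)
    fix x y
    have "u / u powr N = 1 / u powr (N - 1)" if "0 \<le> u" for u :: real
      using that by (cases "u = 0") (simp_all add: powr_diff)
    from this[of "cmod (1 - x)"]
    have "cmod ((1 - x) * of_real 1 + y * of_real 0) / cmod (x - 1) powr N = 1 / cmod (1 - x) powr (N - 1)"
      by (simp add: norm_minus_commute)
    then show "ennreal (cmod ((1 - x) * of_real 1 + y * of_real 0) / cmod (x - 1) powr N * weight2 N x y) =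
      ennreal (1 / cmod (1 - x) powr (N - 1)) * ennreal (weight2 N x y)"
      by (simp only: ennreal_mult[symmetric] weight2_nonneg[OF N] divide_nonneg_nonneg powr_ge_zero zero_le_one)
  qed
  also have "\<dots> = (\<integral>\<^sup>+x. ennreal (1 / cmod (1 - x) powr (N - 1)) * ennreal ((N - 1) / pi * pos_powr (1 - (cmod x)\<^sup>2) (N - 2)) \<partial>lborel)"
    unfolding nn_integral_weight2[OF N, symmetric] by (rule nn_integral_cong, rule nn_integral_cmult) measurable
  also have "\<dots> = (\<integral>\<^sup>+x. ennreal ((N - 1) / pi) * ennreal (pos_powr (1 - (cmod x)\<^sup>2) (N - 2) / cmod (1 - x) powr (2 * (N - 2) + 3 - N)) \<partial>lborel)"
    using N by (intro nn_integral_cong) (simp add: ennreal_mult[symmetric] mult_ac)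
  also have "\<dots> = ennreal ((N - 1) / pi) * ennreal (2 powr (N - 1) * Beta (1/2) (N / 2) * Beta ((N - 2) + 1) (N - 1 - (N - 2)))"
    using N by (subst nn_integral_cmult, measurable, subst nn_integral_disc_cayley) auto
  also have "\<dots> = ennreal ((N - 1) / pi * (2 powr (N - 1) * Beta (1/2) (N / 2) * Beta ((N - 2) + 1) (N - 1 - (N - 2))))"
    using N by (intro ennreal_mult'[symmetric]) simp
  also have "(N - 1) / pi * (2 powr (N - 1) * Beta (1/2) (N / 2) * Beta ((N - 2) + 1) (N - 1 - (N - 2))) =
    2 powr (N - 1) * Beta (1/2) (N / 2) / pi"
  proof -
    have "Gamma ((N - 1) + 1) = (N - 1) * Gamma (N - 1)"
      by (rule Gamma_plus1) (use N in \<open>simp add: nonpos_Ints_def\<close>)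
    moreover have "Gamma (N - 1) \<noteq> 0"
      by (rule not_sym, rule less_imp_neq, rule Gamma_real_pos) (use N in simp)
    ultimately have "(N - 1) * Beta ((N - 2) + 1) (N - 1 - (N - 2)) = 1"
      using N by (simp add: Beta_def)
    moreover have "(N - 1) / pi * (c * B) = c / pi * ((N - 1) * B)" for c B by simp
    ultimately show ?thesis by (simp only: mult_1_right)
  qed
  finally show ?thesis .
qed

text \<open>The factor |y| is integrated out radially and leaves the exponent N - 3/2, for which the
  Cayley formula has denominator exponent exactly N. Compared with the other end point, the
  remaining Beta factors give 1/2 in place of 1/pi.\<close>

lemma boundary_int_0_1:
  assumes N: "2 < N"
  shows "boundary_int N 0 1 = ennreal (2 powr (N - 1) * Beta (1/2) (N / 2) / 2)"
proof -
  let ?k = "(N - 1) * (N - 2) / pi\<^sup>2"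
  have k: "0 \<le> ?k" using N by simp
  have B0: "0 \<le> Beta (3/2) (N - 2)"
    using N by (auto simp: Beta_def intro!: divide_nonneg_nonneg mult_nonneg_nonneg Gamma_real_nonneg)
  have *: "(\<integral>\<^sup>+y. ennreal (cmod y * weight2 N x y) \<partial>lborel) =
    ennreal (?k * pi * Beta (3/2) (N - 2) * pos_powr (1 - (cmod x)\<^sup>2) (N - 3/2))" for x
  proof -
    let ?R = "1 - (cmod x)\<^sup>2"
    have "(\<integral>\<^sup>+y. ennreal (cmod y * weight2 N x y) \<partial>lborel) =
      (\<integral>\<^sup>+y. ennreal ?k * ennreal (sqrt ((cmod y)\<^sup>2) * pos_powr (?R - (cmod y)\<^sup>2) (N - 3)) \<partial>lborel)"
    proof (intro nn_integral_cong)
      fix y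
      have "cmod y * weight2 N x y = ?k * (sqrt ((cmod y)\<^sup>2) * pos_powr (?R - (cmod y)\<^sup>2) (N - 3))"
        by (simp add: weight2_def)
      then show "ennreal (cmod y * weight2 N x y) = ennreal ?k * ennreal (sqrt ((cmod y)\<^sup>2) * pos_powr (?R - (cmod y)\<^sup>2) (N - 3))"
        by (simp only: ennreal_mult'[OF k])
    qed
    also have "\<dots> = ennreal ?k * (\<integral>\<^sup>+y. ennreal (sqrt ((cmod y)\<^sup>2) * pos_powr (?R - (cmod y)\<^sup>2) (N - 3)) \<partial>lborel)"
      by (rule nn_integral_cmult) measurable
    also have "(\<integral>\<^sup>+y. ennreal (sqrt ((cmod y)\<^sup>2) * pos_powr (?R - (cmod y)\<^sup>2) (N - 3)) \<partial>lborel) =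
      ennreal pi * (\<integral>\<^sup>+t. ennreal (sqrt t * pos_powr (?R - t) (N - 3)) * indicator {0<..} t \<partial>lborel)"
      by (rule nn_integral_complex_radial[of "\<lambda>t. ennreal (sqrt t * pos_powr (?R - t) (N - 3))"]) measurable
    also have "(\<integral>\<^sup>+t. ennreal (sqrt t * pos_powr (?R - t) (N - 3)) * indicator {0<..} t \<partial>lborel) =
      (\<integral>\<^sup>+t. ennreal (pos_powr t (3/2 - 1) * pos_powr (?R - t) ((N - 2) - 1)) \<partial>lborel)"
      by (intro nn_integral_cong) (auto simp: pos_powr_def indicator_def powr_half_sqrt)
    also have "\<dots> = ennreal (Beta (3/2) (N - 2) * pos_powr ?R (3/2 + (N - 2) - 1))"
      using N by (intro nn_integral_Beta) auto
    also have "ennreal ?k * (ennreal pi * \<dots>) = ennreal (?k * pi * Beta (3/2) (N - 2) * pos_powr ?R (3/2 + (N - 2) - 1))"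
      using k B0 by (simp only: ennreal_mult'[symmetric] pi_ge_zero mult.assoc)
    also have "3/2 + (N - 2) - 1 = N - 3/2" by simp
    finally show ?thesis .
  qed
  have "boundary_int N 0 1 = (\<integral>\<^sup>+x. \<integral>\<^sup>+y. ennreal (1 / cmod (1 - x) powr N) * ennreal (cmod y * weight2 N x y) \<partial>lborel \<partial>lborel)"
    unfolding boundary_int_def int2_def
  proof (intro nn_integral_cong)
    fix x y
    have "cmod ((1 - x) * of_real 0 + y * of_real 1) / cmod (x - 1) powr N * weight2 N x y =
      1 / cmod (1 - x) powr N * (cmod y * weight2 N x y)"
      by (simp add: norm_minus_commute)
    then show "ennreal (cmod ((1 - x) * of_real 0 + y * of_real 1) / cmod (x - 1) powr N * weight2 N x y) =
      ennreal (1 / cmod (1 - x) powr N) * ennreal (cmod y * weight2 N x y)"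
      by (simp only: ennreal_mult' divide_nonneg_nonneg powr_ge_zero zero_le_one)
  qed
  also have "\<dots> = (\<integral>\<^sup>+x. ennreal (1 / cmod (1 - x) powr N) * ennreal (?k * pi * Beta (3/2) (N - 2) * pos_powr (1 - (cmod x)\<^sup>2) (N - 3/2)) \<partial>lborel)"
  proof (rule nn_integral_cong)
    fix x
    show "(\<integral>\<^sup>+y. ennreal (1 / cmod (1 - x) powr N) * ennreal (cmod y * weight2 N x y) \<partial>lborel) =
      ennreal (1 / cmod (1 - x) powr N) * ennreal (?k * pi * Beta (3/2) (N - 2) * pos_powr (1 - (cmod x)\<^sup>2) (N - 3/2))"
      unfolding *[symmetric] by (rule nn_integral_cmult) measurable
  qed
  also have "\<dots> = (\<integral>\<^sup>+x. ennreal (?k * pi * Beta (3/2) (N - 2)) *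
      ennreal (pos_powr (1 - (cmod x)\<^sup>2) (N - 3/2) / cmod (1 - x) powr (2 * (N - 3/2) + 3 - N)) \<partial>lborel)"
  proof (intro nn_integral_cong)
    fix x
    have e: "2 * (N - 3/2) + 3 - N = N" by simp
    have "1 / cmod (1 - x) powr N * (?k * pi * Beta (3/2) (N - 2) * pos_powr (1 - (cmod x)\<^sup>2) (N - 3/2)) =
      (?k * pi * Beta (3/2) (N - 2)) * (pos_powr (1 - (cmod x)\<^sup>2) (N - 3/2) / cmod (1 - x) powr N)" by simp
    moreover have "0 \<le> ?k * pi * Beta (3/2) (N - 2)" using k B0 by (intro mult_nonneg_nonneg) simp_all
    ultimately show "ennreal (1 / cmod (1 - x) powr N) * ennreal (?k * pi * Beta (3/2) (N - 2) * pos_powr (1 - (cmod x)\<^sup>2) (N - 3/2)) =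
      ennreal (?k * pi * Beta (3/2) (N - 2)) * ennreal (pos_powr (1 - (cmod x)\<^sup>2) (N - 3/2) / cmod (1 - x) powr (2 * (N - 3/2) + 3 - N))"
      unfolding e by (simp only: ennreal_mult'[symmetric] divide_nonneg_nonneg powr_ge_zero zero_le_one)
  qed
  also have "\<dots> = ennreal (?k * pi * Beta (3/2) (N - 2)) *
      ennreal (2 powr (N - 1) * Beta (1/2) (N / 2) * Beta ((N - 3/2) + 1) (N - 1 - (N - 3/2)))"
    using N by (subst nn_integral_cmult, measurable, subst nn_integral_disc_cayley) auto
  also have "\<dots> = ennreal (?k * pi * Beta (3/2) (N - 2) *
      (2 powr (N - 1) * Beta (1/2) (N / 2) * Beta ((N - 3/2) + 1) (N - 1 - (N - 3/2))))"
    using k B0 by (intro ennreal_mult'[symmetric] mult_nonneg_nonneg) simp_all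
  also have "?k * pi * Beta (3/2) (N - 2) * (2 powr (N - 1) * Beta (1/2) (N / 2) * Beta ((N - 3/2) + 1) (N - 1 - (N - 3/2))) =
    2 powr (N - 1) * Beta (1/2) (N / 2) * (?k * pi * (Beta (3/2) (N - 2) * Beta (N - 1/2) (1/2)))"
    by simp
  also have "?k * pi * (Beta (3/2) (N - 2) * Beta (N - 1/2) (1/2)) = 1 / 2"
  proof -
    have 1: "Gamma N = (N - 1) * (N - 2) * Gamma (N - 2)"
    proof -
      have "Gamma ((N - 1) + 1) = (N - 1) * Gamma (N - 1)" "Gamma ((N - 2) + 1) = (N - 2) * Gamma (N - 2)"
        by (rule Gamma_plus1, use N in \<open>simp add: nonpos_Ints_def\<close>)+
      then show ?thesis by simp
    qed
    have 2: "Gamma (N - 2) \<noteq> 0" "Gamma (N - 1/2) \<noteq> 0"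
      by (rule not_sym, rule less_imp_neq, rule Gamma_real_pos, use N in simp)+
    have 3: "Gamma (3/2 :: real) = sqrt pi / 2"
    proof -
      have "(1/2::real) \<notin> \<int>\<^sub>\<le>\<^sub>0" using nonpos_Ints_nonpos[of "1/2::real"] by auto
      then show ?thesis using Gamma_plus1[of "1/2 :: real"] by (simp add: Gamma_one_half_real)
    qed
    \<comment> \<open>Gamma(N - 1/2) cancels between the two Beta values, and each of Gamma(3/2) and
      Gamma(1/2) contributes a \<open>sqrt pi\<close>.\<close>
    have "Beta (3/2) (N - 2) * Beta (N - 1/2) (1/2) = (sqrt pi / 2) * Gamma (N - 2) * sqrt pi / Gamma N"
      using 2 by (simp add: Beta_def 3 Gamma_one_half_real)
    also have "\<dots> = pi / 2 / ((N - 1) * (N - 2))"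
    proof -
      have "sqrt pi / 2 * g * sqrt pi = pi / 2 * g" for g
        using real_sqrt_mult_self[of pi] by (simp add: mult.commute mult.left_commute)
      then show ?thesis unfolding 1 using 2 by simp
    qed
    finally show ?thesis using N by (simp add: power2_eq_square)
  qed
  finally show ?thesis by simp
qed

text \<open>The duplication formula trades Gamma(N/2) for Gamma(N) and cancels the power of 2. As N
  + 1 = 2 + n + \<alpha>, the right side is \<open>C_const\<close>.\<close>

lemma N_times_boundary_value:
  assumes N: "2 < N"
  shows "N * (2 powr (N - 1) * Beta (1/2) (N / 2) / pi) = Gamma (N + 1) / (Gamma ((N + 1) / 2))\<^sup>2"
proof -
  have 1: "Gamma (N + 1) = N * Gamma N"
    by (rule Gamma_plus1) (use N in \<open>simp add: nonpos_Ints_def\<close>)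
  have G: "Gamma ((N + 1) / 2) \<noteq> 0"
    by (rule not_sym, rule less_imp_neq, rule Gamma_real_pos) (use N in simp)
  have "1/2 + N/2 = (N + 1) / 2" by (simp add: field_simps)
  then have "Beta (1/2) (N / 2) = sqrt pi * Gamma (N / 2) / Gamma ((N + 1) / 2)"
    by (simp only: Beta_def Gamma_one_half_real)
  also have "Gamma (N / 2) = 2 powr (1 - N) * sqrt pi * Gamma N / Gamma ((N + 1) / 2)"
    using Gamma_real_duplication[of N] N G by (subst nonzero_eq_divide_eq) auto
  finally have B: "Beta (1/2) (N / 2) = pi * 2 powr (1 - N) * Gamma N / (Gamma ((N + 1) / 2))\<^sup>2"
    by (simp add: power2_eq_square)
  have "2 powr (N - 1) * 2 powr (1 - N) = (1::real)" by (simp flip: powr_add)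
  then have "N * (2 powr (N - 1) * (pi * 2 powr (1 - N) * Gamma N / (Gamma ((N + 1) / 2))\<^sup>2) / pi) = N * Gamma N / (Gamma ((N + 1) / 2))\<^sup>2"
    by (simp add: mult.assoc[symmetric])
  then show ?thesis unfolding B 1 .
qed

section \<open>The invariant gradient of the Bergman projection\<close>

text \<open>Dominated convergence for the difference quotients along an arbitrary sequence: on the
  convex ball they are bounded by B through the mean value inequality, so B |g| is a
  majorant.\<close>

lemma has_field_derivative_integral_dominated:
  fixes K :: "complex \<Rightarrow> 'a \<Rightarrow> complex" and g :: "'a \<Rightarrow> complex"
  assumes \<delta>: "0 < \<delta>"
    and int: "\<And>x. x \<in> ball 0 \<delta> \<Longrightarrow> integrable M (\<lambda>w. g w * K x w)"
    and der: "\<And>x w. x \<in> ball 0 \<delta> \<Longrightarrow> w \<in> space M \<Longrightarrow> ((\<lambda>x. K x w) has_field_derivative K' x w) (at x)"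
    and bound: "\<And>x w. x \<in> ball 0 \<delta> \<Longrightarrow> w \<in> space M \<Longrightarrow> cmod (K' x w) \<le> B"
    and g: "integrable M g" and meas: "(\<lambda>w. g w * K' 0 w) \<in> borel_measurable M"
  shows "((\<lambda>x. LINT w|M. g w * K x w) has_field_derivative (LINT w|M. g w * K' 0 w)) (at 0)"
  unfolding has_field_derivative_iff tendsto_at_iff_sequentially
proof (intro allI impI)
  fix X :: "nat \<Rightarrow> complex"
  assume X: "\<forall>i. X i \<in> UNIV - {0}" "X \<longlonglongrightarrow> 0"
  \<comment> \<open>The sequence tends to 0 but may start outside the ball; its tail after m is used
    instead.\<close>
  obtain m where m: "\<And>n. m \<le> n \<Longrightarrow> X n \<in> ball 0 \<delta>"
    using LIMSEQ_D[OF X(2) \<delta>] by auto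
  define Y where "Y n = X (n + m)" for n
  have Y: "Y n \<in> ball 0 \<delta>" "Y n \<noteq> 0" for n
    using m[of "n + m"] X(1) by (auto simp: Y_def)
  have Y0: "Y \<longlonglongrightarrow> 0" unfolding Y_def by (rule LIMSEQ_ignore_initial_segment[OF X(2)])
  have 0: "0 \<in> ball 0 \<delta>" using \<delta> by simp
  have eq: "((LINT w|M. g w * K (Y n) w) - (LINT w|M. g w * K 0 w)) / (Y n - 0) =
      (LINT w|M. g w * ((K (Y n) w - K 0 w) / Y n))" for n
  proof -
    have "(LINT w|M. g w * K (Y n) w) - (LINT w|M. g w * K 0 w) = (LINT w|M. g w * K (Y n) w - g w * K 0 w)"
      by (rule Bochner_Integration.integral_diff[symmetric]) (intro int Y 0)+
    then show ?thesis
      by (simp add: right_diff_distrib diff_divide_distrib flip: integral_divide_zero)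
  qed
  have "(\<lambda>n. LINT w|M. g w * ((K (Y n) w - K 0 w) / Y n)) \<longlonglongrightarrow> (LINT w|M. g w * K' 0 w)"
  proof (rule integral_dominated_convergence[where w = "\<lambda>w. B * norm (g w)"])
    show "(\<lambda>w. g w * K' 0 w) \<in> borel_measurable M" by (rule meas)
    show "(\<lambda>w. g w * ((K (Y n) w - K 0 w) / Y n)) \<in> borel_measurable M" for n
    proof -
      have "integrable M (\<lambda>w. (g w * K (Y n) w - g w * K 0 w) / Y n)"
        using int[OF Y(1)] int[OF 0] by simp
      then have "(\<lambda>w. (g w * K (Y n) w - g w * K 0 w) / Y n) \<in> borel_measurable M" by auto
      then show ?thesis by (simp add: right_diff_distrib)
    qed
    show "integrable M (\<lambda>w. B * norm (g w))" using g by simp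
    show "AE w in M. (\<lambda>n. g w * ((K (Y n) w - K 0 w) / Y n)) \<longlonglongrightarrow> g w * K' 0 w"
    proof (rule AE_I2)
      fix w assume "w \<in> space M"
      then have "((\<lambda>h. (K h w - K 0 w) / (h - 0)) \<longlongrightarrow> K' 0 w) (at 0)"
        using der[OF 0] by (simp only: has_field_derivative_iff)
      then have "((\<lambda>h. (K h w - K 0 w) / (h - 0)) \<circ> Y) \<longlonglongrightarrow> K' 0 w"
        using Y Y0 by (auto simp: tendsto_at_iff_sequentially)
      then show "(\<lambda>n. g w * ((K (Y n) w - K 0 w) / Y n)) \<longlonglongrightarrow> g w * K' 0 w"
        by (intro tendsto_mult tendsto_const) (simp add: o_def)
    qed
    show "AE w in M. norm (g w * ((K (Y n) w - K 0 w) / Y n)) \<le> B * norm (g w)" for n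
    proof (rule AE_I2)
      fix w assume w: "w \<in> space M"
      have "norm (K (Y n) w - K 0 w) \<le> B * norm (Y n - 0)"
        by (rule field_differentiable_bound[of "ball 0 \<delta>" _ "\<lambda>x. K' x w"])
          (use der bound w Y 0 in \<open>auto intro: has_field_derivative_at_within\<close>)
      then have "norm ((K (Y n) w - K 0 w) / Y n) \<le> B"
        using Y(2)[of n] by (simp add: norm_divide divide_le_eq)
      then show "norm (g w * ((K (Y n) w - K 0 w) / Y n)) \<le> B * norm (g w)"
        unfolding norm_mult by (metis mult.commute mult_right_mono norm_ge_zero)
    qed
  qed
  then have "(\<lambda>n. (((\<lambda>x. ((LINT w|M. g w * K x w) - (LINT w|M. g w * K 0 w)) / (x - 0)) \<circ> X) (n + m))) \<longlonglongrightarrow> (LINT w|M. g w * K' 0 w)"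
    unfolding eq[symmetric] by (simp add: Y_def o_def)
  then show "((\<lambda>x. ((LINT w|M. g w * K x w) - (LINT w|M. g w * K 0 w)) / (x - 0)) \<circ> X) \<longlonglongrightarrow> (LINT w|M. g w * K' 0 w)"
    by (rule LIMSEQ_offset)
qed

text \<open>The derivative of \<open>\<phi>\<^sub>z\<close> at 0 in direction \<open>\<zeta>\<close>.\<close>

definition phi_deriv :: "complex^'n \<Rightarrow> complex^'n \<Rightarrow> complex^'n" where
  "phi_deriv z \<zeta> =
     (let p = (hinner \<zeta> z / of_real ((norm z)\<^sup>2)) *s z
      in hinner \<zeta> z *s z - p - of_real (sqrt (1 - (norm z)\<^sup>2)) *s (\<zeta> - p))"

text \<open>The derivative at 0 in direction \<zeta> of the Bergman kernel composed with
  \<open>phi z\<close>, that is of \<open>1 - hinner (phi z x) w\<close> raised to the power -N with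
  N = n + 1 + \<alpha>.\<close>

definition bloch_kernel :: "real \<Rightarrow> complex^'n \<Rightarrow> complex^'n \<Rightarrow> complex^'n \<Rightarrow> complex" where
  "bloch_kernel \<alpha> z \<zeta> w = of_real (real CARD('n) + 1 + \<alpha>) * hinner (phi_deriv z \<zeta>) w *
     (1 - hinner z w) powr of_real (- (real CARD('n) + 1 + \<alpha>) - 1)"

lemma borel_measurable_hinner[measurable]: "(\<lambda>w. hinner z w) \<in> borel_measurable borel"
  unfolding hinner_def by measurable

lemma borel_measurable_bloch_kernel[measurable]: "bloch_kernel \<alpha> z \<zeta> \<in> borel_measurable borel"
  unfolding bloch_kernel_def by measurable

text \<open>Along a coordinate axis the automorphism is a quotient of affine functions of x. Hiding
  the projections in one vector v makes its derivative at 0 immediate and also covers z = 0, where v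
  is minus the axis vector.\<close>

lemma phi_axis:
  fixes z :: "complex^'n"
  shows "\<exists>v. (\<forall>x. phi z (axis k x) = (1 / (1 - x * cnj (z $ k))) *s (z + x *s v)) \<and>
    phi_deriv z (axis k 1) = v + cnj (z $ k) *s z"
proof -
  let ?c = "cnj (z $ k)"
  let ?p = "(?c / of_real ((norm z)\<^sup>2)) *s z" and ?s = "of_real (sqrt (1 - (norm z)\<^sup>2)) :: complex"
  define v where "v = - ?p - ?s *s (axis k 1 - ?p)"
  have ax: "axis k x = x *s (axis k 1 :: complex^'n)" for x
    by (simp add: vec_eq_iff axis_def)
  have "phi z (axis k x) = (1 / (1 - x * ?c)) *s (z + x *s v)" for x
  proof (cases "z = 0")
    case True
    then show ?thesis by (simp add: phi_def v_def vec_eq_iff axis_def)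
  next
    case False
    have "(x * ?c / of_real ((norm z)\<^sup>2)) *s z = x *s ?p"
      by (simp add: vector_smult_assoc)
    then have "phi z (axis k x) = (1 / (1 - x * ?c)) *s (z - x *s ?p - ?s *s (x *s axis k 1 - x *s ?p))"
      using False by (simp add: phi_def Let_def hinner_axis_left flip: ax)
    also have "z - x *s ?p - ?s *s (x *s axis k 1 - x *s ?p) = z + x *s v"
      by (simp add: v_def vec_eq_iff algebra_simps)
    finally show ?thesis .
  qed
  moreover have "phi_deriv z (axis k 1) = v + ?c *s z"
    by (simp add: phi_deriv_def Let_def hinner_axis_left v_def algebra_simps)
  ultimately show ?thesis by blast
qed

lemma invariant_gradient_bergman_projection:
  fixes g :: "complex^'n \<Rightarrow> complex" and z :: "complex^'n"
  assumes n: "CARD('n) > 1" and \<alpha>: "\<alpha> > -1" and z: "norm z < 1"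
    and gm: "g \<in> borel_measurable (v_alpha \<alpha>)" and g1: "AE w in v_alpha \<alpha>. cmod (g w) \<le> 1"
  shows "invariant_gradient (bergman_projection \<alpha> g) z $ k = (LINT w|v_alpha \<alpha>. g w * bloch_kernel \<alpha> z (axis k 1) w)"
proof -
  let ?V = "v_alpha \<alpha> :: (complex^'n) measure"
  interpret prob_space ?V using n \<alpha> by (rule prob_space_v_alpha)
  define N where "N = real CARD('n) + 1 + \<alpha>"
  have N: "N > 2" using n \<alpha> by (simp add: N_def)
  define c where "c = cnj (z $ k)"
  obtain v where v: "\<And>x. phi z (axis k x) = (1 / (1 - x * c)) *s (z + x *s v)"
    "phi_deriv z (axis k 1) = v + c *s z"
    using phi_axis[of z k] unfolding c_def by metis
  have c1: "cmod c \<le> 1"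
    using norm_hinner_le[of z "axis k 1"] z by (simp add: hinner_axis_right norm_axis_complex c_def)
  define \<beta> where "\<beta> = norm v"
  have \<beta>: "0 \<le> \<beta>" by (simp add: \<beta>_def)
  define R where "R = (1 + norm z) / 2"
  have R: "norm z < R" "R < 1" "0 \<le> R" using z by (auto simp: R_def)
  \<comment> \<open>R lies halfway between |z| and 1, and \<delta> keeps
    \<open>phi z (axis k x)\<close> within radius R for |x| < \<delta>; \<delta> < 1/2 keeps |1 - x
    c| above 1/2.\<close>
  obtain \<delta> where \<delta>: "0 < \<delta>" "\<delta> < 1/2" "(norm z + \<delta> * \<beta>) / (1 - \<delta>) \<le> R"
  proof -
    have "((\<lambda>\<delta>. (norm z + \<delta> * \<beta>) / (1 - \<delta>)) \<longlongrightarrow> (norm z + 0 * \<beta>) / (1 - 0)) (at_right 0)"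
      by (intro tendsto_intros) auto
    then have "eventually (\<lambda>\<delta>. (norm z + \<delta> * \<beta>) / (1 - \<delta>) < R) (at_right 0)"
      using R by (intro order_tendstoD) auto
    moreover have "eventually (\<lambda>\<delta>::real. 0 < \<delta> \<and> \<delta> < 1/2) (at_right 0)"
      by (auto simp: eventually_at_right_field intro!: exI[of _ "1/2"])
    ultimately have "eventually (\<lambda>\<delta>. 0 < \<delta> \<and> \<delta> < 1/2 \<and> (norm z + \<delta> * \<beta>) / (1 - \<delta>) \<le> R) (at_right 0)"
      by eventually_elim auto
    then show ?thesis using that by (auto dest: eventually_happens)
  qed
  \<comment> \<open>q is \<open>1 - hinner (phi z (axis k x)) w\<close>; its real part is at least 1
    - R, which keeps it off the branch cut.\<close>
  define q where "q x w = 1 - (hinner z w + x * hinner v w) / (1 - x * c)" for x w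
  define q' where "q' x w = - (hinner v w + c * hinner z w) / (1 - x * c)\<^sup>2" for x w
  define K where "K x w = q x w powr of_real (- N)" for x w
  define K' where "K' x w = of_real (- N) * q x w powr of_real (- N - 1) * q' x w" for x w
  have xc: "1 - \<delta> \<le> cmod (1 - x * c)" if "x \<in> ball 0 \<delta>" for x
  proof -
    have "cmod (x * c) \<le> \<delta>" using that c1 \<delta>(1) mult_mono[of "cmod x" \<delta> "cmod c" 1] by (simp add: norm_mult)
    then show ?thesis using norm_triangle_ineq2[of 1 "x * c"] by simp
  qed
  have xc0: "1 - x * c \<noteq> 0" if "x \<in> ball 0 \<delta>" for x
    using xc[OF that] \<delta> by auto
  have hw: "cmod (hinner u w) \<le> norm u" if "w \<in> space ?V" for u w
    using norm_hinner_le[of u w] mult_left_le[of "norm w" "norm u"] that by (simp add: space_v_alpha)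
  have q1: "cmod (1 - q x w) \<le> R" if "x \<in> ball 0 \<delta>" "w \<in> space ?V" for x w
  proof -
    have "cmod (1 - q x w) = cmod (hinner z w + x * hinner v w) / cmod (1 - x * c)"
      by (simp add: q_def norm_divide)
    also have "\<dots> \<le> (norm z + \<delta> * \<beta>) / (1 - \<delta>)"
    proof (rule frac_le)
      have "cmod (x * hinner v w) \<le> \<delta> * \<beta>"
        using that hw[OF that(2), of v] \<delta>(1) unfolding norm_mult \<beta>_def by (intro mult_mono) auto
      then show "cmod (hinner z w + x * hinner v w) \<le> norm z + \<delta> * \<beta>"
        using hw[OF that(2), of z] by (intro norm_triangle_le add_mono)
      show "0 \<le> norm z + \<delta> * \<beta>" using \<delta> \<beta> by simp
    qed (use xc[OF that(1)] \<delta> in auto)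
    also have "\<dots> \<le> R" by (rule \<delta>(3))
    finally show ?thesis .
  qed
  have qRe: "1 - R \<le> Re (q x w)" if "x \<in> ball 0 \<delta>" "w \<in> space ?V" for x w
    using q1[OF that] complex_Re_le_cmod[of "1 - q x w"] by simp
  have qnp: "q x w \<notin> \<real>\<^sub>\<le>\<^sub>0" if "x \<in> ball 0 \<delta>" "w \<in> space ?V" for x w
    using qRe[OF that] R by (auto simp: complex_nonpos_Reals_iff)
  have qlow: "1 - R \<le> cmod (q x w)" if "x \<in> ball 0 \<delta>" "w \<in> space ?V" for x w
    using qRe[OF that] complex_Re_le_cmod[of "q x w"] by simp
  have qpow: "cmod (q x w powr of_real (- a)) \<le> (1 - R) powr (- a)" if "0 \<le> a" "x \<in> ball 0 \<delta>" "w \<in> space ?V" for a x w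
    using qlow[OF that(2,3)] R that(1) by (simp add: norm_powr_real_powr' powr_mono2')
  have derK: "((\<lambda>x. K x w) has_field_derivative K' x w) (at x)" if "x \<in> ball 0 \<delta>" "w \<in> space ?V" for x w
  proof -
    have "((\<lambda>x. q x w) has_field_derivative q' x w) (at x)"
    proof -
      have 1: "((\<lambda>x. hinner z w + x * hinner v w) has_field_derivative hinner v w) (at x)"
        by (auto intro!: derivative_eq_intros)
      have 2: "((\<lambda>x. 1 - x * c) has_field_derivative - c) (at x)"
        by (auto intro!: derivative_eq_intros)
      have "0 - (hinner v w * (1 - x * c) - (hinner z w + x * hinner v w) * - c) / ((1 - x * c) * (1 - x * c)) = q' x w"
        unfolding q'_def power2_eq_square minus_divide_left[symmetric] by (simp add: algebra_simps)
      with DERIV_diff[OF DERIV_const[of 1] DERIV_divide[OF 1 2 xc0[OF that(1)]]]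
      show ?thesis unfolding q_def by (simp only:)
    qed
    from DERIV_chain2[OF has_field_derivative_powr[OF qnp[OF that], of "of_real (- N)"] this]
    show ?thesis by (simp add: K_def K'_def)
  qed
  \<comment> \<open>The bounds of the three factors of \<open>K'\<close>: the exponent, the power of
    q with |q| at least 1 - R, and \<open>q'\<close> with numerator at most \<beta> + 1 and |1 - x
    c| at least 1/2.\<close>
  define B where "B = N * (1 - R) powr (- (N + 1)) * ((\<beta> + 1) / (1/2)\<^sup>2)"
  have bK': "cmod (K' x w) \<le> B" if "x \<in> ball 0 \<delta>" "w \<in> space ?V" for x w
  proof -
    have "cmod (q' x w) = cmod (hinner v w + c * hinner z w) / (cmod (1 - x * c))\<^sup>2"
      by (simp only: q'_def norm_divide norm_minus_cancel norm_power)
    also have "\<dots> \<le> (\<beta> + 1) / (1/2)\<^sup>2"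
    proof (rule frac_le)
      have "cmod (c * hinner z w) \<le> 1 * 1"
        using c1 hw[OF that(2), of z] z unfolding norm_mult by (intro mult_mono) auto
      then show "cmod (hinner v w + c * hinner z w) \<le> \<beta> + 1"
        using hw[OF that(2), of v] unfolding \<beta>_def by (intro norm_triangle_le add_mono) auto
      show "(1/2)\<^sup>2 \<le> (cmod (1 - x * c))\<^sup>2"
        using xc[OF that(1)] \<delta> by (intro power_mono) auto
    qed (use \<beta> in auto)
    finally have q'b: "cmod (q' x w) \<le> (\<beta> + 1) / (1/2)\<^sup>2" .
    have "cmod (K' x w) = N * cmod (q x w powr of_real (- (N + 1))) * cmod (q' x w)"
    proof -
      have "- N - 1 = - (N + 1)" "\<bar>- N\<bar> = N" using N by auto
      then show ?thesis by (simp only: K'_def norm_mult norm_of_real)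
    qed
    also have "\<dots> \<le> B"
      unfolding B_def using N qpow[OF _ that, of "N + 1"] q'b by (intro mult_mono) auto
    finally show ?thesis .
  qed
  have Km: "K x \<in> borel_measurable ?V" "K' x \<in> borel_measurable ?V" for x
    unfolding K_def K'_def q_def q'_def by (intro measurable_v_alpha_borel; measurable)+
  have gi: "integrable ?V g"
    by (rule integrable_const_bound[OF g1 gm])
  have "integrable ?V (\<lambda>w. g w * K x w)" if "x \<in> ball 0 \<delta>" for x
  proof (rule integrable_const_bound)
    show "AE w in ?V. norm (g w * K x w) \<le> (1 - R) powr (- N)"
      using g1
    proof (rule AE_mp, intro AE_I2 impI)
      fix w assume "w \<in> space ?V" "cmod (g w) \<le> 1"
      then show "norm (g w * K x w) \<le> (1 - R) powr (- N)"
        using qpow[of N x w] that N mult_mono[of "cmod (g w)" 1 "cmod (K x w)" "(1 - R) powr (- N)"]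
        by (simp add: norm_mult K_def)
    qed
    show "(\<lambda>w. g w * K x w) \<in> borel_measurable ?V" using gm Km by measurable
  qed
  then have D: "((\<lambda>x. LINT w|?V. g w * K x w) has_field_derivative (LINT w|?V. g w * K' 0 w)) (at 0)"
    using gm Km by (intro has_field_derivative_integral_dominated[OF \<delta>(1) _ derK bK' gi]) auto
  have proj: "bergman_projection \<alpha> g (phi z (axis k x)) = (LINT w|?V. g w * K x w)" for x
  proof -
    have "1 - hinner (phi z (axis k x)) w = q x w" for w
      by (simp add: v(1) hinner_scale_left hinner_add_left q_def add_divide_distrib)
    moreover have "a / u powr of_real N = a * u powr of_real (- N)" for a u :: complex
      by (simp add: powr_minus divide_inverse)
    ultimately show ?thesis
      unfolding bergman_projection_def K_def N_def by simp
  qed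
  have "invariant_gradient (bergman_projection \<alpha> g) z $ k = deriv (\<lambda>x. LINT w|?V. g w * K x w) 0"
    by (simp add: invariant_gradient_def complex_gradient_def proj)
  also have "\<dots> = (LINT w|?V. g w * K' 0 w)" by (rule DERIV_imp_deriv[OF D])
  also have "\<dots> = (LINT w|?V. g w * bloch_kernel \<alpha> z (axis k 1) w)"
  proof -
    have "K' 0 w = bloch_kernel \<alpha> z (axis k 1) w" for w
      unfolding bloch_kernel_def N_def[symmetric] v(2) K'_def q_def q'_def hinner_add_left hinner_scale_left
      by (simp add: algebra_simps)
    then show ?thesis by simp
  qed
  finally show ?thesis .
qed

section \<open>Duality and the theorem\<close>

lemma sum_bloch_kernel:
  "(\<Sum>k\<in>UNIV. \<zeta> $ k * bloch_kernel \<alpha> z (axis k 1) w) = bloch_kernel \<alpha> z \<zeta> w"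
proof -
  define s where "s = (of_real (sqrt (1 - (norm z)\<^sup>2)) :: complex)"
  \<comment> \<open>A collects everything parallel to z and does not depend on the direction, so
    linearity in the direction becomes visible.\<close>
  define A where "A = hinner z w - hinner z w / of_real ((norm z)\<^sup>2) + s * (hinner z w / of_real ((norm z)\<^sup>2))"
  have 1: "hinner (phi_deriv z x) w = hinner x z * A - s * hinner x w" for x
    unfolding phi_deriv_def Let_def hinner_diff_left hinner_scale_left s_def[symmetric] A_def
    by (simp add: algebra_simps)
  have "hinner (phi_deriv z \<zeta>) w = (\<Sum>k\<in>UNIV. \<zeta> $ k * hinner (phi_deriv z (axis k 1)) w)"
    unfolding 1 hinner_axis_left
    by (simp add: hinner_def sum_distrib_right sum_distrib_left sum_subtractf algebra_simps)
  then show ?thesis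
    by (simp add: bloch_kernel_def sum_distrib_left sum_distrib_right mult_ac)
qed

lemma cmod_bloch_kernel:
  fixes z :: "complex^'n"
  assumes "\<alpha> > -1"
  shows "cmod (bloch_kernel \<alpha> z \<zeta> w) = (real CARD('n) + 1 + \<alpha>) *
    (cmod (hinner (phi_deriv z \<zeta>) w) / cmod (1 - hinner z w) powr (real CARD('n) + 1 + \<alpha> + 1))"
proof -
  have *: "cmod (u powr of_real (- N - 1)) = 1 / cmod u powr (N + 1)" for u :: complex and N
    using powr_minus_divide[of "cmod u" "N + 1"]
    by (simp only: norm_powr_real_powr'[OF Reals_of_real] Re_complex_of_real) simp
  show ?thesis
    unfolding bloch_kernel_def norm_mult norm_of_real * using assms by simp
qed

text \<open>For fixed z the kernel is bounded on the ball, since |1 - <z,w>| is at least 1 - |z|,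
  and the measure has total mass 1.\<close>

lemma integrable_bloch_kernel:
  fixes g :: "complex^'n \<Rightarrow> complex"
  assumes n: "CARD('n) > 1" and \<alpha>: "\<alpha> > -1" and z: "norm z < 1"
    and gm: "g \<in> borel_measurable (v_alpha \<alpha>)" and g1: "AE w in v_alpha \<alpha>. cmod (g w) \<le> 1"
  shows "integrable (v_alpha \<alpha>) (\<lambda>w. g w * bloch_kernel \<alpha> z \<zeta> w)"
proof -
  interpret prob_space "v_alpha \<alpha> :: (complex^'n) measure" using n \<alpha> by (rule prob_space_v_alpha)
  let ?N = "real CARD('n) + 1 + \<alpha>"
  define B where "B = ?N * (norm (phi_deriv z \<zeta>) / (1 - norm z) powr (?N + 1))"
  have b: "cmod (bloch_kernel \<alpha> z \<zeta> w) \<le> B" if "norm w < 1" for w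
  proof -
    have h: "cmod (hinner u w) \<le> norm u" for u
      using norm_hinner_le[of u w] that mult_left_le[of "norm w" "norm u"] by simp
    have "1 - norm z \<le> cmod (1 - hinner z w)"
      using norm_triangle_ineq2[of 1 "hinner z w"] h[of z] by simp
    then have "(1 - norm z) powr (?N + 1) \<le> cmod (1 - hinner z w) powr (?N + 1)"
      using z \<alpha> by (intro powr_mono2) auto
    then show ?thesis
      unfolding cmod_bloch_kernel[OF \<alpha>] B_def using z \<alpha> h
      by (intro mult_left_mono frac_le) auto
  qed
  show ?thesis
  proof (rule integrable_const_bound)
    show "AE w in v_alpha \<alpha>. norm (g w * bloch_kernel \<alpha> z \<zeta> w) \<le> B"
      using g1
    proof (rule AE_mp, intro AE_I2 impI)
      fix w :: "complex^'n" assume "w \<in> space (v_alpha \<alpha>)" "cmod (g w) \<le> 1"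
      then show "norm (g w * bloch_kernel \<alpha> z \<zeta> w) \<le> B"
        using b[of w] mult_mono[of "cmod (g w)" 1 "cmod (bloch_kernel \<alpha> z \<zeta> w)" B]
        by (simp add: norm_mult space_v_alpha)
    qed
    show "(\<lambda>w. g w * bloch_kernel \<alpha> z \<zeta> w) \<in> borel_measurable (v_alpha \<alpha>)"
    proof (rule borel_measurable_times[OF gm])
      show "bloch_kernel \<alpha> z \<zeta> \<in> borel_measurable (v_alpha \<alpha>)"
        by (rule measurable_v_alpha_borel) measurable
    qed
  qed
qed

lemma sum_invariant_gradient:
  fixes g :: "complex^'n \<Rightarrow> complex"
  assumes "CARD('n) > 1" "\<alpha> > -1" "norm z < 1"
    "g \<in> borel_measurable (v_alpha \<alpha>)" "AE w in v_alpha \<alpha>. cmod (g w) \<le> 1"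
  shows "(\<Sum>k\<in>UNIV. \<zeta> $ k * invariant_gradient (bergman_projection \<alpha> g) z $ k) =
    (LINT w|v_alpha \<alpha>. g w * bloch_kernel \<alpha> z \<zeta> w)"
proof -
  have "(\<Sum>k\<in>UNIV. \<zeta> $ k * invariant_gradient (bergman_projection \<alpha> g) z $ k) =
    (\<Sum>k\<in>UNIV. (LINT w|v_alpha \<alpha>. \<zeta> $ k * (g w * bloch_kernel \<alpha> z (axis k 1) w)))"
    using invariant_gradient_bergman_projection[OF assms] by simp
  also have "\<dots> = (LINT w|v_alpha \<alpha>. (\<Sum>k\<in>UNIV. \<zeta> $ k * (g w * bloch_kernel \<alpha> z (axis k 1) w)))"
    by (intro Bochner_Integration.integral_sum[symmetric] integrable_mult_right integrable_bloch_kernel assms)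
  also have "\<dots> = (LINT w|v_alpha \<alpha>. g w * bloch_kernel \<alpha> z \<zeta> w)"
    unfolding sum_bloch_kernel[symmetric, where \<zeta> = \<zeta>] by (simp add: sum_distrib_left mult_ac)
  finally show ?thesis .
qed

lemma norm_vec_cnj: "norm (\<chi> k. cnj (G $ k)) = norm (G :: complex^'n)"
  by (simp add: norm_vec_def)

lemma norm_sum_mult_le: "cmod (\<Sum>k\<in>UNIV. \<zeta> $ k * G $ k) \<le> norm \<zeta> * norm (G :: complex^'n)"
  using norm_hinner_le[of \<zeta> "\<chi> k. cnj (G $ k)"] by (simp add: hinner_def norm_vec_cnj)

text \<open>The normalised conjugate of G, because the pairing with the gradient is bilinear; any
  unit vector when G = 0.\<close>

lemma ex_norming_vector:
  fixes G :: "complex^'n"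
  obtains \<zeta> where "norm \<zeta> = 1" "(\<Sum>k\<in>UNIV. \<zeta> $ k * G $ k) = of_real (norm G)"
proof (cases "G = 0")
  case True
  then show ?thesis using that[of "axis undefined 1"] by (simp add: norm_axis_complex)
next
  case False
  define \<zeta> where "\<zeta> = (1 / of_real (norm G)) *s (\<chi> k. cnj (G $ k))"
  have "norm \<zeta> = 1" using False by (simp add: \<zeta>_def norm_vec_scale norm_vec_cnj norm_divide)
  moreover have "(\<Sum>k\<in>UNIV. \<zeta> $ k * G $ k) = (1 / of_real (norm G)) * hinner G G"
    by (simp add: \<zeta>_def hinner_def sum_distrib_left mult_ac sum_divide_distrib)
  then have "(\<Sum>k\<in>UNIV. \<zeta> $ k * G $ k) = of_real (norm G)"
    using False by (simp add: hinner_self power2_eq_square)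
  ultimately show ?thesis by (rule that)
qed

text \<open>\<open>Linf\<close> refers to \<open>v_measure\<close>; a density has the same
  measurable sets and keeps null sets null, so both properties pass to
  \<open>v_alpha\<close>.\<close>

lemma Linf_unit_ball_AE:
  assumes "g \<in> Linf" "Linf_norm g \<le> 1"
  shows "g \<in> borel_measurable (v_alpha \<alpha>)" "AE w in v_alpha \<alpha>. cmod (g w) \<le> 1"
proof -
  show "g \<in> borel_measurable (v_alpha \<alpha>)"
    using assms(1) by (simp add: Linf_def v_alpha_def)
  have "AE w in v_measure. ereal (cmod (g w)) \<le> Linf_norm g"
    unfolding Linf_norm_def by (rule esssup_AE)
  then have AE1: "AE w in v_measure. cmod (g w) \<le> 1"
  proof eventually_elim
    case (elim w)
    then have "ereal (cmod (g w)) \<le> 1" using assms(2) by (rule order_trans)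
    then show ?case by (simp add: one_ereal_def)
  qed
  show "AE w in v_alpha \<alpha>. cmod (g w) \<le> 1"
    unfolding v_alpha_def
  proof (subst AE_density)
    have "(\<lambda>z. ennreal (c_const CARD('a) \<alpha> * (1 - (norm z)\<^sup>2) powr \<alpha>)) \<in> borel_measurable (v_alpha \<alpha> :: (complex^'a) measure)"
      by (rule measurable_v_alpha_borel) measurable
    then show "(\<lambda>z. ennreal (c_const CARD('a) \<alpha> * (1 - (norm z)\<^sup>2) powr \<alpha>)) \<in> borel_measurable (v_measure :: (complex^'a) measure)"
      by (simp add: v_alpha_def)
  qed (use AE1 in \<open>auto elim: eventually_mono\<close>)
qed

lemma Linf_unit_ballI:
  fixes g :: "complex^'n \<Rightarrow> complex"
  assumes "g \<in> borel_measurable borel" "\<And>w. cmod (g w) \<le> 1"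
  shows "g \<in> Linf" "Linf_norm g \<le> 1"
proof -
  have m: "g \<in> borel_measurable v_measure"
    using measurable_v_alpha_borel[OF assms(1), of 0] by (simp add: v_alpha_def)
  then show "Linf_norm g \<le> 1"
    unfolding Linf_norm_def using assms(2) by (intro esssup_I) (auto simp: one_ereal_def)
  then show "g \<in> Linf" using m unfolding Linf_def by (auto simp: le_less_trans)
qed

text \<open>The quantity F(z, \<zeta>) of the overview.\<close>

definition bloch_bound :: "real \<Rightarrow> complex^'n \<Rightarrow> complex^'n \<Rightarrow> ennreal" where
  "bloch_bound \<alpha> z \<zeta> = (\<integral>\<^sup>+w. ennreal (cmod (bloch_kernel \<alpha> z \<zeta> w)) \<partial>v_alpha \<alpha>)"

text \<open>The direction is chosen after g: the norming vector turns the length of the gradient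
  into one integral of g against one kernel.\<close>

lemma norm_invariant_gradient_le:
  fixes g :: "complex^'n \<Rightarrow> complex"
  assumes n: "CARD('n) > 1" and \<alpha>: "\<alpha> > -1" and z: "norm z < 1" and g: "g \<in> Linf" "Linf_norm g \<le> 1"
  obtains \<zeta> where "norm \<zeta> = 1"
    "ennreal (norm (invariant_gradient (bergman_projection \<alpha> g) z)) \<le> bloch_bound \<alpha> z \<zeta>"
proof -
  note gm = Linf_unit_ball_AE[OF g, of \<alpha>]
  let ?G = "invariant_gradient (bergman_projection \<alpha> g) z"
  obtain \<zeta> where \<zeta>: "norm \<zeta> = 1" "(\<Sum>k\<in>UNIV. \<zeta> $ k * ?G $ k) = of_real (norm ?G)"
    by (rule ex_norming_vector)
  have "(LINT w|v_alpha \<alpha>. g w * bloch_kernel \<alpha> z \<zeta> w) = of_real (norm ?G)"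
    unfolding sum_invariant_gradient[OF n \<alpha> z gm, symmetric] by (rule \<zeta>(2))
  then have "ennreal (norm ?G) = ennreal (cmod (LINT w|v_alpha \<alpha>. g w * bloch_kernel \<alpha> z \<zeta> w))"
    by simp
  also have "\<dots> \<le> (\<integral>\<^sup>+w. ennreal (norm (g w * bloch_kernel \<alpha> z \<zeta> w)) \<partial>v_alpha \<alpha>)"
    by (rule integral_norm_bound_ennreal) (rule integrable_bloch_kernel[OF n \<alpha> z gm])
  also have "\<dots> \<le> bloch_bound \<alpha> z \<zeta>"
    unfolding bloch_bound_def
  proof (rule nn_integral_mono_AE)
    show "AE w in v_alpha \<alpha>. ennreal (norm (g w * bloch_kernel \<alpha> z \<zeta> w)) \<le> ennreal (cmod (bloch_kernel \<alpha> z \<zeta> w))"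
      using gm(2) by eventually_elim (simp add: norm_mult mult_left_le_one_le ennreal_leI)
  qed
  finally show ?thesis using that \<zeta>(1) by blast
qed

lemma bloch_bound_attained:
  fixes z \<zeta> :: "complex^'n"
  assumes n: "CARD('n) > 1" and \<alpha>: "\<alpha> > -1" and z: "norm z < 1" and \<zeta>: "norm \<zeta> = 1"
  obtains g where "g \<in> Linf" "Linf_norm g \<le> 1"
    "bloch_bound \<alpha> z \<zeta> \<le> ennreal (norm (invariant_gradient (bergman_projection \<alpha> g) z))"
proof -
  let ?k = "bloch_kernel \<alpha> z \<zeta>"
  \<comment> \<open>The conjugate sign of the kernel; where the kernel vanishes, division by zero
    gives 0, so |g| is at most 1 everywhere.\<close>
  define g where "g w = cnj (?k w / of_real (cmod (?k w)))" for w
  have g: "g \<in> Linf" "Linf_norm g \<le> 1"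
  proof -
    have "g \<in> borel_measurable borel" unfolding g_def by measurable
    moreover have "cmod (g w) \<le> 1" for w by (simp add: g_def norm_divide)
    ultimately show "g \<in> Linf" "Linf_norm g \<le> 1" by (auto intro: Linf_unit_ballI)
  qed
  note gm = Linf_unit_ball_AE[OF g, of \<alpha>]
  let ?G = "invariant_gradient (bergman_projection \<alpha> g) z"
  have gk: "g w * ?k w = of_real (cmod (?k w))" for w
    using complex_norm_square[of "?k w"] by (cases "?k w = 0") (auto simp: g_def power2_eq_square field_simps)
  have int: "integrable (v_alpha \<alpha>) (\<lambda>w. cmod (?k w))"
    using integrable_norm[OF integrable_bloch_kernel[OF n \<alpha> z gm, of \<zeta>]] by (simp add: gk)
  have "(\<Sum>k\<in>UNIV. \<zeta> $ k * ?G $ k) = of_real (LINT w|v_alpha \<alpha>. cmod (?k w))"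
    unfolding sum_invariant_gradient[OF n \<alpha> z gm] gk by (rule integral_complex_of_real)
  then have "(LINT w|v_alpha \<alpha>. cmod (?k w)) \<le> norm ?G"
    using norm_sum_mult_le[of \<zeta> ?G] \<zeta> by simp
  moreover have "bloch_bound \<alpha> z \<zeta> = ennreal (LINT w|v_alpha \<alpha>. cmod (?k w))"
    unfolding bloch_bound_def using int by (intro nn_integral_eq_integral) auto
  ultimately show ?thesis using that[OF g] by (simp add: ennreal_leI)
qed

text \<open>The differential at 0 is diagonal in this frame: \<open>- (1 - r\<^sup>2)\<close> along
  z and \<open>- sqrt (1 - r\<^sup>2)\<close> across it.\<close>

lemma phi_deriv_orthonormal:
  assumes "norm p = 1" "norm q = 1" "hinner p q = 0" "0 \<le> r"
  shows "phi_deriv (of_real r *s p) (a *s p + b *s q) =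
    - ((of_real (1 - r\<^sup>2) * a) *s p + (of_real (sqrt (1 - r\<^sup>2)) * b) *s q)"
proof -
  have qp: "hinner q p = 0" using cnj_hinner[of p q] assms by simp
  have h: "hinner (a *s p + b *s q) (of_real r *s p) = a * of_real r"
    using assms qp by (simp add: hinner_add_left hinner_scale_left hinner_scale_right hinner_self)
  have nz: "norm (of_real r *s p) = r"
    using assms by (simp add: norm_vec_scale)
  show ?thesis
  proof (cases "r = 0")
    case True
    then show ?thesis by (simp add: phi_deriv_def Let_def)
  next
    case False
    then have "(a * of_real r / of_real (r\<^sup>2)) *s (of_real r *s p) = a *s p"
      by (simp add: vector_smult_assoc power2_eq_square)
    then show ?thesis
      unfolding phi_deriv_def Let_def h nz
      by (simp add: vec_eq_iff algebra_simps power2_eq_square)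
  qed
qed

lemma bloch_bound_eq_int2:
  fixes p q :: "complex^'n"
  assumes n: "CARD('n) > 1" and \<alpha>: "\<alpha> > -1" and r: "0 \<le> r" "r < 1"
    and pq: "norm p = 1" "norm q = 1" "hinner p q = 0" and N: "N = real CARD('n) + 1 + \<alpha>"
  shows "bloch_bound \<alpha> (of_real r *s p) (a *s p + b *s q) = ennreal N *
    int2 N (\<lambda>x y. cmod (cnj a * (x - of_real r) + cnj b * y) / cmod (1 - of_real r * x) powr N)"
proof -
  let ?s = "sqrt (1 - r\<^sup>2)"
  have N2: "2 < N" using n \<alpha> by (simp add: N)
  define H where "H x y = cmod (of_real (1 - r\<^sup>2) * cnj a * x + of_real ?s * cnj b * y) / cmod (1 - of_real r * x) powr (N + 1)" for x y
  have [measurable]: "case_prod H \<in> borel_measurable (borel \<Otimes>\<^sub>M borel)"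
    unfolding H_def by measurable
  have *: "cmod (bloch_kernel \<alpha> (of_real r *s p) (a *s p + b *s q) w) = N * H (hinner w p) (hinner w q)" for w
  proof -
    \<comment> \<open>The kernel contains w in the second slot of \<open>hinner\<close>, the
      coordinate law uses the first; taking conjugates moves the conjugation onto a and b.\<close>
    have "cmod (hinner (phi_deriv (of_real r *s p) (a *s p + b *s q)) w) =
      cmod (cnj (of_real (1 - r\<^sup>2) * a * hinner p w + of_real ?s * b * hinner q w))"
      unfolding phi_deriv_orthonormal[OF pq r(1)] hinner_minus_left hinner_add_left hinner_scale_left
      by (simp only: norm_minus_cancel complex_mod_cnj)
    also have "\<dots> = cmod (of_real (1 - r\<^sup>2) * cnj a * hinner w p + of_real ?s * cnj b * hinner w q)"
      by (simp only: complex_cnj_add complex_cnj_mult complex_cnj_complex_of_real cnj_hinner)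
    finally have 1: "cmod (hinner (phi_deriv (of_real r *s p) (a *s p + b *s q)) w) = \<dots>" .
    have "cmod (1 - hinner (of_real r *s p) w) = cmod (cnj (1 - of_real r * hinner p w))"
      by (simp only: hinner_scale_left complex_mod_cnj)
    also have "\<dots> = cmod (1 - of_real r * hinner w p)"
      by (simp add: cnj_hinner)
    finally show ?thesis
      unfolding cmod_bloch_kernel[OF \<alpha>] 1 H_def N by simp
  qed
  have "bloch_bound \<alpha> (of_real r *s p) (a *s p + b *s q) = (\<integral>\<^sup>+w. ennreal N * ennreal (H (hinner w p) (hinner w q)) \<partial>v_alpha \<alpha>)"
    unfolding bloch_bound_def * using N2 by (intro nn_integral_cong ennreal_mult) (auto simp: H_def)
  also have "\<dots> = ennreal N * (\<integral>\<^sup>+w. ennreal (H (hinner w p) (hinner w q)) \<partial>v_alpha \<alpha>)"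
  proof (rule nn_integral_cmult, rule measurable_v_alpha_borel)
    have [measurable]: "(\<lambda>w. hinner w u) \<in> borel_measurable borel" for u :: "complex^'n"
      unfolding hinner_def by measurable
    show "(\<lambda>w. ennreal (H (hinner w p) (hinner w q))) \<in> borel_measurable borel"
      unfolding H_def by measurable
  qed
  also have "\<dots> = ennreal N * int2 N H"
    unfolding N by (subst nn_integral_v_alpha_orthonormal[OF pq n \<alpha>]) auto
  also have "\<dots> = ennreal N * int2 N (\<lambda>x y. cmod (cnj a * (x - of_real r) + cnj b * y) / cmod (1 - of_real r * x) powr N)"
    unfolding H_def int2_mobius[OF r N2] ..
  finally show ?thesis .
qed

lemma norm_orthonormal_combination:
  assumes "norm p = 1" "norm q = 1" "hinner p q = 0"
  shows "(norm (a *s p + b *s q))\<^sup>2 = (cmod a)\<^sup>2 + (cmod b)\<^sup>2"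
proof -
  have qp: "hinner q p = 0" using cnj_hinner[of p q] assms by simp
  let ?u = "a *s p + b *s q"
  have "hinner ?u p = a" "hinner ?u q = b"
    using assms qp by (simp_all add: hinner_add_left hinner_scale_left hinner_self)
  then have "hinner p ?u = cnj a" "hinner q ?u = cnj b"
    using cnj_hinner[of ?u p] cnj_hinner[of ?u q] by simp_all
  then have "complex_of_real ((norm ?u)\<^sup>2) = a * cnj a + b * cnj b"
    unfolding hinner_self[symmetric] by (subst hinner_add_left) (simp add: hinner_scale_left)
  also have "\<dots> = complex_of_real ((cmod a)\<^sup>2 + (cmod b)\<^sup>2)"
    unfolding of_real_add complex_norm_square ..
  finally show ?thesis by (simp only: of_real_eq_iff)
qed

lemma bloch_bound_le_boundary_int:
  fixes z \<zeta> :: "complex^'n"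
  assumes n: "CARD('n) > 1" and \<alpha>: "\<alpha> > -1" and z: "norm z < 1" and \<zeta>: "norm \<zeta> = 1"
    and N: "N = real CARD('n) + 1 + \<alpha>"
  obtains t where "0 \<le> t" "t \<le> pi / 2" "bloch_bound \<alpha> z \<zeta> \<le> ennreal N * boundary_int N (cos t) (sin t)"
proof -
  obtain p q a b where pq: "norm p = 1" "norm q = 1" "hinner p q = 0"
    and z': "z = of_real (norm z) *s p" and \<zeta>': "\<zeta> = a *s p + b *s q"
    using ex_orthonormal_decomposition[OF n] .
  have "(cmod a)\<^sup>2 + (cmod b)\<^sup>2 = 1"
    using norm_orthonormal_combination[OF pq, of a b] \<zeta> \<zeta>' by simp
  then obtain t where t: "0 \<le> t" "t \<le> pi / 2" "cmod a = cos t" "cmod b = sin t"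
    using sincos_total_pi_half[of "cmod a" "cmod b"] by auto
  have "bloch_bound \<alpha> z \<zeta> = bloch_bound \<alpha> (of_real (norm z) *s p) (a *s p + b *s q)"
    using z' \<zeta>' by simp
  also have "\<dots> \<le> ennreal N * boundary_int N (cmod (cnj a)) (cmod (cnj b))"
    unfolding bloch_bound_eq_int2[OF n \<alpha> norm_ge_zero z pq N]
    by (intro mult_left_mono int2_le_boundary_int) (use n \<alpha> z N in auto)
  finally show ?thesis using that t by simp
qed

text \<open>The real integral in \<open>ell\<close> matches the extended one only once integrability
  is known. It is read off at the two end points, and the triangle inequality carries it to all
  coefficients. The same inequality gives the second claim, and the third is the modulus of
  continuity used for the maximum.\<close>

lemma ell_eq_boundary_int:
  fixes i j :: "'n::finite"
  assumes ij: "i \<noteq> j" and \<alpha>: "\<alpha> > -1" and N: "N = real CARD('n) + 1 + \<alpha>" and n: "CARD('n) > 1"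
  shows "ennreal (ell i j \<alpha> t) = ennreal N * boundary_int N (cos t) (sin t)"
    and "ell i j \<alpha> t \<le> \<bar>cos t\<bar> * ell i j \<alpha> 0 + \<bar>sin t\<bar> * ell i j \<alpha> (pi / 2)"
    and "\<bar>ell i j \<alpha> t - ell i j \<alpha> s\<bar> \<le> \<bar>cos t - cos s\<bar> * ell i j \<alpha> 0 + \<bar>sin t - sin s\<bar> * ell i j \<alpha> (pi / 2)"
    and "0 \<le> ell i j \<alpha> t"
proof -
  let ?V = "v_alpha \<alpha> :: (complex^'n) measure"
  define h where "h A B w = cmod ((1 - w $ i) * of_real A + w $ j * of_real B) / cmod (w $ i - 1) powr N"
    for A B and w :: "complex^'n"
  have N2: "2 < N" using n \<alpha> by (simp add: N)
  have m: "h A B \<in> borel_measurable ?V" for A B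
    unfolding h_def by (rule measurable_v_alpha_borel) measurable
  have nn: "(\<integral>\<^sup>+w. ennreal (h A B w) \<partial>?V) = boundary_int N A B" for A B
    unfolding h_def boundary_int_def
    by (rule nn_integral_v_alpha_coordinates[OF ij \<alpha> _ N,
          of "\<lambda>x y. cmod ((1 - x) * of_real A + y * of_real B) / cmod (x - 1) powr N"]) measurable
  have i10: "integrable ?V (h 1 0)" and i01: "integrable ?V (h 0 1)"
    using m nn[of 1 0] nn[of 0 1] boundary_int_1_0[OF N2] boundary_int_0_1[OF N2]
    by (auto intro!: integrableI_bounded simp: h_def)
  have tri: "h A B w \<le> \<bar>A\<bar> * h 1 0 w + \<bar>B\<bar> * h 0 1 w" for A B w
  proof -
    have "cmod ((1 - w $ i) * of_real A + w $ j * of_real B) \<le> \<bar>A\<bar> * cmod (1 - w $ i) + \<bar>B\<bar> * cmod (w $ j)"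
      by (rule order_trans[OF norm_triangle_ineq]) (simp add: norm_mult mult.commute)
    then show ?thesis unfolding h_def
      by (simp add: divide_right_mono flip: add_divide_distrib)
  qed
  have nonneg: "0 \<le> h A B w" for A B w by (simp add: h_def)
  have int: "integrable ?V (h A B)" for A B
  proof (rule Bochner_Integration.integrable_bound)
    show "integrable ?V (\<lambda>w. \<bar>A\<bar> * h 1 0 w + \<bar>B\<bar> * h 0 1 w)" using i10 i01 by simp
    show "AE w in ?V. norm (h A B w) \<le> norm (\<bar>A\<bar> * h 1 0 w + \<bar>B\<bar> * h 0 1 w)"
    proof (rule AE_I2)
      fix w
      show "norm (h A B w) \<le> norm (\<bar>A\<bar> * h 1 0 w + \<bar>B\<bar> * h 0 1 w)"
        using tri[of A B w] nonneg[of A B w] by (simp add: nonneg)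
    qed
  qed (rule m)
  have ell: "ell i j \<alpha> t = N * (LINT w|?V. h (cos t) (sin t) w)" for t
    by (simp add: ell_def h_def N)
  have ell0: "ell i j \<alpha> 0 = N * (LINT w|?V. h 1 0 w)" and ell1: "ell i j \<alpha> (pi / 2) = N * (LINT w|?V. h 0 1 w)"
    by (simp_all add: ell)
  show "0 \<le> ell i j \<alpha> t" unfolding ell using N2 nonneg by simp
  have "ennreal (LINT w|?V. h (cos t) (sin t) w) = boundary_int N (cos t) (sin t)"
    unfolding nn[symmetric] using int nonneg by (intro nn_integral_eq_integral[symmetric]) auto
  then show "ennreal (ell i j \<alpha> t) = ennreal N * boundary_int N (cos t) (sin t)"
    unfolding ell using N2 by (simp add: ennreal_mult')
  have lin: "(LINT w|?V. \<bar>A\<bar> * h 1 0 w + \<bar>B\<bar> * h 0 1 w) = \<bar>A\<bar> * (LINT w|?V. h 1 0 w) + \<bar>B\<bar> * (LINT w|?V. h 0 1 w)" for A B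
    using i10 i01 by simp
  have le: "N * (LINT w|?V. h A B w) \<le> \<bar>A\<bar> * ell i j \<alpha> 0 + \<bar>B\<bar> * ell i j \<alpha> (pi / 2)" for A B
  proof -
    have "(LINT w|?V. h A B w) \<le> (LINT w|?V. \<bar>A\<bar> * h 1 0 w + \<bar>B\<bar> * h 0 1 w)"
      using i10 i01 int tri by (intro integral_mono) auto
    then have "N * (LINT w|?V. h A B w) \<le> N * (\<bar>A\<bar> * (LINT w|?V. h 1 0 w) + \<bar>B\<bar> * (LINT w|?V. h 0 1 w))"
      using N2 unfolding lin by (intro mult_left_mono) auto
    then show ?thesis by (simp add: ell0 ell1 algebra_simps)
  qed
  show "ell i j \<alpha> t \<le> \<bar>cos t\<bar> * ell i j \<alpha> 0 + \<bar>sin t\<bar> * ell i j \<alpha> (pi / 2)"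
    unfolding ell[of t] by (rule le)
  \<comment> \<open>By the reverse triangle inequality the integrands differ by at most the
    integrand formed with the differences of the coefficients.\<close>
  have "\<bar>(LINT w|?V. h (cos t) (sin t) w) - (LINT w|?V. h (cos s) (sin s) w)\<bar> \<le> (LINT w|?V. h (cos t - cos s) (sin t - sin s) w)"
  proof -
    have "\<bar>h (cos t) (sin t) w - h (cos s) (sin s) w\<bar> \<le> h (cos t - cos s) (sin t - sin s) w" for w
    proof -
      let ?u = "\<lambda>A B. (1 - w $ i) * of_real A + w $ j * of_real B"
      have "\<bar>cmod (?u (cos t) (sin t)) - cmod (?u (cos s) (sin s))\<bar> \<le> cmod (?u (cos t) (sin t) - ?u (cos s) (sin s))"
        by (rule norm_triangle_ineq3)
      also have "?u (cos t) (sin t) - ?u (cos s) (sin s) = ?u (cos t - cos s) (sin t - sin s)"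
        by (simp add: algebra_simps)
      finally show ?thesis
        unfolding h_def diff_divide_distrib[symmetric] abs_divide by (simp add: divide_right_mono)
    qed
    then have "(LINT w|?V. \<bar>h (cos t) (sin t) w - h (cos s) (sin s) w\<bar>) \<le> (LINT w|?V. h (cos t - cos s) (sin t - sin s) w)"
      using int by (intro integral_mono) auto
    moreover have "\<bar>LINT w|?V. h (cos t) (sin t) w - h (cos s) (sin s) w\<bar> \<le> (LINT w|?V. \<bar>h (cos t) (sin t) w - h (cos s) (sin s) w\<bar>)"
      by (rule integral_abs_bound)
    ultimately show ?thesis using int by simp
  qed
  then have "N * \<bar>(LINT w|?V. h (cos t) (sin t) w) - (LINT w|?V. h (cos s) (sin s) w)\<bar> \<le> N * (LINT w|?V. h (cos t - cos s) (sin t - sin s) w)"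
    using N2 by (intro mult_left_mono) auto
  also note le
  finally show "\<bar>ell i j \<alpha> t - ell i j \<alpha> s\<bar> \<le> \<bar>cos t - cos s\<bar> * ell i j \<alpha> 0 + \<bar>sin t - sin s\<bar> * ell i j \<alpha> (pi / 2)"
    unfolding ell[of t] ell[of s] using N2 by (simp add: abs_mult flip: right_diff_distrib)
qed

lemma ell_values:
  fixes i j :: "'n::finite"
  assumes "CARD('n) > 1" "i \<noteq> j" "\<alpha> > -1"
  shows "ell i j \<alpha> 0 = C_const \<alpha> CARD('n)" "ell i j \<alpha> (pi / 2) = pi / 2 * C_const \<alpha> CARD('n)"
proof -
  define N where "N = real CARD('n) + 1 + \<alpha>"
  have N: "2 < N" using assms by (simp add: N_def)
  \<comment> \<open>The common factor of the two end point values, which are b/pi and b/2.\<close>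
  define b where "b = 2 powr (N - 1) * Beta (1/2) (N / 2)"
  have b: "0 \<le> b"
    using N by (auto simp: b_def Beta_def intro!: mult_nonneg_nonneg divide_nonneg_nonneg Gamma_real_nonneg)
  have C: "N * (b / pi) = C_const \<alpha> CARD('n)"
    using N_times_boundary_value[OF N] unfolding b_def C_const_def by (simp add: N_def add_ac)
  note e = ell_eq_boundary_int(1)[OF assms(2,3) N_def assms(1)] and e0 = ell_eq_boundary_int(4)[OF assms(2,3) N_def assms(1)]
  have "ennreal (ell i j \<alpha> 0) = ennreal N * ennreal (b / pi)"
    using e[of 0] boundary_int_1_0[OF N] by (simp add: b_def)
  also have "\<dots> = ennreal (N * (b / pi))" using N b by (intro ennreal_mult[symmetric]) auto
  finally have "ennreal (ell i j \<alpha> 0) = ennreal (N * (b / pi))" .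
  then show "ell i j \<alpha> 0 = C_const \<alpha> CARD('n)"
    using e0[of 0] N b C by (simp add: ennreal_inj)
  have "ennreal (ell i j \<alpha> (pi / 2)) = ennreal N * ennreal (b / 2)"
    using e[of "pi / 2"] boundary_int_0_1[OF N] by (simp add: b_def)
  also have "\<dots> = ennreal (N * (b / 2))" using N b by (intro ennreal_mult[symmetric]) auto
  finally have "ennreal (ell i j \<alpha> (pi / 2)) = ennreal (N * (b / 2))" .
  then have "ell i j \<alpha> (pi / 2) = N * (b / 2)"
    using e0[of "pi / 2"] N b by (simp add: ennreal_inj)
  also have "\<dots> = pi / 2 * (N * (b / pi))" by simp
  finally show "ell i j \<alpha> (pi / 2) = pi / 2 * C_const \<alpha> CARD('n)" unfolding C .
qed

theorem theorem1p3:
  fixes i j :: "'n::finite" and \<alpha> :: real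
  assumes "CARD('n) > 1" and "i \<noteq> j" and "\<alpha> > -1"
  shows "ell i j \<alpha> (pi / 2) = pi / 2 * ell i j \<alpha> 0 \<and>
    pi / 2 * ell i j \<alpha> 0 = pi / 2 * C_const \<alpha> CARD('n) \<and>
    (\<exists>t0\<in>{0..pi / 2}. (\<forall>t\<in>{0..pi / 2}. ell i j \<alpha> t \<le> ell i j \<alpha> t0) \<and>
       bergman_bloch_norm TYPE('n) \<alpha> = ereal (ell i j \<alpha> t0)) \<and>
    ereal (pi / 2 * C_const \<alpha> CARD('n)) \<le> bergman_bloch_norm TYPE('n) \<alpha> \<and>
    bergman_bloch_norm TYPE('n) \<alpha> \<le> ereal (sqrt (pi\<^sup>2 + 4) / 2 * C_const \<alpha> CARD('n))"
proof -
  define N where "N = real CARD('n) + 1 + \<alpha>"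
  have N: "2 < N" using assms by (simp add: N_def)
  let ?C = "C_const \<alpha> CARD('n)"
  let ?B = "bergman_bloch_norm TYPE('n) \<alpha>"
  note ell = ell_eq_boundary_int[OF assms(2,3) N_def assms(1)]
  note val = ell_values[OF assms]
  have C: "0 \<le> ?C" using ell(4)[of 0] by (simp add: val)
  have "continuous_on {0..pi / 2} (ell i j \<alpha>)"
    unfolding continuous_on_def
  proof
    fix s
    show "(ell i j \<alpha> \<longlongrightarrow> ell i j \<alpha> s) (at s within {0..pi / 2})"
    proof (rule LIM_zero_cancel, rule Lim_null_comparison)
      show "\<forall>\<^sub>F t in at s within {0..pi / 2}. norm (ell i j \<alpha> t - ell i j \<alpha> s) \<le>
          \<bar>cos t - cos s\<bar> * ell i j \<alpha> 0 + \<bar>sin t - sin s\<bar> * ell i j \<alpha> (pi / 2)"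
        using ell(3) by (simp add: always_eventually)
      have "((\<lambda>t. \<bar>cos t - cos s\<bar> * ell i j \<alpha> 0 + \<bar>sin t - sin s\<bar> * ell i j \<alpha> (pi / 2)) \<longlongrightarrow>
          \<bar>cos s - cos s\<bar> * ell i j \<alpha> 0 + \<bar>sin s - sin s\<bar> * ell i j \<alpha> (pi / 2)) (at s within {0..pi / 2})"
        by (intro tendsto_intros)
      then show "((\<lambda>t. \<bar>cos t - cos s\<bar> * ell i j \<alpha> 0 + \<bar>sin t - sin s\<bar> * ell i j \<alpha> (pi / 2)) \<longlongrightarrow> 0) (at s within {0..pi / 2})"
        by simp
    qed
  qed
  \<comment> \<open>A maximum point exists because the interval is compact.\<close>
  then obtain t0 where t0: "t0 \<in> {0..pi / 2}" "\<And>t. t \<in> {0..pi / 2} \<Longrightarrow> ell i j \<alpha> t \<le> ell i j \<alpha> t0"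
    using continuous_attains_sup[of "{0..pi / 2}" "ell i j \<alpha>"] by auto
  have upper: "?B \<le> ereal (ell i j \<alpha> t0)"
    unfolding bergman_bloch_norm_def bloch_seminorm_def
  proof (intro SUP_least)
    fix g :: "complex^'n \<Rightarrow> complex" and z :: "complex^'n"
    assume g: "g \<in> {g \<in> Linf. Linf_norm g \<le> 1}" and z: "z \<in> ball 0 1"
    let ?G = "norm (invariant_gradient (bergman_projection \<alpha> g) z)"
    obtain \<zeta> where \<zeta>: "norm \<zeta> = 1" "ennreal ?G \<le> bloch_bound \<alpha> z \<zeta>"
      using norm_invariant_gradient_le[OF assms(1,3), of z g] g z by auto
    obtain t where t: "0 \<le> t" "t \<le> pi / 2" "bloch_bound \<alpha> z \<zeta> \<le> ennreal N * boundary_int N (cos t) (sin t)"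
      using bloch_bound_le_boundary_int[OF assms(1,3) _ \<zeta>(1) N_def, of z] z by auto
    have "ennreal ?G \<le> ennreal (ell i j \<alpha> t)" using \<zeta>(2) t(3) unfolding ell(1) by (rule order_trans)
    then have "?G \<le> ell i j \<alpha> t" using ell(4) by (simp add: ennreal_le_iff)
    then show "ereal ?G \<le> ereal (ell i j \<alpha> t0)" using t0(2)[of t] t by simp
  qed
  \<comment> \<open>The norm is a supremum in the extended reals, so it is compared with its real
    upper bounds c. Each c bounds the integrals for all r < 1 with z on axis i, and Fatou carries
    the bound to r = 1.\<close>
  have lower: "ell i j \<alpha> t0 \<le> c" if c: "?B \<le> ereal c" for c
  proof -
    have gle: "norm (invariant_gradient (bergman_projection \<alpha> g) z) \<le> c"
      if "g \<in> Linf" "Linf_norm g \<le> 1" "norm z < 1" for g and z :: "complex^'n"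
    proof -
      have "ereal (norm (invariant_gradient (bergman_projection \<alpha> g) z)) \<le> bloch_seminorm (bergman_projection \<alpha> g)"
        unfolding bloch_seminorm_def using that by (intro SUP_upper) auto
      also have "\<dots> \<le> ?B"
        unfolding bergman_bloch_norm_def using that by (intro SUP_upper) auto
      also note c
      finally show ?thesis by simp
    qed
    have p: "norm (axis i 1 :: complex^'n) = 1" "norm (axis j 1 :: complex^'n) = 1"
      "hinner (axis i 1) (axis j 1 :: complex^'n) = 0"
      using assms(2) by (simp_all add: norm_axis_complex hinner_axis_right) (simp add: axis_def)
    have bb: "ennreal N * int2 N (\<lambda>x y. cmod (of_real (cos t0) * (x - of_real r) + of_real (- sin t0) * y) / cmod (1 - of_real r * x) powr N)
      \<le> ennreal c" if r: "0 \<le> r" "r < 1" for r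
    proof -
      let ?z = "of_real r *s axis i 1 :: complex^'n"
      \<comment> \<open>The minus sign matches the reversed sign of B in
        \<open>boundary_int_le\<close>.\<close>
      let ?\<zeta> = "of_real (cos t0) *s axis i 1 + of_real (- sin t0) *s axis j 1 :: complex^'n"
      have z: "norm ?z < 1" using r by (simp add: norm_vec_scale norm_axis_complex)
      have "(norm ?\<zeta>)\<^sup>2 = 1"
        unfolding norm_orthonormal_combination[OF p] by simp
      moreover have "u = 1" if "u\<^sup>2 = 1" "0 \<le> u" for u :: real
        using that by (auto simp: power2_eq_1_iff)
      ultimately have "norm ?\<zeta> = 1" using norm_ge_zero by blast
      from bloch_bound_attained[OF assms(1,3) z this] obtain g where g: "g \<in> Linf" "Linf_norm g \<le> 1"
        "bloch_bound \<alpha> ?z ?\<zeta> \<le> ennreal (norm (invariant_gradient (bergman_projection \<alpha> g) ?z))"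
        by blast
      note g(3)
      also have "ennreal (norm (invariant_gradient (bergman_projection \<alpha> g) ?z)) \<le> ennreal c"
        by (intro ennreal_leI gle g z)
      finally show ?thesis
        unfolding bloch_bound_eq_int2[OF assms(1,3) r p N_def] by simp
    qed
    have c0: "0 \<le> c"
      using gle[of "\<lambda>_. 0" 0] Linf_unit_ballI[of "\<lambda>_::complex^'n. 0::complex"] by (auto intro: order_trans[OF norm_ge_zero])
    have "boundary_int N (cos t0) (sin t0) \<le> ennreal (c / N)"
    proof (rule boundary_int_le[OF N])
      fix r :: real assume r: "0 \<le> r" "r < 1"
      \<comment> \<open>Cancelling N among extended reals is legitimate because N is positive and
        finite.\<close>
      have "ennreal (1 / N) * (ennreal N * u) = u" for u
        using N by (simp add: mult.assoc[symmetric] ennreal_mult[symmetric])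
      moreover have "ennreal (1 / N) * ennreal c = ennreal (c / N)"
        using N c0 by (simp add: ennreal_mult[symmetric])
      ultimately show "int2 N (\<lambda>x y. cmod (of_real (cos t0) * (x - of_real r) + of_real (- sin t0) * y) / cmod (1 - of_real r * x) powr N) \<le> ennreal (c / N)"
        using mult_left_mono[OF bb[OF r], of "ennreal (1 / N)"] by simp
    qed
    then have "ennreal (ell i j \<alpha> t0) \<le> ennreal N * ennreal (c / N)"
      unfolding ell(1) by (intro mult_left_mono) auto
    also have "\<dots> = ennreal c" using N c0 by (simp add: ennreal_mult[symmetric])
    finally show ?thesis using c0 by (simp add: ennreal_le_iff)
  qed
  have B: "?B = ereal (ell i j \<alpha> t0)"
  proof (rule antisym[OF upper])
    show "ereal (ell i j \<alpha> t0) \<le> ?B"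
      by (rule ereal_le_real) (use lower in simp)
  qed
  have "pi / 2 * ?C \<le> ell i j \<alpha> t0"
    using t0(2)[of "pi / 2"] by (simp add: val)
  moreover have "ell i j \<alpha> t0 \<le> sqrt (pi\<^sup>2 + 4) / 2 * ?C"
  proof -
    have "\<bar>cos t0\<bar> * 1 + \<bar>sin t0\<bar> * (pi / 2) \<le> sqrt (1 + (pi / 2)\<^sup>2)"
    proof (rule real_le_rsqrt)
      \<comment> \<open>Cauchy-Schwarz by Lagrange's identity; 1 and pi/2 are the end point values
        in units of \<open>C_const\<close>.\<close>
      have "(x * 1 + y * p)\<^sup>2 \<le> (x\<^sup>2 + y\<^sup>2) * (1 + p\<^sup>2)" for x y p :: real
      proof -
        have "(x\<^sup>2 + y\<^sup>2) * (1 + p\<^sup>2) = (x * 1 + y * p)\<^sup>2 + (x * p - y)\<^sup>2"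
          by (simp add: power2_eq_square algebra_simps)
        then show ?thesis by simp
      qed
      from this[of "\<bar>cos t0\<bar>" "\<bar>sin t0\<bar>" "pi / 2"]
      show "(\<bar>cos t0\<bar> * 1 + \<bar>sin t0\<bar> * (pi / 2))\<^sup>2 \<le> 1 + (pi / 2)\<^sup>2"
        by simp
    qed
    also have "\<dots> = sqrt (pi\<^sup>2 + 4) / 2"
    proof -
      have "1 + (pi / 2)\<^sup>2 = (pi\<^sup>2 + 4) / 2\<^sup>2" by (simp add: power_divide)
      then have "sqrt (1 + (pi / 2)\<^sup>2) = sqrt (pi\<^sup>2 + 4) / sqrt (2\<^sup>2)" by (simp only: real_sqrt_divide)
      then show ?thesis by simp
    qed
    finally have "(\<bar>cos t0\<bar> * 1 + \<bar>sin t0\<bar> * (pi / 2)) * ?C \<le> sqrt (pi\<^sup>2 + 4) / 2 * ?C"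
      using C by (rule mult_right_mono)
    then show ?thesis using ell(2)[of t0] unfolding val by (simp add: algebra_simps)
  qed
  ultimately show ?thesis
    using t0 unfolding val B by (intro conjI bexI[of _ t0] ballI) simp_all
qed

end
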